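(* Let $P$ be a $3$-dimensional simple convex polytope, let $\pi:M\to P$ be a small cover over $P$, and let $F_1,F_2,F_3,F_4$ be a $4$-belt in $P$. Let $F\subset P$ be the square cross section determined by the $4$-belt, and let $M_F$ be the sectional submanifold determined by $F$. Let $i_*:\pi_1(M_F)\to\pi_1(M)$ be the homomorphism induced by the inclusion $M_F\subset M$, and let $j_*:W_F\to W_P$ be the homomorphism defined by $j_*(s_i)=t_{F_i}$ for $i=1,2,3,4$. Then both $i_*$ and $j_*$ are injective.
   Context: A simple $3$-polytope is a $3$-dimensional convex polytope in which every vertex lies in exactly three facets ($2$-dimensional faces). Let $\mathcal{F}(P)$ be the set of facets of $P$. Small cover: a characteristic map is a map $\lambda:\mathcal{F}(P)\to\mathbb{Z}_2^3$ ($\mathbb{Z}_2^3$ written multiplicatively) such that for any three facets meeting at a vertex their images under $\lambda$ form a basis of $\mathbb{Z}_2^3$. For a proper face $f$ of $P$ let $G_f$ be the subgroup of $\mathbb{Z}_2^3$ generated by $\{\lambda(F')\mid F'\in\mathcal{F}(P),\ f\subset F'\}$, and let $G_P=\{1\}$. The small cover is the closed $3$-manifold $M=P\times\mathbb{Z}_2^3/\sim$, where $(p,g)\sim(q,h)$ if and only if $p=q$ and $g^{-1}h\in G_{f(p)}$, with $f(p)$ the unique face of $P$ containing $p$ in its relative interior; $\pi:M\to P$ is the projection induced by $(p,g)\mapsto p$. $4$-belt: a set of four distinct facets $F_1,F_2,F_3,F_4$ of $P$ such that $F_1\cap F_2$, $F_2\cap F_3$, $F_3\cap F_4$, $F_4\cap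 F_1$ are all nonempty, no three of the four facets have a common point, and $F_1\cap F_3=F_2\cap F_4=\varnothing$. Cross section: the $4$-belt determines a simple loop $c$ on $\partial P$ running cyclically through $F_1,F_2,F_3,F_4$ and crossing transversely, once each, the interiors of exactly the four edges $F_1\cap F_2$, $F_2\cap F_3$, $F_3\cap F_4$, $F_4\cap F_1$. The loop $c$ bounds a properly embedded square $F$ in $P$ (a disc with $F\cap\partial P=c$) whose edges are $f_i=F\cap F_i$, $i=1,2,3,4$. Sectional submanifold: the surface $\pi^{-1}(F)\subset M$, which is $F\times\mathbb{Z}_2^3$ glued along its edges according to the colors $\lambda(F_i)$ on $f_i$. If $\lambda(F_1),\dots,\lambda(F_4)$ generate $\mathbb{Z}_2^3$, then $\pi^{-1}(F)$ is connected (a torus or a Klein bottle) and $M_F=\pi^{-1}(F)$. If they generate a subgroup isomorphic to $\mathbb{Z}_2^2$, then $\pi^{-1}(F)$ is a disjoint union of two tori or of two Klein bottles, and $M_F$ denotes one of these two components. Coxeter groups: $W_P=\langle t_{F'},\ F'\in\mathcal{F}(P)\mid t_{F'}^2=1\ \text{for all } F';\ (t_{F'}t_{F''})^2=1\ \text{whenever } F'\cap F''\neq\varnothing\rangle$ and $W_F=\langle s_1,s_2,s_3,s_4\mid s_1^2=s_2^2=s_3^2=s_4^2=1,\ (s_1s_2)^2=(s_2s_3)^2=(s_3s_4)^2=(s_4s_1)^2=1\rangle$. *)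

theory Defs
  imports "HOL-Analysis.Analysis" "HOL-Library.Z2" "HOL-Algebra.Generated_Groups"
begin

definition quotient_topology :: "'a topology \<Rightarrow> ('a \<times> 'a) set \<Rightarrow> 'a set topology" where
  "quotient_topology X r =
     topology (\<lambda>U. U \<subseteq> topspace X // r \<and> openin X {x \<in> topspace X. r `` {x} \<in> U})"

lemma openin_quotient_topology:
  "openin (quotient_topology X r) U \<longleftrightarrow>
     U \<subseteq> topspace X // r \<and> openin X {x \<in> topspace X. r `` {x} \<in> U}"
proof -
  have "istopology (\<lambda>U. U \<subseteq> topspace X // r \<and> openin X {x \<in> topspace X. r `` {x} \<in> U})"
    unfolding istopology_def
  proof (intro conjI allI impI)
    fix S T
    assume S: "S \<subseteq> topspace X // r \<and> openin X {x \<in> topspace X. r `` {x} \<in> S}"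
       and T: "T \<subseteq> topspace X // r \<and> openin X {x \<in> topspace X. r `` {x} \<in> T}"
    have "{x \<in> topspace X. r `` {x} \<in> S \<inter> T} =
          {x \<in> topspace X. r `` {x} \<in> S} \<inter> {x \<in> topspace X. r `` {x} \<in> T}"
      by blast
    then show "openin X {x \<in> topspace X. r `` {x} \<in> S \<inter> T}"
      using openin_Int[OF conjunct2[OF S] conjunct2[OF T]] by simp
    show "S \<inter> T \<subseteq> topspace X // r" using conjunct1[OF S] by (rule le_infI1)
  next
    fix K
    assume K: "\<forall>S\<in>K. S \<subseteq> topspace X // r \<and> openin X {x \<in> topspace X. r `` {x} \<in> S}"
    have "{x \<in> topspace X. r `` {x} \<in> \<Union>K} = (\<Union>S\<in>K. {x \<in> topspace X. r `` {x} \<in> S})"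
      by blast
    moreover have "openin X (\<Union>S\<in>K. {x \<in> topspace X. r `` {x} \<in> S})"
      using K by (intro openin_Union) blast
    ultimately show "openin X {x \<in> topspace X. r `` {x} \<in> \<Union>K}"
      by (simp only:)
    show "\<Union>K \<subseteq> topspace X // r" using K by (simp add: Union_least)
  qed
  then show ?thesis
    unfolding quotient_topology_def by (simp only: topology_inverse')
qed

lemma topspace_quotient_topology [simp]: "topspace (quotient_topology X r) = topspace X // r"
proof -
  have "{x \<in> topspace X. r `` {x} \<in> topspace X // r} = topspace X"
    by (blast intro: quotientI)
  then have "openin (quotient_topology X r) (topspace X // r)"
    by (simp add: openin_quotient_topology)
  moreover have "topspace (quotient_topology X r) \<subseteq> topspace X // r"
    using openin_topspace[of "quotient_topology X r"] by (simp only: openin_quotient_topology)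
  ultimately show ?thesis
    by (intro subset_antisym openin_subset)
qed

lemma quotient_map_quotient_topology:
  "quotient_map X (quotient_topology X r) (\<lambda>x. r `` {x})"
  unfolding quotient_map_def
proof (intro conjI allI impI)
  show "(\<lambda>x. r `` {x}) ` topspace X = topspace (quotient_topology X r)"
    unfolding topspace_quotient_topology quotient_def by blast
next
  fix U
  assume "U \<subseteq> topspace (quotient_topology X r)"
  then show "openin X {x \<in> topspace X. r `` {x} \<in> U} = openin (quotient_topology X r) U"
    unfolding openin_quotient_topology topspace_quotient_topology by blast
qed

definition loop_at :: "'a topology \<Rightarrow> 'a \<Rightarrow> (real \<Rightarrow> 'a) \<Rightarrow> bool" where
  "loop_at X x p \<longleftrightarrow> pathin X p \<and> p 0 = x \<and> p 1 = x"

(* The library's joinpaths needs a topological_space instance on the point type. *)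
definition loop_join :: "(real \<Rightarrow> 'a) \<Rightarrow> (real \<Rightarrow> 'a) \<Rightarrow> real \<Rightarrow> 'a" where
  "loop_join p q = (\<lambda>t. if t \<le> 1/2 then p (2 * t) else q (2 * t - 1))"

definition loop_class :: "'a topology \<Rightarrow> 'a \<Rightarrow> (real \<Rightarrow> 'a) \<Rightarrow> (real \<Rightarrow> 'a) set" where
  "loop_class X x p =
     {q. homotopic_with (\<lambda>h. h 0 = x \<and> h 1 = x) (top_of_set {0..1}) X p q}"

definition fundamental_group :: "'a topology \<Rightarrow> 'a \<Rightarrow> (real \<Rightarrow> 'a) set monoid" where
  "fundamental_group X x =
     \<lparr>carrier = loop_class X x ` {p. loop_at X x p},
      mult = (\<lambda>C D. \<Union>p\<in>C. \<Union>q\<in>D. loop_class X x (loop_join p q)),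
      one = loop_class X x (\<lambda>_. x)\<rparr>"

definition fundamental_group_map ::
    "'b topology \<Rightarrow> 'b \<Rightarrow> ('a \<Rightarrow> 'b) \<Rightarrow> (real \<Rightarrow> 'a) set \<Rightarrow> (real \<Rightarrow> 'b) set" where
  "fundamental_group_map Y y f C = (\<Union>p\<in>C. loop_class Y y (f \<circ> p))"

(* The letter (s, True) is the generator s and (s, False) its formal inverse.  The presented
   group consists of the words modulo the congruence generated by free cancellation and the
   relators, i.e. the free group modulo the normal closure of the relators. *)

definition words :: "'s set \<Rightarrow> ('s \<times> bool) list set" where
  "words S = lists (S \<times> UNIV)"

inductive pres_eq :: "'s set \<Rightarrow> ('s \<times> bool) list set \<Rightarrow> ('s \<times> bool) list \<Rightarrow> ('s \<times> bool) list \<Rightarrow> bool"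
  for S R where
  pres_refl: "w \<in> words S \<Longrightarrow> pres_eq S R w w"
| pres_sym: "pres_eq S R v w \<Longrightarrow> pres_eq S R w v"
| pres_trans: "pres_eq S R u v \<Longrightarrow> pres_eq S R v w \<Longrightarrow> pres_eq S R u w"
| pres_cancel: "u @ [(s, b), (s, \<not> b)] @ v \<in> words S \<Longrightarrow>
    pres_eq S R (u @ [(s, b), (s, \<not> b)] @ v) (u @ v)"
| pres_relator: "r \<in> R \<Longrightarrow> u @ r @ v \<in> words S \<Longrightarrow> pres_eq S R (u @ r @ v) (u @ v)"

definition word_class ::
    "'s set \<Rightarrow> ('s \<times> bool) list set \<Rightarrow> ('s \<times> bool) list \<Rightarrow> ('s \<times> bool) list set" where
  "word_class S R w = {v. pres_eq S R w v}"

definition presented_group ::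
    "'s set \<Rightarrow> ('s \<times> bool) list set \<Rightarrow> ('s \<times> bool) list set monoid" where
  "presented_group S R =
     \<lparr>carrier = word_class S R ` words S,
      mult = (\<lambda>C D. \<Union>u\<in>C. \<Union>v\<in>D. word_class S R (u @ v)),
      one = word_class S R []\<rparr>"

(* The group generated by S with s^2 = 1 for all s and (s t)^2 = 1 whenever E s t. *)
definition coxeter_relators :: "'s set \<Rightarrow> ('s \<Rightarrow> 's \<Rightarrow> bool) \<Rightarrow> ('s \<times> bool) list set" where
  "coxeter_relators S E =
     {[(s, True), (s, True)] | s. s \<in> S} \<union>
     {[(s, True), (t, True), (s, True), (t, True)] | s t. s \<in> S \<and> t \<in> S \<and> E s t}"

definition coxeter_group ::
    "'s set \<Rightarrow> ('s \<Rightarrow> 's \<Rightarrow> bool) \<Rightarrow> ('s \<times> bool) list set monoid" where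
  "coxeter_group S E = presented_group S (coxeter_relators S E)"

definition coxeter_generator ::
    "'s set \<Rightarrow> ('s \<Rightarrow> 's \<Rightarrow> bool) \<Rightarrow> 's \<Rightarrow> ('s \<times> bool) list set" where
  "coxeter_generator S E s = word_class S (coxeter_relators S E) [(s, True)]"

definition facets :: "'a::euclidean_space set \<Rightarrow> 'a set set" where
  "facets P = {A. A facet_of P}"

definition simple_3_polytope :: "'a::euclidean_space set \<Rightarrow> bool" where
  "simple_3_polytope P \<longleftrightarrow> polytope P \<and> aff_dim P = 3 \<and>
     (\<forall>v. v extreme_point_of P \<longrightarrow> card {A \<in> facets P. v \<in> A} = 3)"

type_synonym z2_cube = "bit ^ 3"

(* Z_2^3 as a group: multiplication is the componentwise addition of bit ^ 3. *)
definition Z2_cube :: "z2_cube monoid" where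
  "Z2_cube = \<lparr>carrier = UNIV, mult = (+), one = 0\<rparr>"

lemma group_Z2_cube: "group Z2_cube"
proof (rule groupI)
  fix x assume "x \<in> carrier Z2_cube"
  have "- x \<in> carrier Z2_cube" "(- x) \<otimes>\<^bsub>Z2_cube\<^esub> x = \<one>\<^bsub>Z2_cube\<^esub>"
    by (simp_all add: Z2_cube_def)
  then show "\<exists>y\<in>carrier Z2_cube. y \<otimes>\<^bsub>Z2_cube\<^esub> x = \<one>\<^bsub>Z2_cube\<^esub>"
    by blast
qed (simp_all add: Z2_cube_def add.assoc)

definition characteristic_map :: "'a::euclidean_space set \<Rightarrow> ('a set \<Rightarrow> z2_cube) \<Rightarrow> bool" where
  "characteristic_map P col \<longleftrightarrow>
     (\<forall>v A B C. v extreme_point_of P \<and> A \<in> facets P \<and> B \<in> facets P \<and> C \<in> facets P \<and>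
        A \<noteq> B \<and> B \<noteq> C \<and> A \<noteq> C \<and> v \<in> A \<and> v \<in> B \<and> v \<in> C \<longrightarrow>
        vec.independent {col A, col B, col C} \<and> vec.span {col A, col B, col C} = UNIV)"

(* For f = P no facet contains f, and the generated subgroup is trivial, as it should be. *)
definition face_group ::
    "'a::euclidean_space set \<Rightarrow> ('a set \<Rightarrow> z2_cube) \<Rightarrow> 'a set \<Rightarrow> z2_cube set" where
  "face_group P col f = generate Z2_cube (col ` {A \<in> facets P. f \<subseteq> A})"

definition carrier_face :: "'a::euclidean_space set \<Rightarrow> 'a \<Rightarrow> 'a set" where
  "carrier_face P p = (THE f. f face_of P \<and> p \<in> rel_interior f)"

definition small_cover_rel ::
    "'a::euclidean_space set \<Rightarrow> ('a set \<Rightarrow> z2_cube) \<Rightarrow> (('a \<times> z2_cube) \<times> ('a \<times> z2_cube)) set" where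
  "small_cover_rel P col =
     {((p, g), (q, h)) | p g q h. p \<in> P \<and> q \<in> P \<and> p = q \<and>
        inv\<^bsub>Z2_cube\<^esub> g \<otimes>\<^bsub>Z2_cube\<^esub> h \<in> face_group P col (carrier_face P p)}"

definition small_cover ::
    "'a::euclidean_space set \<Rightarrow> ('a set \<Rightarrow> z2_cube) \<Rightarrow> ('a \<times> z2_cube) set topology" where
  "small_cover P col =
     quotient_topology (prod_topology (top_of_set P) (discrete_topology UNIV)) (small_cover_rel P col)"

(* All members of a class have the same first component. *)
definition small_cover_proj :: "('a \<times> z2_cube) set \<Rightarrow> 'a" where
  "small_cover_proj x = the_elem (fst ` x)"

definition four_belt :: "'a::euclidean_space set \<Rightarrow> (nat \<Rightarrow> 'a set) \<Rightarrow> bool" where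
  "four_belt P F \<longleftrightarrow>
     (\<forall>i\<in>{1..4}. F i \<in> facets P) \<and> inj_on F {1..4} \<and>
     F 1 \<inter> F 2 \<noteq> {} \<and> F 2 \<inter> F 3 \<noteq> {} \<and> F 3 \<inter> F 4 \<noteq> {} \<and> F 4 \<inter> F 1 \<noteq> {} \<and>
     (\<forall>i\<in>{1..4}. \<forall>j\<in>{1..4}. \<forall>k\<in>{1..4}.
        i \<noteq> j \<and> j \<noteq> k \<and> i \<noteq> k \<longrightarrow> F i \<inter> F j \<inter> F k = {}) \<and>
     F 1 \<inter> F 3 = {} \<and> F 2 \<inter> F 4 = {}"

(* Parametrised so that the loop is in the relative interior of F i for (i-1)/4 < t < i/4 and
   passes from F i to the next facet at t = i/4, through the relative interior of their
   common edge. *)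
definition belt_loop :: "(nat \<Rightarrow> 'a::euclidean_space set) \<Rightarrow> (real \<Rightarrow> 'a) \<Rightarrow> bool" where
  "belt_loop F c \<longleftrightarrow> simple_path c \<and> pathfinish c = pathstart c \<and>
     (\<forall>i\<in>{1..4::nat}. \<forall>t. (real i - 1) / 4 < t \<and> t < real i / 4 \<longrightarrow> c t \<in> rel_interior (F i)) \<and>
     c (1/4) \<in> rel_interior (F 1 \<inter> F 2) \<and> c (2/4) \<in> rel_interior (F 2 \<inter> F 3) \<and>
     c (3/4) \<in> rel_interior (F 3 \<inter> F 4) \<and> c 1 \<in> rel_interior (F 4 \<inter> F 1)"

definition cross_section ::
    "'a::euclidean_space set \<Rightarrow> (nat \<Rightarrow> 'a set) \<Rightarrow> 'a set \<Rightarrow> bool" where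
  "cross_section P F Q \<longleftrightarrow>
     (\<exists>c. belt_loop F c \<and> Q \<subseteq> P \<and> Q \<inter> rel_frontier P = path_image c \<and>
        (\<exists>h k. homeomorphism (cball (0::complex) 1) Q h k \<and> h ` sphere 0 1 = path_image c))"

definition section_preimage ::
    "'a::euclidean_space set \<Rightarrow> ('a set \<Rightarrow> z2_cube) \<Rightarrow> 'a set \<Rightarrow> ('a \<times> z2_cube) set set" where
  "section_preimage P col Q = {x \<in> topspace (small_cover P col). small_cover_proj x \<in> Q}"

(* The colours of a belt generate a subgroup of rank 3 or 2; in the second case N is any one of
   the components of the preimage. *)
definition sectional_submanifold ::
    "'a::euclidean_space set \<Rightarrow> ('a set \<Rightarrow> z2_cube) \<Rightarrow> (nat \<Rightarrow> 'a set) \<Rightarrow> 'a set \<Rightarrow>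
     ('a \<times> z2_cube) set set \<Rightarrow> bool" where
  "sectional_submanifold P col F Q N \<longleftrightarrow>
     (if generate Z2_cube (col ` F ` {1..4}) = UNIV
      then N = section_preimage P col Q
      else N \<in> connected_components_of
                 (subtopology (small_cover P col) (section_preimage P col Q)))"

definition facets_meet :: "'a set \<Rightarrow> 'a set \<Rightarrow> bool" where
  "facets_meet A B \<longleftrightarrow> A \<inter> B \<noteq> {}"

definition square_adjacent :: "nat \<Rightarrow> nat \<Rightarrow> bool" where
  "square_adjacent i j \<longleftrightarrow> (i, j) \<in> {(1, 2), (2, 3), (3, 4), (4, 1)}"

abbreviation W_polytope :: "'a::euclidean_space set \<Rightarrow> ('a set \<times> bool) list set monoid" where
  "W_polytope P \<equiv> coxeter_group (facets P) facets_meet"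

abbreviation W_square :: "(nat \<times> bool) list set monoid" where
  "W_square \<equiv> coxeter_group {1..4} square_adjacent"

abbreviation facet_reflection :: "'a::euclidean_space set \<Rightarrow> 'a set \<Rightarrow> ('a set \<times> bool) list set" where
  "facet_reflection P \<equiv> coxeter_generator (facets P) facets_meet"

abbreviation edge_reflection :: "nat \<Rightarrow> (nat \<times> bool) list set" where
  "edge_reflection \<equiv> coxeter_generator {1..4} square_adjacent"

end

theory Submission
  imports Defs
begin

text \<open>Killing the generators of \<open>W_P\<close> off the belt retracts \<open>W_P\<close> onto \<open>W_F\<close>, because opposite facets of
  the belt are disjoint; so \<open>j\<^sub>*\<close> is injective.

  For \<open>i\<^sub>*\<close>, the space of all \<open>(p, v)\<close> with \<open>p \<in> P\<close> and \<open>\<bar>v\<^sub>A\<bar> = dist p A\<close> for every facet \<open>A\<close> is a finite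
  covering of \<open>M\<close>, the colour of \<open>(p, v)\<close> being the sum of the colours of the facets with \<open>v\<^sub>A < 0\<close>. A
  homotopy in \<open>M\<close> between two loops of \<open>M\<^sub>F\<close> lifts to this covering. Let \<open>(a, b) : P \<rightarrow> [0,1]\<^sup>2\<close> extend
  coordinates of the square \<open>F\<close> in such a way that \<open>a = 0, 1\<close> on \<open>F\<^sub>1, F\<^sub>3\<close> and \<open>b = 0, 1\<close> on \<open>F\<^sub>2, F\<^sub>4\<close>. Then
  the signs of the lift turn \<open>(sin (\<pi>a/2), cos (\<pi>a/2))\<close> and its analogue for \<open>b\<close> into continuous maps
  from the parameter square of the homotopy to the circle, which have continuous angles \<open>\<theta>, \<phi>\<close>. These
  angles develop the two loops into the plane, the universal covering of \<open>M\<^sub>F\<close>, as paths with the same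
  end points, and the linear homotopy between these paths projects to \<open>M\<^sub>F\<close>.\<close>

subsection \<open>Right-angled Coxeter groups\<close>

text \<open>The coordinates (a, b) alone give no map from M to M_F: a development into the plane
  also needs one sign for each of the four belt facets, and an element of Z_2^3 cannot record four
  independent signs. The covering by the pairs (p, v), the real moment-angle manifold of P, keeps a
  sign for every facet. The circle-valued maps exist on it because opposite belt facets are
  disjoint: at most one of the two signs involved is 0 at a time, and the trigonometric factor next
  to it is 0 as well. Facets off the belt do not meet the square, so over it their signs are locally
  constant and can be frozen in a parameter \<open>e\<close>. The homotopy in M serves only to
  define the angles. The two developed paths have the same end points because the angles do not move
  along a path on which the homotopy is constant.\<close>

lemma words_append [simp]: "u @ v \<in> words S \<longleftrightarrow> u \<in> words S \<and> v \<in> words S"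
  by (auto simp: words_def)

lemma words_Nil [simp]: "[] \<in> words S"
  by (simp add: words_def)

lemma words_Cons [simp]: "x # v \<in> words S \<longleftrightarrow> fst x \<in> S \<and> v \<in> words S"
  by (cases x) (auto simp: words_def)

lemma pres_eq_words: "pres_eq S R u v \<Longrightarrow> u \<in> words S \<and> v \<in> words S"
  by (induction rule: pres_eq.induct) auto

text \<open>The rules \<open>pres_cancel\<close> and \<open>pres_relator\<close> already carry
  contexts \<open>u\<close> and \<open>v\<close>; congruence follows by enlarging them.\<close>

lemma pres_eq_ctxt:
  assumes "pres_eq S R u v" "a \<in> words S" "b \<in> words S"
  shows "pres_eq S R (a @ u @ b) (a @ v @ b)"
  using assms
proof (induction rule: pres_eq.induct)
  case (pres_cancel u s b' v)
  then show ?case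
    using pres_eq.pres_cancel[of "a @ u" s b' "v @ b" S R] by simp
next
  case (pres_relator r u v)
  then show ?case
    using pres_eq.pres_relator[of r R "a @ u" "v @ b" S] by simp
qed (auto intro: pres_eq.pres_refl pres_eq.pres_sym pres_eq.pres_trans)

lemma pres_eq_append:
  assumes "pres_eq S R u u'" "pres_eq S R v v'"
  shows "pres_eq S R (u @ v) (u' @ v')"
  using pres_eq_ctxt[OF assms(1), of "[]" v] pres_eq_ctxt[OF assms(2), of u' "[]"]
    pres_eq_words[OF assms(1)] pres_eq_words[OF assms(2)]
  by (auto intro: pres_trans)

lemma word_class_eq_iff:
  assumes "v \<in> words S"
  shows "word_class S R u = word_class S R v \<longleftrightarrow> pres_eq S R u v"
  using assms unfolding word_class_def set_eq_iff
  by (blast intro: pres_refl pres_sym pres_trans)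

text \<open>The union that defines the product runs over all representatives; every pair gives the
  same class, so the union is that class.\<close>

lemma presented_group_mult:
  assumes "u \<in> words S" "v \<in> words S"
  shows "word_class S R u \<otimes>\<^bsub>presented_group S R\<^esub> word_class S R v = word_class S R (u @ v)"
proof -
  have "word_class S R (u' @ v') = word_class S R (u @ v)"
    if "u' \<in> word_class S R u" "v' \<in> word_class S R v" for u' v'
    using that assms pres_eq_append[of S R u u' v v']
    by (subst word_class_eq_iff) (auto simp: word_class_def intro: pres_sym)
  moreover have "u \<in> word_class S R u" "v \<in> word_class S R v"
    using assms by (auto simp: word_class_def intro: pres_refl)
  ultimately have "(\<Union>u'\<in>word_class S R u. \<Union>v'\<in>word_class S R v. word_class S R (u' @ v'))
      = word_class S R (u @ v)"
    by blast
  then show ?thesis by (simp add: presented_group_def)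
qed

lemma carrier_presented_group: "carrier (presented_group S R) = word_class S R ` words S"
  by (simp add: presented_group_def)

text \<open>Words are substituted letter by letter; a generator may go to the empty word, so the
  inclusion of the square and the retraction onto it are both of this form.\<close>

lemma pres_eq_substitute:
  fixes \<phi> :: "'s \<times> bool \<Rightarrow> ('t \<times> bool) list"
  assumes "pres_eq S R u v"
    and words: "\<And>s b. s \<in> S \<Longrightarrow> \<phi> (s, b) \<in> words T"
    and cancel: "\<And>s b. s \<in> S \<Longrightarrow> pres_eq T R' (\<phi> (s, b) @ \<phi> (s, \<not> b)) []"
    and relators: "\<And>r. r \<in> R \<Longrightarrow> r \<in> words S \<Longrightarrow> pres_eq T R' (concat (map \<phi> r)) []"
  shows "pres_eq T R' (concat (map \<phi> u)) (concat (map \<phi> v))"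
proof -
  have w: "concat (map \<phi> w) \<in> words T" if "w \<in> words S" for w
    using that by (induction w) (auto simp: words)
  show ?thesis using assms(1)
  proof (induction rule: pres_eq.induct)
    case (pres_cancel u s b v)
    then show ?case
      using pres_eq_ctxt[OF cancel[of s b], of "concat (map \<phi> u)" "concat (map \<phi> v)"] w by auto
  next
    case (pres_relator r u v)
    then show ?case
      using pres_eq_ctxt[OF relators[of r], of "concat (map \<phi> u)" "concat (map \<phi> v)"] w by auto
  qed (auto intro: pres_refl pres_sym pres_trans w)
qed

text \<open>The relators only square positive letters, and mixed pairs cancel freely. For two
  inverse letters the word s^-1 s s s^-1 is reduced in two ways: by the relator in the middle to
  s^-1 s^-1, by free cancellation to the empty word.\<close>

lemma coxeter_square:
  assumes "s \<in> S"
  shows "pres_eq S (coxeter_relators S E) [(s, b), (s, c)] []"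
proof -
  let ?eq = "pres_eq S (coxeter_relators S E)"
  have tt: "?eq [(s, True), (s, True)] []"
    using pres_relator[of "[(s, True), (s, True)]" "coxeter_relators S E" "[]" "[]" S] assms
    by (auto simp: coxeter_relators_def)
  have canc: "?eq [(s, d), (s, \<not> d)] []" for d
    using pres_cancel[of "[]" s d "[]" S] assms by simp
  have "?eq ([(s, False)] @ [(s, True), (s, True)] @ [(s, False)]) ([(s, False)] @ [] @ [(s, False)])"
    by (rule pres_eq_ctxt[OF tt]) (use assms in auto)
  moreover have "?eq ([(s, False), (s, True)] @ [(s, True), (s, False)]) ([] @ [])"
    by (rule pres_eq_append) (use canc[of False] canc[of True] in auto)
  ultimately have ff: "?eq [(s, False), (s, False)] []"
    by (auto intro: pres_sym pres_trans)
  show ?thesis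
    using tt ff canc[of False] canc[of True] by (cases b; cases c) auto
qed

text \<open>The word with letters \<open>(s, b)\<close>, \<open>(s, c)\<close>,
  \<open>(s, c)\<close> reduces to either side, depending on which adjacent pair is removed.\<close>

lemma coxeter_letter:
  assumes "s \<in> S"
  shows "pres_eq S (coxeter_relators S E) [(s, b)] [(s, c)]"
proof -
  let ?eq = "pres_eq S (coxeter_relators S E)"
  have "?eq ([(s, b), (s, c)] @ [(s, c)]) ([] @ [(s, c)])"
    by (rule pres_eq_append[OF coxeter_square pres_refl]) (use assms in auto)
  moreover have "?eq ([(s, b)] @ [(s, c), (s, c)]) ([(s, b)] @ [])"
    by (rule pres_eq_append[OF pres_refl coxeter_square]) (use assms in auto)
  ultimately show ?thesis by (auto intro: pres_sym pres_trans)
qed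

text \<open>Three cases, because \<open>square_adjacent\<close> lists each adjacent pair in one
  order only, whereas \<open>facets_meet\<close> is symmetric and also relates a facet to
  itself.\<close>

lemma coxeter_commute:
  assumes "s \<in> S" "t \<in> S" "E s t \<or> E t s \<or> s = t"
  shows "pres_eq S (coxeter_relators S E) [(s, True), (t, True), (s, True), (t, True)] []"
proof -
  let ?eq = "pres_eq S (coxeter_relators S E)"
  have rel: "?eq [(s, True), (t, True), (s, True), (t, True)] []"
    if "E s t" "s \<in> S" "t \<in> S" for s t
    using pres_relator[of "[(s, True), (t, True), (s, True), (t, True)]" "coxeter_relators S E" "[]" "[]" S]
      that by (auto simp: coxeter_relators_def)
  consider "E s t" | "E t s" | "s = t" using assms by blast
  then show ?thesis
  proof cases
    case 1 then show ?thesis using rel assms by blast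
  next
    case 2
    \<comment> \<open>The relator for the pair \<open>t\<close>, \<open>s\<close>, conjugated by
      \<open>s\<close>, is the wanted word followed by a square.\<close>
    have "?eq ([(s, True), (t, True), (s, True), (t, True)] @ [(s, True), (s, True)])
              ([(s, True), (t, True), (s, True), (t, True)] @ [])"
      by (rule pres_eq_append[OF pres_refl coxeter_square]) (use assms in auto)
    moreover have "?eq ([(s, True)] @ [(t, True), (s, True), (t, True), (s, True)] @ [(s, True)])
              ([(s, True)] @ [] @ [(s, True)])"
      by (rule pres_eq_ctxt[OF rel]) (use assms 2 in auto)
    moreover have "?eq [(s, True), (s, True)] []"
      by (rule coxeter_square) fact
    ultimately show ?thesis by (auto intro: pres_sym pres_trans)
  next
    case 3
    have "?eq ([(s, True), (s, True)] @ [(s, True), (s, True)]) ([] @ [])"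
      by (rule pres_eq_append[OF coxeter_square coxeter_square]) (use assms in auto)
    then show ?thesis using 3 by simp
  qed
qed

lemma hom_coxeter_group_word:
  assumes j: "j \<in> hom (coxeter_group S E) (coxeter_group T E')"
    and f: "\<And>s. s \<in> S \<Longrightarrow> f s \<in> T"
    and gen: "\<And>s. s \<in> S \<Longrightarrow> j (coxeter_generator S E s) = coxeter_generator T E' (f s)"
    and "S \<noteq> {}" "w \<in> words S"
  shows "j (word_class S (coxeter_relators S E) w)
    = word_class T (coxeter_relators T E') (map (map_prod f id) w)"
proof -
  let ?w = "word_class S (coxeter_relators S E)" and ?w' = "word_class T (coxeter_relators T E')"
  let ?f = "map (map_prod f id)"
  have map_words: "?f u \<in> words T" if "u \<in> words S" for u
    using that f by (induction u) auto
  have letter: "j (?w [(s, b)]) = ?w' (?f [(s, b)])" if "s \<in> S" for s b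
  proof -
    have "?w [(s, b)] = ?w [(s, True)]"
      using that by (subst word_class_eq_iff) (auto intro: coxeter_letter)
    moreover have "?w' [(f s, b)] = ?w' [(f s, True)]"
      using that f by (subst word_class_eq_iff) (auto intro: coxeter_letter)
    ultimately show ?thesis using gen[OF that] by (simp add: coxeter_generator_def)
  qed
  have mult: "j (?w (u @ v)) = ?w' (?f (u @ v))"
    if "u \<in> words S" "v \<in> words S" "j (?w u) = ?w' (?f u)" "j (?w v) = ?w' (?f v)" for u v
    using hom_mult[OF j, of "?w u" "?w v"] that map_words
    by (simp add: coxeter_group_def carrier_presented_group presented_group_mult)
  \<comment> \<open>\<open>hom\<close> asks for multiplicativity only, so the image of the empty
    word is computed by writing its class as the square of a generator.\<close>
  obtain s where s: "s \<in> S" using \<open>S \<noteq> {}\<close> by blast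
  have "?w [] = ?w [(s, True), (s, True)]" "?w' [] = ?w' [(f s, True), (f s, True)]"
    using s f coxeter_square[of s S] coxeter_square[of "f s" T] by (auto simp: word_class_eq_iff intro: pres_sym)
  then have Nil: "j (?w []) = ?w' (?f [])"
    using mult[of "[(s, True)]" "[(s, True)]"] s letter[OF s] by simp
  show ?thesis using \<open>w \<in> words S\<close>
  proof (induction w)
    case Nil
    show ?case by (rule \<open>j (?w []) = ?w' (?f [])\<close>)
  next
    case (Cons x w)
    then show ?case
      using mult[of "[x]" w] letter[of "fst x" "snd x"] by (simp add: id_def)
  qed
qed

lemma hom_coxeter_group_exists:
  assumes f: "\<And>s. s \<in> S \<Longrightarrow> f s \<in> T"
    and E: "\<And>s t. s \<in> S \<Longrightarrow> t \<in> S \<Longrightarrow> E s t \<Longrightarrow> E' (f s) (f t)"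
  shows "\<exists>j \<in> hom (coxeter_group S E) (coxeter_group T E').
    \<forall>s\<in>S. j (coxeter_generator S E s) = coxeter_generator T E' (f s)"
proof -
  let ?w = "word_class S (coxeter_relators S E)" and ?w' = "word_class T (coxeter_relators T E')"
  let ?f = "map (map_prod f id)"
  define j where "j C = ?w' (?f (SOME u. u \<in> C))" for C
  have map_words: "?f u \<in> words T" if "u \<in> words S" for u
    using that f by (induction u) auto
  have "pres_eq T (coxeter_relators T E') (?f u) (?f v)"
    if "pres_eq S (coxeter_relators S E) u v" for u v
  proof -
    have "pres_eq T (coxeter_relators T E') (concat (map (\<lambda>x. [map_prod f id x]) u))
        (concat (map (\<lambda>x. [map_prod f id x]) v))"
    proof (rule pres_eq_substitute[OF that])
      fix r assume "r \<in> coxeter_relators S E" "r \<in> words S"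
      then show "pres_eq T (coxeter_relators T E') (concat (map (\<lambda>x. [map_prod f id x]) r)) []"
        using coxeter_square[of "f _" T] coxeter_commute[of "f _" T "f _"] f E
        by (auto simp: coxeter_relators_def)
    qed (use f coxeter_square[of "f _" T] in auto)
    moreover have "concat (map (\<lambda>x. [map_prod f id x]) u) = ?f u" for u
      by (induction u) auto
    ultimately show ?thesis by simp
  qed
  then have j: "j (?w u) = ?w' (?f u)" if "u \<in> words S" for u
  proof -
    have "u \<in> ?w u" using that by (auto simp: word_class_def intro: pres_refl)
    then have "pres_eq S (coxeter_relators S E) u (SOME v. v \<in> ?w u)"
      using someI[of "\<lambda>v. v \<in> ?w u" u] by (simp add: word_class_def)
    then show ?thesis
      using that map_words \<open>\<And>v u. pres_eq S _ u v \<Longrightarrow> _\<close> unfolding j_def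
      by (subst word_class_eq_iff) (auto intro: pres_sym)
  qed
  have "j \<in> hom (coxeter_group S E) (coxeter_group T E')"
    by (rule homI) (auto simp: coxeter_group_def carrier_presented_group presented_group_mult j map_words)
  moreover have "\<forall>s\<in>S. j (coxeter_generator S E s) = coxeter_generator T E' (f s)"
    by (simp add: coxeter_generator_def j)
  ultimately show ?thesis by blast
qed

text \<open>If \<open>f\<close> embeds \<open>S\<close> as a full subgraph of \<open>T\<close>, killing the generators outside \<open>f ` S\<close>
  retracts the big group onto the small one.\<close>

lemma hom_coxeter_group_inj:
  assumes j: "j \<in> hom (coxeter_group S E) (coxeter_group T E')"
    and f: "\<And>s. s \<in> S \<Longrightarrow> f s \<in> T" and inj: "inj_on f S"
    and gen: "\<And>s. s \<in> S \<Longrightarrow> j (coxeter_generator S E s) = coxeter_generator T E' (f s)"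
    and full: "\<And>s t. s \<in> S \<Longrightarrow> t \<in> S \<Longrightarrow> E' (f s) (f t) \<Longrightarrow> E s t \<or> E t s \<or> s = t"
    and "S \<noteq> {}"
  shows "inj_on j (carrier (coxeter_group S E))"
proof -
  let ?R = "coxeter_relators S E"
  define \<rho> where "\<rho> x = (if fst x \<in> f ` S then [(the_inv_into S f (fst x), snd x)] else [])"
    for x :: "'b \<times> bool"
  have \<rho>_f: "\<rho> (f s, b) = [(s, b)]" if "s \<in> S" for s b
    using that by (simp add: \<rho>_def the_inv_into_f_f[OF inj])
  have \<rho>_out: "\<rho> (t, b) = []" if "t \<notin> f ` S" for t b
    using that by (simp add: \<rho>_def)
  have retract: "concat (map \<rho> (map (map_prod f id) w)) = w" if "w \<in> words S" for w
    using that by (induction w) (auto simp: \<rho>_f)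
  have "pres_eq S ?R (concat (map \<rho> u)) (concat (map \<rho> v))"
    if "pres_eq T (coxeter_relators T E') u v" for u v
  proof (rule pres_eq_substitute[OF that])
    fix t b assume "t \<in> T"
    show "\<rho> (t, b) \<in> words S"
      by (cases "t \<in> f ` S") (auto simp: \<rho>_f \<rho>_out)
    show "pres_eq S ?R (\<rho> (t, b) @ \<rho> (t, \<not> b)) []"
      by (cases "t \<in> f ` S") (auto simp: \<rho>_f \<rho>_out pres_refl intro: coxeter_square)
  next
    fix r assume "r \<in> coxeter_relators T E'"
    then consider t where "r = [(t, True), (t, True)]"
      | t t' where "r = [(t, True), (t', True), (t, True), (t', True)]" "E' t t'"
      unfolding coxeter_relators_def by blast
    then show "pres_eq S ?R (concat (map \<rho> r)) []"
    proof cases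
      case (1 t)
      then show ?thesis
        by (cases "t \<in> f ` S") (auto simp: \<rho>_f \<rho>_out pres_refl intro: coxeter_square)
    next
      \<comment> \<open>With one letter killed the relator becomes the square of the other; with
        both kept, \<open>full\<close> makes it a relation of the small group.\<close>
      case (2 t t')
      then show ?thesis
        by (cases "t \<in> f ` S"; cases "t' \<in> f ` S")
          (auto simp: \<rho>_f \<rho>_out pres_refl intro: coxeter_square intro!: coxeter_commute dest: full)
    qed
  qed
  then have "pres_eq S ?R u v"
    if "pres_eq T (coxeter_relators T E') (map (map_prod f id) u) (map (map_prod f id) v)"
      "u \<in> words S" "v \<in> words S" for u v
    using that retract by metis
  moreover have "map (map_prod f id) v \<in> words T" if "v \<in> words S" for v
    using that f by (induction v) auto
  ultimately show ?thesis
    using hom_coxeter_group_word[OF j f gen \<open>S \<noteq> {}\<close>]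
    unfolding coxeter_group_def carrier_presented_group inj_on_def
    by (auto simp: word_class_eq_iff)
qed

text \<open>The pairs of indices that are neither adjacent nor equal are 1, 3 and 2, 4, exactly
  those whose facets are disjoint.\<close>

lemma belt_full:
  assumes "four_belt P F" "i \<in> {1..4}" "j \<in> {1..4}" "facets_meet (F i) (F j)"
  shows "square_adjacent i j \<or> square_adjacent j i \<or> i = j"
proof -
  have "F 1 \<inter> F 3 = {}" "F 2 \<inter> F 4 = {}"
    using assms(1) by (simp_all add: four_belt_def)
  moreover have "i = 1 \<or> i = 2 \<or> i = 3 \<or> i = 4" "j = 1 \<or> j = 2 \<or> j = 3 \<or> j = 4"
    using assms(2,3) by auto
  ultimately show ?thesis
    using assms(4) unfolding square_adjacent_def facets_meet_def by (elim disjE) auto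
qed

lemma belt_adjacent:
  assumes "four_belt P F" "square_adjacent i j"
  shows "facets_meet (F i) (F j)"
proof -
  have "F 1 \<inter> F 2 \<noteq> {}" "F 2 \<inter> F 3 \<noteq> {}" "F 3 \<inter> F 4 \<noteq> {}" "F 4 \<inter> F 1 \<noteq> {}"
    using assms(1) by (simp_all add: four_belt_def)
  then show ?thesis
    using assms(2) by (auto simp: square_adjacent_def facets_meet_def)
qed

lemma belt_coxeter:
  assumes "four_belt P F"
  shows "(\<exists>j \<in> hom W_square (W_polytope P).
            \<forall>i\<in>{1..4}. j (edge_reflection i) = facet_reflection P (F i))"
    and "(\<forall>j \<in> hom W_square (W_polytope P).
            (\<forall>i\<in>{1..4}. j (edge_reflection i) = facet_reflection P (F i)) \<longrightarrow>
            inj_on j (carrier W_square))"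
proof -
  have F: "\<And>i. i \<in> {1..4} \<Longrightarrow> F i \<in> facets P" and inj: "inj_on F {1..4}"
    using assms unfolding four_belt_def by blast+
  show "\<exists>j \<in> hom W_square (W_polytope P).
      \<forall>i\<in>{1..4}. j (edge_reflection i) = facet_reflection P (F i)"
    by (rule hom_coxeter_group_exists) (use F belt_adjacent[OF assms] in auto)
  show "\<forall>j \<in> hom W_square (W_polytope P).
      (\<forall>i\<in>{1..4}. j (edge_reflection i) = facet_reflection P (F i)) \<longrightarrow>
      inj_on j (carrier W_square)"
  proof (intro ballI impI)
    fix j assume "j \<in> hom W_square (W_polytope P)"
      "\<forall>i\<in>{1..4}. j (edge_reflection i) = facet_reflection P (F i)"
    then show "inj_on j (carrier W_square)"
      by (intro hom_coxeter_group_inj[where f = F and T = "facets P" and E' = facets_meet])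
        (use F inj belt_full[OF assms] in auto)
  qed
qed

subsection \<open>Fundamental groups\<close>

abbreviation homotopic_loops_at :: "'a topology \<Rightarrow> 'a \<Rightarrow> (real \<Rightarrow> 'a) \<Rightarrow> (real \<Rightarrow> 'a) \<Rightarrow> bool" where
  "homotopic_loops_at X x \<equiv> homotopic_with (\<lambda>h. h 0 = x \<and> h 1 = x) (top_of_set {0..1}) X"

lemma homotopic_loops_at_imp_loop_at:
  "homotopic_loops_at X x p q \<Longrightarrow> loop_at X x p \<and> loop_at X x q"
  using homotopic_with_imp_continuous_maps homotopic_with_imp_property
  unfolding loop_at_def pathin_def by blast

lemma loop_class_eq_iff:
  assumes "loop_at X x q"
  shows "loop_class X x p = loop_class X x q \<longleftrightarrow> homotopic_loops_at X x p q"
proof -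
  have "homotopic_loops_at X x q q"
    using assms by (simp add: loop_at_def pathin_def)
  then show ?thesis
    unfolding loop_class_def set_eq_iff mem_Collect_eq
    by (meson homotopic_with_symD homotopic_with_trans)
qed

lemma loop_in_loop_class: "loop_at X x p \<Longrightarrow> p \<in> loop_class X x p"
  by (simp add: loop_class_def loop_at_def pathin_def)

text \<open>The two homotopies run side by side and are glued along \<open>snd y = 1/2\<close>,
  where both are constantly \<open>x\<close>.\<close>

lemma homotopic_loops_at_join:
  assumes "homotopic_loops_at X x p p'" "homotopic_loops_at X x q q'"
  shows "homotopic_loops_at X x (loop_join p q) (loop_join p' q')"
proof -
  let ?I = "top_of_set {0..1::real}"
  obtain h k where h: "continuous_map (prod_topology ?I ?I) X h"
    and k: "continuous_map (prod_topology ?I ?I) X k"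
    and hk: "\<forall>t. h (0, t) = p t" "\<forall>t. h (1, t) = p' t" "\<forall>s\<in>{0..1}. h (s, 0) = x \<and> h (s, 1) = x"
      "\<forall>t. k (0, t) = q t" "\<forall>t. k (1, t) = q' t" "\<forall>s\<in>{0..1}. k (s, 0) = x \<and> k (s, 1) = x"
    using assms unfolding homotopic_with_def by metis
  let ?m = "\<lambda>y. if snd y \<le> 1/2 then (h \<circ> (\<lambda>y. (fst y, 2 * snd y))) y
                else (k \<circ> (\<lambda>y. (fst y, 2 * snd y - 1))) y"
  have "continuous_map (prod_topology ?I ?I) X ?m"
  proof (rule continuous_map_cases_le)
    show "continuous_map (subtopology (prod_topology ?I ?I) {y \<in> topspace (prod_topology ?I ?I). snd y \<le> 1/2}) X
        (h \<circ> (\<lambda>y. (fst y, 2 * snd y)))"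
      by (rule continuous_map_compose[OF _ h])
        (auto simp: subtopology_subtopology Pi_iff intro!: continuous_intros)
    show "continuous_map (subtopology (prod_topology ?I ?I) {y \<in> topspace (prod_topology ?I ?I). 1/2 \<le> snd y}) X
        (k \<circ> (\<lambda>y. (fst y, 2 * snd y - 1)))"
      by (rule continuous_map_compose[OF _ k])
        (auto simp: subtopology_subtopology Pi_iff intro!: continuous_intros)
    show "continuous_map (prod_topology ?I ?I) euclideanreal snd"
      using continuous_map_snd continuous_map_in_subtopology by blast
    fix y assume "y \<in> topspace (prod_topology ?I ?I)" "snd y = 1/2"
    then obtain s where "y = (s, 1/2)" "s \<in> {0..1}" by (cases y) auto
    then show "(h \<circ> (\<lambda>y. (fst y, 2 * snd y))) y = (k \<circ> (\<lambda>y. (fst y, 2 * snd y - 1))) y"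
      using hk by simp
  qed auto
  then show ?thesis
    unfolding homotopic_with_def
    by (intro exI[of _ ?m]) (use hk in \<open>auto simp: loop_join_def\<close>)
qed

lemma loop_at_join:
  assumes "loop_at X x p" "loop_at X x q"
  shows "loop_at X x (loop_join p q)"
  using homotopic_loops_at_join[of x X p p q q] assms homotopic_loops_at_imp_loop_at
  by (fastforce simp: loop_at_def pathin_def)

lemma fundamental_group_mult:
  assumes "loop_at X x p" "loop_at X x q"
  shows "loop_class X x p \<otimes>\<^bsub>fundamental_group X x\<^esub> loop_class X x q = loop_class X x (loop_join p q)"
proof -
  have "loop_class X x (loop_join p' q') = loop_class X x (loop_join p q)"
    if "p' \<in> loop_class X x p" "q' \<in> loop_class X x q" for p' q'
    using that homotopic_loops_at_join loop_at_join[OF assms]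
    by (subst loop_class_eq_iff) (auto simp: loop_class_def homotopic_with_sym)
  then have "(\<Union>p'\<in>loop_class X x p. \<Union>q'\<in>loop_class X x q. loop_class X x (loop_join p' q'))
      = loop_class X x (loop_join p q)"
    using loop_in_loop_class[OF assms(1)] loop_in_loop_class[OF assms(2)] by blast
  then show ?thesis by (simp add: fundamental_group_def)
qed

lemma fundamental_group_map_loop_class:
  assumes f: "continuous_map X Y f" and "f x = y" and p: "loop_at X x p"
  shows "fundamental_group_map Y y f (loop_class X x p) = loop_class Y y (f \<circ> p)"
    and "loop_at Y y (f \<circ> p)"
proof -
  show *: "loop_at Y y (f \<circ> p)"
    using assms pathin_compose by (fastforce simp: loop_at_def)
  have "loop_class Y y (f \<circ> p') = loop_class Y y (f \<circ> p)" if "p' \<in> loop_class X x p" for p'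
  proof -
    have "homotopic_loops_at X x p' p"
      using that homotopic_with_symD by (auto simp: loop_class_def)
    then have "homotopic_loops_at Y y (f \<circ> p') (f \<circ> p)"
      by (rule homotopic_with_compose_continuous_map_left[OF _ f]) (use \<open>f x = y\<close> in auto)
    then show ?thesis by (simp add: loop_class_eq_iff[OF *])
  qed
  then show "fundamental_group_map Y y f (loop_class X x p) = loop_class Y y (f \<circ> p)"
    unfolding fundamental_group_map_def using loop_in_loop_class[OF p] by blast
qed

lemma carrier_fundamental_group:
  "carrier (fundamental_group X x) = loop_class X x ` {p. loop_at X x p}"
  by (simp add: fundamental_group_def)

lemma fundamental_group_map_hom:
  assumes f: "continuous_map X Y f" and "f x = y"
  shows "fundamental_group_map Y y f \<in> hom (fundamental_group X x) (fundamental_group Y y)"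
proof (rule homI)
  fix C assume "C \<in> carrier (fundamental_group X x)"
  then show "fundamental_group_map Y y f C \<in> carrier (fundamental_group Y y)"
    using fundamental_group_map_loop_class[OF assms] by (auto simp: carrier_fundamental_group)
next
  fix C D assume "C \<in> carrier (fundamental_group X x)" "D \<in> carrier (fundamental_group X x)"
  then obtain p q where C: "C = loop_class X x p" "loop_at X x p"
    and D: "D = loop_class X x q" "loop_at X x q"
    by (auto simp: carrier_fundamental_group)
  have "f \<circ> loop_join p q = loop_join (f \<circ> p) (f \<circ> q)"
    by (auto simp: loop_join_def)
  then show "fundamental_group_map Y y f (C \<otimes>\<^bsub>fundamental_group X x\<^esub> D)
      = fundamental_group_map Y y f C \<otimes>\<^bsub>fundamental_group Y y\<^esub> fundamental_group_map Y y f D"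
    by (simp add: C D fundamental_group_mult fundamental_group_map_loop_class[OF assms] loop_at_join)
qed

text \<open>Membership in \<open>mon\<close> asks for injectivity on classes, so two loops are
  compared directly, and \<open>inj\<close> carries the whole topological content.\<close>

lemma fundamental_group_map_mon:
  assumes f: "continuous_map X Y f" and "f x = y"
    and inj: "\<And>p q. loop_at X x p \<Longrightarrow> loop_at X x q \<Longrightarrow> homotopic_loops_at Y y (f \<circ> p) (f \<circ> q)
      \<Longrightarrow> homotopic_loops_at X x p q"
  shows "fundamental_group_map Y y f \<in> mon (fundamental_group X x) (fundamental_group Y y)"
  unfolding mon_def
  using fundamental_group_map_hom[OF assms(1,2)] inj
  by (auto simp: inj_on_def carrier_fundamental_group fundamental_group_map_loop_class[OF assms(1,2)]
      loop_class_eq_iff)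

subsection \<open>Faces and colours of a simple polytope\<close>

text \<open>The intersection of all faces through \<open>p\<close> is the least such face; were
  \<open>p\<close> on its relative frontier, a proper face of it would contain \<open>p\<close>,
  against minimality.\<close>

lemma carrier_face_exists:
  fixes P :: "'a::euclidean_space set"
  assumes "polytope P" "p \<in> P"
  shows "\<exists>f. f face_of P \<and> p \<in> rel_interior f"
proof -
  define f where "f = \<Inter>{T. T face_of P \<and> p \<in> T}"
  have "P \<in> {T. T face_of P \<and> p \<in> T}"
    using assms by (simp add: face_of_refl polytope_imp_convex)
  then have f: "f face_of P"
    unfolding f_def by (intro face_of_Inter) auto
  have "p \<in> f" by (simp add: f_def)
  have "p \<in> rel_interior f"
  proof (rule ccontr)
    assume "p \<notin> rel_interior f"
    moreover have "polyhedron f"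
      using f assms by (meson face_of_polytope_polytope polytope_imp_polyhedron)
    ultimately have "p \<in> rel_frontier f"
      using \<open>p \<in> f\<close> by (simp add: rel_frontier_def closure_closed polyhedron_imp_closed)
    then obtain T where "T face_of f" "T \<noteq> f" "p \<in> T"
      using rel_frontier_of_polyhedron_alt[OF \<open>polyhedron f\<close>] by blast
    then have "f \<subseteq> T"
      unfolding f_def using face_of_trans[OF \<open>T face_of f\<close> f] by blast
    then show False
      using \<open>T face_of f\<close> \<open>T \<noteq> f\<close> face_of_imp_subset by blast
  qed
  then show ?thesis using f by blast
qed

lemma carrier_face_props:
  fixes P :: "'a::euclidean_space set"
  assumes "polytope P" "p \<in> P"
  shows "carrier_face P p face_of P" "p \<in> rel_interior (carrier_face P p)"
proof -
  obtain f where f: "f face_of P" "p \<in> rel_interior f"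
    using carrier_face_exists[OF assms] by blast
  then have "carrier_face P p = f"
    unfolding carrier_face_def using face_of_eq by (intro the_equality) blast+
  then show "carrier_face P p face_of P" "p \<in> rel_interior (carrier_face P p)"
    using f by auto
qed

lemma carrier_face_subset_facet_iff:
  fixes P :: "'a::euclidean_space set"
  assumes "polytope P" "p \<in> P" "A \<in> facets P"
  shows "carrier_face P p \<subseteq> A \<longleftrightarrow> p \<in> A"
proof
  show "p \<in> A" if "carrier_face P p \<subseteq> A"
    using that carrier_face_props[OF assms(1,2)] rel_interior_subset by blast
next
  assume "p \<in> A"
  then show "carrier_face P p \<subseteq> A"
    using subset_of_face_of[of A P "carrier_face P p"] carrier_face_props[OF assms(1,2)] assms(3)
      facet_of_imp_face_of face_of_imp_subset unfolding facets_def by blast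
qed

text \<open>Any vertex of the carrier face of \<open>p\<close> will do, since every facet through
  \<open>p\<close> contains that face. This transfers the basis condition, stated at vertices, to
  all points.\<close>

lemma vertex_in_facets:
  fixes P :: "'a::euclidean_space set"
  assumes "polytope P" "p \<in> P"
  shows "\<exists>v. v extreme_point_of P \<and> (\<forall>A\<in>facets P. p \<in> A \<longrightarrow> v \<in> A)"
proof -
  let ?f = "carrier_face P p"
  note f = carrier_face_props[OF assms]
  have "polytope ?f" using f(1) assms(1) by (rule face_of_polytope_polytope[rotated])
  moreover have "?f \<noteq> {}" using f(2) by auto
  ultimately obtain v where "v extreme_point_of ?f"
    using extreme_point_exists_convex[of ?f] polytope_imp_compact polytope_imp_convex by blast
  then have "v extreme_point_of P" "v \<in> ?f"
    using extreme_point_of_face[OF f(1)] by auto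
  then show ?thesis
    using carrier_face_subset_facet_iff[OF assms] by blast
qed

lemma finite_facets: "polytope P \<Longrightarrow> finite (facets P)"
  by (simp add: facets_def finite_polytope_facets)

lemma facet_subset_facet:
  fixes P :: "'a::euclidean_space set"
  assumes "polytope P" "A \<in> facets P" "B \<in> facets P" "A \<subseteq> B"
  shows "A = B"
proof (rule ccontr)
  assume "A \<noteq> B"
  have "A face_of P" "B face_of P" and dim: "aff_dim A = aff_dim B"
    using assms(2,3) by (auto simp: facets_def facet_of_def)
  then have "A face_of B"
    using assms(4) face_of_face by blast
  then have "aff_dim A < aff_dim B"
    using face_of_aff_dim_lt[OF _ _ \<open>A \<noteq> B\<close>] face_of_imp_convex[OF \<open>B face_of P\<close>] by blast
  then show False using dim by simp
qed

lemma rel_interior_facet_disjoint: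
  fixes P :: "'a::euclidean_space set"
  assumes "polytope P" "A \<in> facets P" "B \<in> facets P" "y \<in> rel_interior A" "y \<in> B"
  shows "A = B"
  using assms facet_subset_facet[OF assms(1-3)] subset_of_face_of[of B P A]
    facet_of_imp_face_of facet_of_imp_subset unfolding facets_def by blast

text \<open>At a vertex of \<open>A \<inter> B\<close> the facet \<open>A\<close> has two edges, and by simplicity each of them is
  one of \<open>A \<inter> B\<close>, \<open>A \<inter> C\<close>, \<open>A \<inter> B \<inter> C\<close>; if \<open>A \<inter> B\<close> were contained in \<open>C\<close>, one of the edges
  would be a proper face of the other.\<close>

lemma rel_interior_edge_disjoint:
  fixes P :: "'a::euclidean_space set"
  assumes simple: "simple_3_polytope P"
    and A: "A \<in> facets P" and B: "B \<in> facets P" and C: "C \<in> facets P"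
    and neq: "A \<noteq> B" "A \<noteq> C" "B \<noteq> C"
    and y: "y \<in> rel_interior (A \<inter> B)" "y \<in> C"
  shows False
proof -
  have P: "polytope P" "aff_dim P = 3"
    and three: "\<And>v. v extreme_point_of P \<Longrightarrow> card {A \<in> facets P. v \<in> A} = 3"
    using simple by (auto simp: simple_3_polytope_def)
  have face: "A face_of P" "B face_of P" "C face_of P"
    using A B C by (auto simp: facets_def facet_of_imp_face_of)
  have AB: "A \<inter> B face_of P" by (rule face_of_Int[OF face(1,2)])
  have sub: "A \<inter> B \<subseteq> C"
    using subset_of_face_of[OF face(3)] AB y face_of_imp_subset by blast
  have "polytope (A \<inter> B)" "A \<inter> B \<noteq> {}"
    using AB P(1) face_of_polytope_polytope y rel_interior_subset by blast+
  then obtain v where "v extreme_point_of (A \<inter> B)"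
    using extreme_point_exists_convex[of "A \<inter> B"] polytope_imp_compact polytope_imp_convex by blast
  then have v: "v extreme_point_of P" "v \<in> A" "v \<in> B" "v \<in> C" "v extreme_point_of A"
    using extreme_point_of_face[OF AB] extreme_point_of_face[OF face(1)] sub by auto
  have "{A, B, C} = {A \<in> facets P. v \<in> A}"
    by (rule card_subset_eq) (use three[OF v(1)] A B C v neq finite_facets[OF P(1)] in auto)
  then have at_v: "X \<in> {A, B, C}" if "X \<in> facets P" "v \<in> X" for X
    using that by blast
  have polyP: "polyhedron P" and polyA: "polyhedron A"
    using P(1) face(1) face_of_polytope_polytope polytope_imp_polyhedron by blast+
  have dimA: "aff_dim A = 2"
    using A P(2) by (simp add: facets_def facet_of_def)
  have edge: "e = A \<inter> B \<or> e = A \<inter> C" if "e facet_of A" "v \<in> e" for e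
  proof -
    have e: "e face_of A" "aff_dim e = 1" "e \<noteq> {}"
      using that dimA by (auto simp: facet_of_def)
    then have eP: "e face_of P" using face(1) face_of_trans by blast
    \<comment> \<open>Facets of \<open>P\<close> that contain \<open>e\<close> pass through
      \<open>v\<close>, so only \<open>A\<close>, \<open>B\<close>, \<open>C\<close> can occur, and
      \<open>A\<close> alone would give \<open>e = A\<close>. If all three occur, \<open>sub\<close>
      reduces their intersection to \<open>A \<inter> B\<close>.\<close>
    let ?S = "{F. F facet_of P \<and> e \<subseteq> F}"
    have "e \<noteq> P" using e(2) P(2) by auto
    then have eq: "e = \<Inter>?S"
      by (rule face_of_polyhedron[OF polyP eP e(3)])
    have "A \<in> ?S" using A face_of_imp_subset[OF e(1)] by (simp add: facets_def)
    moreover have "?S \<subseteq> {A, B, C}"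
      using at_v that(2) unfolding facets_def by blast
    moreover have "?S \<noteq> {A}"
      using eq e(2) dimA by auto
    ultimately have "?S = {A, B} \<or> ?S = {A, C} \<or> ?S = {A, B, C}"
      by blast
    then show ?thesis
      using eq sub by auto
  qed
  have "{v} face_of A" using v(5) by (simp add: face_of_singleton)
  moreover have "{v} \<noteq> A" using dimA by auto
  ultimately have eq: "{v} = \<Inter>{e. e facet_of A \<and> {v} \<subseteq> e}" (is "_ = \<Inter>?E")
    by (intro face_of_polyhedron[OF polyA]) auto
  have dimE: "aff_dim e = 1" if "e \<in> ?E" for e
    using that dimA by (simp add: facet_of_def)
  \<comment> \<open>The edges of \<open>A\<close> through \<open>v\<close> intersect in
    \<open>{v}\<close>. An empty family would give the whole space and a single edge has dimension
    1, so there are at least two.\<close>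
  have "?E \<noteq> {}"
  proof
    assume "?E = {}"
    then have "{v} = UNIV" using eq by (metis Inf_empty)
    moreover have "A \<noteq> {v}" using \<open>{v} \<noteq> A\<close> by simp
    ultimately show False using v(2) by auto
  qed
  moreover have "?E \<noteq> {e}" for e
  proof
    assume "?E = {e}"
    then have "e \<in> ?E" "{v} = e" using eq by (blast, simp only: cInf_singleton)
    then show False using dimE[of e] by auto
  qed
  ultimately obtain e e' where "e \<in> ?E" "e' \<in> ?E" "e \<noteq> e'"
    by blast
  then have AB_AC: "A \<inter> B \<in> ?E" "A \<inter> C \<in> ?E" "A \<inter> B \<noteq> A \<inter> C"
    using edge[of e] edge[of e'] by auto
  have "A \<inter> B face_of A \<inter> C"
    using AB face_of_Int[OF face(1,3)] sub by (subst face_of_face) auto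
  then have "aff_dim (A \<inter> B) < aff_dim (A \<inter> C)"
    using face_of_aff_dim_lt[OF _ _ AB_AC(3)] face_of_imp_convex[OF face_of_Int[OF face(1,3)]] by blast
  then show False using dimE[OF AB_AC(1)] dimE[OF AB_AC(2)] by simp
qed

section \<open>Colours as a linear map over the field with two elements\<close>

lemma inv_Z2_cube: "inv\<^bsub>Z2_cube\<^esub> g = - g"
proof -
  have "- g \<otimes>\<^bsub>Z2_cube\<^esub> g = \<one>\<^bsub>Z2_cube\<^esub>" "g \<in> carrier Z2_cube" "- g \<in> carrier Z2_cube"
    by (simp_all add: Z2_cube_def)
  then show ?thesis using group.inv_equality[OF group_Z2_cube] by blast
qed

lemma double_z2_cube [simp]: "(g::z2_cube) + g = 0"
  by (simp add: vec_eq_iff)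

lemma z2_cube_cancel: "(g::z2_cube) + (g + h) = h"
  by (simp add: add.assoc[symmetric])

lemma minus_z2_cube: "- (g::z2_cube) = g"
  by (simp add: vec_eq_iff)

lemma generate_Z2_cube:
  assumes "finite S"
  shows "generate Z2_cube (col ` S) = {\<Sum>A\<in>S. c A *s col A | c. True}"
proof (intro subset_antisym subsetI)
  fix g assume "g \<in> generate Z2_cube (col ` S)"
  then show "g \<in> {\<Sum>A\<in>S. c A *s col A | c. True}"
  proof (induction rule: generate.induct)
    case one
    show ?case by (auto simp: Z2_cube_def intro!: exI[of _ "\<lambda>_. 0"])
  next
    case (incl h)
    then obtain A where "A \<in> S" "h = col A" by blast
    then have "h = (\<Sum>B\<in>S. (if B = A then 1 else 0) *s col B)"
      using assms by (simp add: if_distrib[of "\<lambda>x. x *s _"] cong: if_cong)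
    then show ?case unfolding mem_Collect_eq by (intro exI conjI TrueI)
  next
    case (inv h)
    then obtain A where "A \<in> S" "h = col A" by blast
    then have "- h = (\<Sum>B\<in>S. (if B = A then 1 else 0) *s col B)"
      using assms by (simp add: minus_z2_cube if_distrib[of "\<lambda>x. x *s _"] cong: if_cong)
    then show ?case
      unfolding mem_Collect_eq inv_Z2_cube \<open>h = col A\<close> by (intro exI conjI TrueI)
  next
    case (eng h1 h2)
    then obtain c d where "h1 = (\<Sum>A\<in>S. c A *s col A)" "h2 = (\<Sum>A\<in>S. d A *s col A)"
      by blast
    then have "h1 + h2 = (\<Sum>A\<in>S. (c A + d A) *s col A)"
      by (simp only: vec.scale_left_distrib sum.distrib)
    then have "h1 \<otimes>\<^bsub>Z2_cube\<^esub> h2 = (\<Sum>A\<in>S. (c A + d A) *s col A)"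
      by (simp add: Z2_cube_def)
    then show ?case unfolding mem_Collect_eq by (intro exI conjI TrueI)
  qed
next
  fix g assume "g \<in> {\<Sum>A\<in>S. c A *s col A | c. True}"
  then obtain c where g: "g = (\<Sum>A\<in>S. c A *s col A)" by blast
  have "(\<Sum>A\<in>T. c A *s col A) \<in> generate Z2_cube (col ` S)" if "T \<subseteq> S" for T
    using finite_subset[OF that assms] that
  proof (induction T rule: finite_induct)
    case empty
    show ?case using generate.one[of Z2_cube] by (simp add: Z2_cube_def)
  next
    case (insert A T)
    have "c A *s col A \<in> generate Z2_cube (col ` S)"
      using insert.prems generate.incl[of "col A" "col ` S" Z2_cube] generate.one[of Z2_cube]
      by (cases "c A") (auto simp: Z2_cube_def)
    then show ?case
      using insert generate.eng[of "c A *s col A" Z2_cube] by (simp add: Z2_cube_def)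
  qed
  then show "g \<in> generate Z2_cube (col ` S)" using g by blast
qed

text \<open>The homomorphism from Z_2^m to Z_2^3 given by the colours, m being the number of facets;
  its kernel is the group of deck transformations of the covering by the pairs (p, v).\<close>

definition facet_sum :: "'a::euclidean_space set \<Rightarrow> ('a set \<Rightarrow> z2_cube) \<Rightarrow> ('a set \<Rightarrow> bit) \<Rightarrow> z2_cube" where
  "facet_sum P col c = (\<Sum>A\<in>facets P. c A *s col A)"

definition facets_at :: "'a::euclidean_space set \<Rightarrow> 'a \<Rightarrow> 'a set set" where
  "facets_at P p = {A \<in> facets P. p \<in> A}"

lemma facet_sum_add: "facet_sum P col (\<lambda>A. c A + d A) = facet_sum P col c + facet_sum P col d"
  by (simp only: facet_sum_def vec.scale_left_distrib sum.distrib)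

lemma facet_sum_zero: "facet_sum P col (\<lambda>_. 0) = 0"
  by (simp add: facet_sum_def)

lemma facet_sum_cong: "(\<And>A. A \<in> facets P \<Longrightarrow> c A = d A) \<Longrightarrow> facet_sum P col c = facet_sum P col d"
  by (simp add: facet_sum_def)

lemma facet_sum_restrict:
  assumes "finite (facets P)" "S \<subseteq> facets P" "\<And>A. A \<in> facets P \<Longrightarrow> A \<notin> S \<Longrightarrow> c A = 0"
  shows "facet_sum P col c = (\<Sum>A\<in>S. c A *s col A)"
  unfolding facet_sum_def by (rule sum.mono_neutral_right) (use assms in auto)

text \<open>Independence of the set of colours does not exclude repetitions. They are excluded
  because the set spans a space of dimension 3 and so has as many elements as there are facets at
  \<open>v\<close>.\<close>

lemma colours_at_vertex:
  assumes simple: "simple_3_polytope P" and char: "characteristic_map P col"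
    and v: "v extreme_point_of P"
  shows "inj_on col (facets_at P v)" "vec.independent (col ` facets_at P v)"
    "vec.span (col ` facets_at P v) = UNIV"
proof -
  have "card (facets_at P v) = 3"
    using simple v by (simp add: simple_3_polytope_def facets_at_def)
  then obtain A B C where ABC: "facets_at P v = {A, B, C}" "A \<noteq> B" "B \<noteq> C" "A \<noteq> C"
    by (auto simp: card_Suc_eq numeral_3_eq_3)
  then have *: "A \<in> facets P" "B \<in> facets P" "C \<in> facets P" "v \<in> A" "v \<in> B" "v \<in> C"
    by (auto simp: facets_at_def)
  have im: "col ` facets_at P v = {col A, col B, col C}" using ABC by auto
  show ind: "vec.independent (col ` facets_at P v)" and span: "vec.span (col ` facets_at P v) = UNIV"
    using char v * ABC(2-4) unfolding im characteristic_map_def by blast+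
  have "card (col ` facets_at P v) = vec.dim (UNIV :: z2_cube set)"
    using vec.dim_span_eq_card_independent[OF ind] span by simp
  then have "card (col ` facets_at P v) = card (facets_at P v)"
    unfolding vec_dim_card using \<open>card (facets_at P v) = 3\<close> by simp
  then show "inj_on col (facets_at P v)"
    by (rule eq_card_imp_inj_on[rotated]) (simp add: ABC)
qed

text \<open>The facets through \<open>p\<close> share a vertex, where their colours belong to a
  basis. This is the freeness of the deck transformations.\<close>

lemma facet_sum_independent:
  assumes simple: "simple_3_polytope P" and char: "characteristic_map P col" and "p \<in> P"
    and c: "\<And>A. A \<in> facets P \<Longrightarrow> p \<notin> A \<Longrightarrow> c A = 0" and "facet_sum P col c = 0" "A \<in> facets P"
  shows "c A = 0"
proof -
  have P: "polytope P" using simple by (simp add: simple_3_polytope_def)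
  obtain v where v: "v extreme_point_of P" "\<And>A. A \<in> facets P \<Longrightarrow> p \<in> A \<Longrightarrow> v \<in> A"
    using vertex_in_facets[OF P \<open>p \<in> P\<close>] by blast
  let ?S = "facets_at P v"
  note col = colours_at_vertex[OF simple char v(1)]
  have "finite ?S" using finite_facets[OF P] by (simp add: facets_at_def)
  have c0: "c A = 0" if "A \<in> facets P" "A \<notin> ?S" for A
    using that c v(2) by (auto simp: facets_at_def)
  have "0 = (\<Sum>A\<in>?S. c A *s col A)"
    using facet_sum_restrict[of P ?S c col, OF finite_facets[OF P] _ c0] assms(5) by (simp add: facets_at_def)
  also have "\<dots> = (\<Sum>g\<in>col ` ?S. c (the_inv_into ?S col g) *s g)"
    by (simp add: sum.reindex[OF col(1)] the_inv_into_f_f[OF col(1)])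
  finally have "c (the_inv_into ?S col g) = 0" if "g \<in> col ` ?S" for g
    using vec.independentD[OF col(2) _ subset_refl _ that, of "\<lambda>g. c (the_inv_into ?S col g)"] \<open>finite ?S\<close>
    by simp
  then show ?thesis
    using c0[OF \<open>A \<in> facets P\<close>] the_inv_into_f_f[OF col(1), of A] by (cases "A \<in> ?S") force+
qed

text \<open>Every group coordinate comes from a choice of signs, so every point of the small cover
  has a point of the covering above it.\<close>

lemma facet_sum_surj:
  assumes simple: "simple_3_polytope P" and char: "characteristic_map P col"
  shows "\<exists>c. facet_sum P col c = g"
proof -
  have P: "polytope P" "P \<noteq> {}" using simple by (auto simp: simple_3_polytope_def)
  then obtain v where v: "v extreme_point_of P"
    using vertex_in_facets by blast
  let ?S = "facets_at P v"
  note col = colours_at_vertex[OF simple char v(1)]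
  have "finite ?S" using finite_facets[OF P(1)] by (simp add: facets_at_def)
  then have "range (\<lambda>u. \<Sum>x\<in>col ` ?S. u x *s x) = UNIV"
    using col(3) vec.span_finite[of "col ` ?S"] by simp
  then obtain u where "g = (\<Sum>x\<in>col ` ?S. u x *s x)" by blast
  also have "\<dots> = (\<Sum>A\<in>?S. u (col A) *s col A)"
    by (simp add: sum.reindex[OF col(1)])
  also have "\<dots> = (\<Sum>A\<in>?S. (if v \<in> A then u (col A) else 0) *s col A)"
    by (rule sum.cong) (auto simp: facets_at_def)
  also have "\<dots> = facet_sum P col (\<lambda>A. if v \<in> A then u (col A) else 0)"
    by (rule facet_sum_restrict[symmetric]) (use finite_facets[OF P(1)] in \<open>auto simp: facets_at_def\<close>)
  finally show ?thesis by blast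
qed

section \<open>Points of the small cover and their equality\<close>

definition cover_point :: "'a::euclidean_space set \<Rightarrow> ('a set \<Rightarrow> z2_cube) \<Rightarrow> 'a \<Rightarrow> z2_cube \<Rightarrow> ('a \<times> z2_cube) set" where
  "cover_point P col p g = small_cover_rel P col `` {(p, g)}"

text \<open>The face group at \<open>p\<close> is generated by the colours of the facets through
  \<open>p\<close>; its elements are sums of these colours, here extended by zero to all
  facets.\<close>

lemma mem_cover_point_iff:
  assumes P: "polytope P"
  shows "(q, h) \<in> cover_point P col p g \<longleftrightarrow> p \<in> P \<and> q = p \<and>
    (\<exists>c. (\<forall>A\<in>facets P. p \<notin> A \<longrightarrow> c A = 0) \<and> h = g + facet_sum P col c)"
proof (cases "p \<in> P")
  case True
  have S: "{A \<in> facets P. carrier_face P p \<subseteq> A} = facets_at P p"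
    using carrier_face_subset_facet_iff[OF P True] by (auto simp: facets_at_def)
  have fin: "finite (facets_at P p)" using finite_facets[OF P] by (simp add: facets_at_def)
  have "- g + h \<in> face_group P col (carrier_face P p) \<longleftrightarrow>
      (\<exists>c. (\<forall>A\<in>facets P. p \<notin> A \<longrightarrow> c A = 0) \<and> - g + h = facet_sum P col c)"
  proof
    assume "- g + h \<in> face_group P col (carrier_face P p)"
    then obtain c where "- g + h = (\<Sum>A\<in>facets_at P p. c A *s col A)"
      unfolding face_group_def S generate_Z2_cube[OF fin] by blast
    also have "\<dots> = (\<Sum>A\<in>facets_at P p. (if p \<in> A then c A else 0) *s col A)"
      by (rule sum.cong) (auto simp: facets_at_def)
    also have "\<dots> = facet_sum P col (\<lambda>A. if p \<in> A then c A else 0)"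
      by (rule facet_sum_restrict[symmetric]) (use finite_facets[OF P] in \<open>auto simp: facets_at_def\<close>)
    finally show "\<exists>c. (\<forall>A\<in>facets P. p \<notin> A \<longrightarrow> c A = 0) \<and> - g + h = facet_sum P col c"
      by (intro exI conjI) auto
  next
    assume "\<exists>c. (\<forall>A\<in>facets P. p \<notin> A \<longrightarrow> c A = 0) \<and> - g + h = facet_sum P col c"
    then obtain c where c: "\<forall>A\<in>facets P. p \<notin> A \<longrightarrow> c A = 0" "- g + h = facet_sum P col c" by blast
    have "facet_sum P col c = (\<Sum>A\<in>facets_at P p. c A *s col A)"
      by (rule facet_sum_restrict) (use finite_facets[OF P] c(1) in \<open>auto simp: facets_at_def\<close>)
    then show "- g + h \<in> face_group P col (carrier_face P p)"
      unfolding face_group_def S generate_Z2_cube[OF fin] using c(2) by auto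
  qed
  moreover have "- g + h = s \<longleftrightarrow> h = g + s" for s
    unfolding minus_z2_cube using z2_cube_cancel[of g s] z2_cube_cancel[of g h] by auto
  moreover have "(q, h) \<in> cover_point P col p g \<longleftrightarrow>
      p \<in> P \<and> q = p \<and> - g + h \<in> face_group P col (carrier_face P p)"
    unfolding cover_point_def small_cover_rel_def inv_Z2_cube by (auto simp: Z2_cube_def)
  ultimately show ?thesis
    using True by simp
qed (simp add: cover_point_def small_cover_rel_def)

lemma cover_point_self:
  assumes "polytope P" "p \<in> P"
  shows "(p, g) \<in> cover_point P col p g"
  unfolding mem_cover_point_iff[OF assms(1)]
  using assms(2) by (intro conjI exI[of _ "\<lambda>_. 0"]) (simp_all add: facet_sum_zero)

lemma cover_point_eq_iff:
  assumes P: "polytope P" and "p \<in> P"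
  shows "cover_point P col p g = cover_point P col q h \<longleftrightarrow> q = p \<and>
    (\<exists>c. (\<forall>A\<in>facets P. p \<notin> A \<longrightarrow> c A = 0) \<and> h = g + facet_sum P col c)"
proof
  assume eq: "cover_point P col p g = cover_point P col q h"
  \<comment> \<open>The class of a point outside \<open>P\<close> is empty, whereas this one
    contains \<open>(p, g)\<close>.\<close>
  then have "q \<in> P"
    using cover_point_self[OF assms, of g col] mem_cover_point_iff[OF P] by metis
  then have "(q, h) \<in> cover_point P col p g"
    unfolding eq by (rule cover_point_self[OF P])
  then show "q = p \<and> (\<exists>c. (\<forall>A\<in>facets P. p \<notin> A \<longrightarrow> c A = 0) \<and> h = g + facet_sum P col c)"
    unfolding mem_cover_point_iff[OF P] by blast
next
  assume "q = p \<and> (\<exists>c. (\<forall>A\<in>facets P. p \<notin> A \<longrightarrow> c A = 0) \<and> h = g + facet_sum P col c)"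
  then obtain c where c: "q = p" "\<forall>A\<in>facets P. p \<notin> A \<longrightarrow> c A = 0" "h = g + facet_sum P col c"
    by blast
  have "(\<exists>d::'a set \<Rightarrow> bit. (\<forall>A\<in>facets P. p \<notin> A \<longrightarrow> d A = 0) \<and> k = g + facet_sum P col d) \<longleftrightarrow>
      (\<exists>d::'a set \<Rightarrow> bit. (\<forall>A\<in>facets P. p \<notin> A \<longrightarrow> d A = 0) \<and> k = h + facet_sum P col d)" for k
  proof safe
    fix d :: "'a set \<Rightarrow> bit" assume "\<forall>A\<in>facets P. p \<notin> A \<longrightarrow> d A = 0"
    then show "\<exists>d'. (\<forall>A\<in>facets P. p \<notin> A \<longrightarrow> d' A = 0) \<and> g + facet_sum P col d = h + facet_sum P col d'"
      using c(2) by (intro exI[of _ "\<lambda>A. c A + d A"] conjI)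
        (simp, simp only: c(3) facet_sum_add add.assoc z2_cube_cancel)
  next
    fix d :: "'a set \<Rightarrow> bit" assume "\<forall>A\<in>facets P. p \<notin> A \<longrightarrow> d A = 0"
    then show "\<exists>d'. (\<forall>A\<in>facets P. p \<notin> A \<longrightarrow> d' A = 0) \<and> h + facet_sum P col d = g + facet_sum P col d'"
      using c(2) by (intro exI[of _ "\<lambda>A. c A + d A"] conjI)
        (simp, simp only: c(3) facet_sum_add add.assoc)
  qed
  then show "cover_point P col p g = cover_point P col q h"
    using mem_cover_point_iff[OF P] c(1) by (auto simp: set_eq_iff)
qed

lemma small_cover_proj_cover_point:
  assumes "polytope P" "p \<in> P"
  shows "small_cover_proj (cover_point P col p g) = p"
proof -
  have "(p, g) \<in> cover_point P col p g"
    by (rule cover_point_self[OF assms])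
  moreover have "fst x = p" if "x \<in> cover_point P col p g" for x
    using that mem_cover_point_iff[OF assms(1), of "fst x" "snd x"] by (metis prod.collapse)
  ultimately have "fst ` cover_point P col p g = {p}"
    by force
  then show ?thesis by (simp add: small_cover_proj_def)
qed

lemma quotient_map_cover_point:
  "quotient_map (prod_topology (top_of_set P) (discrete_topology UNIV)) (small_cover P col)
    (\<lambda>(p, g). cover_point P col p g)"
proof -
  have "(\<lambda>(p, g). cover_point P col p g) = (\<lambda>x. small_cover_rel P col `` {x})"
    by (auto simp: cover_point_def)
  then show ?thesis
    unfolding small_cover_def by (simp only: quotient_map_quotient_topology)
qed

lemma topspace_small_cover: "topspace (small_cover P col) = {cover_point P col p g | p g. p \<in> P}"
  unfolding small_cover_def topspace_quotient_topology quotient_def cover_point_def by auto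

lemma continuous_map_small_cover_proj:
  assumes "polytope P"
  shows "continuous_map (small_cover P col) (top_of_set P) small_cover_proj"
proof (rule continuous_compose_quotient_map[OF quotient_map_cover_point])
  show "continuous_map (prod_topology (top_of_set P) (discrete_topology UNIV)) (top_of_set P)
      (small_cover_proj \<circ> (\<lambda>(p, g). cover_point P col p g))"
    by (rule continuous_map_eq[OF continuous_map_fst])
      (auto simp: small_cover_proj_cover_point[OF assms])
qed

lemma continuous_map_cover_point:
  "continuous_map (top_of_set P) (small_cover P col) (\<lambda>p. cover_point P col p g)"
proof -
  have "continuous_map (top_of_set P) (prod_topology (top_of_set P) (discrete_topology UNIV)) (\<lambda>p. (p, g))"
    by (intro continuous_intros) auto
  from continuous_map_compose[OF this quotient_imp_continuous_map[OF quotient_map_cover_point[of P col]]]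
  show ?thesis by (simp add: o_def)
qed

subsection \<open>The square\<close>

text \<open>A continuous map from a compact space onto a Hausdorff space is a quotient map, so
  \<open>q\<close> descends along \<open>p\<close>. It serves to compare two parametrisations of a
  circle that identify the same end points.\<close>

lemma continuous_factor_compact:
  fixes p :: "'a::topological_space \<Rightarrow> 'b::metric_space" and q :: "'a \<Rightarrow> 'c::topological_space"
  assumes "compact K" "continuous_on K p" "continuous_on K q"
    and fibres: "\<And>s t. s \<in> K \<Longrightarrow> t \<in> K \<Longrightarrow> p s = p t \<Longrightarrow> q s = q t"
  shows "\<exists>f. continuous_on (p ` K) f \<and> (\<forall>t\<in>K. f (p t) = q t)"
proof -
  define f where "f x = q (SOME t. t \<in> K \<and> p t = x)" for x
  have f: "f (p t) = q t" if "t \<in> K" for t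
  proof -
    have "(SOME s. s \<in> K \<and> p s = p t) \<in> K \<and> p (SOME s. s \<in> K \<and> p s = p t) = p t"
      by (rule someI[of _ t]) (use that in simp)
    then show ?thesis unfolding f_def using fibres that by blast
  qed
  have "quotient_map (top_of_set K) (top_of_set (p ` K)) p"
  proof (rule continuous_imp_quotient_map)
    show "continuous_map (top_of_set K) (top_of_set (p ` K)) p"
      using assms(2) by (simp add: continuous_map_in_subtopology)
    show "compact_space (top_of_set K)"
      using assms(1) by (simp add: compact_space_subtopology)
    show "Hausdorff_space (top_of_set (p ` K))"
      by (intro Hausdorff_space_subtopology Hausdorff_space_euclidean)
  qed simp
  moreover have "continuous_map (top_of_set K) euclidean (f \<circ> p)"
    using assms(3) f by (simp add: continuous_on_eq)
  ultimately have "continuous_map (top_of_set (p ` K)) euclidean f"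
    by (rule continuous_compose_quotient_map)
  then show ?thesis using f by auto
qed

section \<open>Coning between the disc and the square\<close>

definition gauge_function :: "('a::real_normed_vector \<Rightarrow> real) \<Rightarrow> bool" where
  "gauge_function N \<longleftrightarrow> continuous_on UNIV N \<and> (\<forall>x. N x \<ge> 0) \<and> (\<forall>x. N x = 0 \<longleftrightarrow> x = 0) \<and>
    (\<forall>r x. r \<ge> 0 \<longrightarrow> N (r *\<^sub>R x) = r * N x)"

text \<open>Radial extension from the unit level set of \<open>N\<close>, as in the Alexander trick.
  At the origin the factor \<open>N x\<close> is 0, whatever \<open>f\<close> returns there.\<close>

definition cone_map :: "('a::real_normed_vector \<Rightarrow> real) \<Rightarrow> ('a \<Rightarrow> 'b::real_normed_vector) \<Rightarrow> 'a \<Rightarrow> 'b" where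
  "cone_map N f x = N x *\<^sub>R f (x /\<^sub>R N x)"

lemma gauge_functionD:
  assumes "gauge_function N"
  shows "continuous_on UNIV N" "N x \<ge> 0" "N x = 0 \<longleftrightarrow> x = 0" "r \<ge> 0 \<Longrightarrow> N (r *\<^sub>R x) = r * N x"
  using assms unfolding gauge_function_def by blast+

lemma gauge_normalize:
  assumes "gauge_function N" "x \<noteq> 0"
  shows "N (x /\<^sub>R N x) = 1"
proof -
  have "N x \<noteq> 0" "inverse (N x) \<ge> 0"
    using gauge_functionD(2,3)[OF assms(1), of x] assms(2) by auto
  then show ?thesis using gauge_functionD(4)[OF assms(1), of "inverse (N x)" x] by simp
qed

text \<open>The delicate point is the apex, near which the directions \<open>x /\<^sub>R N x\<close>
  need not converge; there the value is bounded by \<open>N\<close> times a bound of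
  \<open>f\<close> and tends to 0.\<close>

lemma continuous_on_cone_map:
  fixes N :: "'a::real_normed_vector \<Rightarrow> real" and f :: "'a \<Rightarrow> 'b::real_normed_vector"
  assumes N: "gauge_function N" and f: "continuous_on {x. N x = 1} f" and bd: "bounded (f ` {x. N x = 1})"
  shows "continuous_on UNIV (cone_map N f)"
proof -
  have N': "continuous_on UNIV N" "\<And>x. N x = 0 \<longleftrightarrow> x = 0" "\<And>x. N x \<ge> 0"
    using gauge_functionD[OF N] by blast+
  have off: "continuous_on (- {0}) (cone_map N f)"
    unfolding cone_map_def
  proof (intro continuous_intros)
    show "continuous_on (- {0}) N" using N'(1) continuous_on_subset by blast
    have "continuous_on (- {0}) (\<lambda>x. x /\<^sub>R N x)"
      using N' by (intro continuous_intros continuous_on_subset[OF N'(1)]) auto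
    then show "continuous_on (- {0}) (\<lambda>x. f (x /\<^sub>R N x))"
      by (rule continuous_on_compose2[OF f]) (auto simp: gauge_normalize[OF N])
  qed
  have "isCont (cone_map N f) x" for x
  proof (cases "x = 0")
    case False
    have "open (- {0 :: 'a})" by (rule open_Compl) (rule closed_singleton)
    with off show ?thesis using False continuous_on_eq_continuous_at by blast
  next
    case True
    obtain B where B: "\<And>x. N x = 1 \<Longrightarrow> norm (f x) \<le> B"
      using bd unfolding bounded_iff by auto
    have bound: "norm (cone_map N f y) \<le> N y * \<bar>B\<bar>" for y
    proof (cases "y = 0")
      case True
      then show ?thesis using N'(2)[of 0] by (simp add: cone_map_def)
    next
      case False
      then have "norm (f (y /\<^sub>R N y)) \<le> \<bar>B\<bar>"
        using B[OF gauge_normalize[OF N False]] by linarith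
      then show ?thesis using N'(3)[of y] by (simp add: cone_map_def mult_left_mono)
    qed
    have "((\<lambda>y. N y * \<bar>B\<bar>) \<longlongrightarrow> N 0 * \<bar>B\<bar>) (at 0)"
      using N'(1) by (intro tendsto_mult tendsto_const) (simp add: continuous_on_def)
    then have "((\<lambda>y. N y * \<bar>B\<bar>) \<longlongrightarrow> 0) (at 0)"
      using N'(2)[of 0] by simp
    then have "(cone_map N f \<longlongrightarrow> 0) (at 0)"
      by (rule Lim_null_comparison[rotated]) (simp add: bound)
    moreover have "cone_map N f 0 = 0" using N'(2)[of 0] by (simp add: cone_map_def)
    ultimately show ?thesis using True by (simp add: isCont_def)
  qed
  then show ?thesis by (simp add: continuous_on_eq_continuous_at)
qed

lemma gauge_cone_map:
  assumes N: "gauge_function N" and N': "gauge_function N'" and f: "\<And>x. N x = 1 \<Longrightarrow> N' (f x) = 1"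
  shows "N' (cone_map N f x) = N x"
proof (cases "x = 0")
  case True
  then show ?thesis
    using gauge_functionD(3)[OF N, of 0] gauge_functionD(3)[OF N', of 0] by (simp add: cone_map_def)
next
  case False
  then show ?thesis
    using f[OF gauge_normalize[OF N False]] gauge_functionD(2)[OF N, of x]
    by (simp add: cone_map_def gauge_functionD(4)[OF N'])
qed

lemma cone_map_inverse:
  assumes N: "gauge_function N" and N': "gauge_function N'" and f: "\<And>x. N x = 1 \<Longrightarrow> N' (f x) = 1"
    and gf: "\<And>x. N x = 1 \<Longrightarrow> g (f x) = x"
  shows "cone_map N' g (cone_map N f x) = x"
proof (cases "x = 0")
  case True
  then show ?thesis
    using gauge_functionD(3)[OF N, of 0] gauge_functionD(3)[OF N', of 0] by (simp add: cone_map_def)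
next
  case False
  then have "N x \<noteq> 0" using gauge_functionD(3)[OF N] by blast
  then have "cone_map N f x /\<^sub>R N x = f (x /\<^sub>R N x)" by (simp add: cone_map_def)
  moreover have "N' (cone_map N f x) = N x" by (rule gauge_cone_map[OF N N' f])
  ultimately have "cone_map N' g (cone_map N f x) = N x *\<^sub>R g (f (x /\<^sub>R N x))"
    unfolding cone_map_def[of N' g] by simp
  then show ?thesis
    using gf[OF gauge_normalize[OF N False]] \<open>N x \<noteq> 0\<close> by simp
qed

lemma cone_map_unit: "N x = 1 \<Longrightarrow> cone_map N f x = f x"
  by (simp add: cone_map_def)

lemma gauge_function_norm: "gauge_function norm"
  by (simp add: gauge_function_def continuous_on_norm_id)

text \<open>The factor 2 makes the unit level set the boundary of a square of side 1, that is, of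
  \<open>unit_square\<close> translated so that its centre is the origin.\<close>

definition square_gauge :: "real \<times> real \<Rightarrow> real" where
  "square_gauge w = 2 * max \<bar>fst w\<bar> \<bar>snd w\<bar>"

lemma gauge_function_square: "gauge_function square_gauge"
  unfolding gauge_function_def square_gauge_def
proof (intro conjI allI impI)
  fix r :: real and x :: "real \<times> real" assume "r \<ge> 0"
  then show "2 * max \<bar>fst (r *\<^sub>R x)\<bar> \<bar>snd (r *\<^sub>R x)\<bar> = r * (2 * max \<bar>fst x\<bar> \<bar>snd x\<bar>)"
    by (simp add: abs_mult max_mult_distrib_left)
next
  show "continuous_on UNIV (\<lambda>w::real \<times> real. 2 * max \<bar>fst w\<bar> \<bar>snd w\<bar>)"
    by (intro continuous_intros)
qed (auto simp: prod_eq_iff max_def)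

text \<open>Runs once around the boundary of the unit square, with \<open>[(i-1)/4, i/4]\<close> going to the sides
  \<open>a = 0\<close>, \<open>b = 0\<close>, \<open>a = 1\<close>, \<open>b = 1\<close> in this order.\<close>

definition square_boundary :: "real \<Rightarrow> real \<times> real" where
  "square_boundary t = (min 1 (max 0 (min (4 * t - 1) (4 - 4 * t))), min 1 (max 0 (max (1 - 4 * t) (4 * t - 2))))"

lemma continuous_on_square_boundary: "continuous_on S square_boundary"
  unfolding square_boundary_def by (intro continuous_intros)

text \<open>The path visits (0, 1), (0, 0), (1, 0), (1, 1), (0, 1), so the first and the last side
  are run through against their coordinate.\<close>

lemma square_boundary_sides:
  assumes "0 \<le> s" "s \<le> 1"
  shows "square_boundary ((1 - s) / 4) = (0, s)" "square_boundary ((1 + s) / 4) = (s, 0)"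
    "square_boundary ((2 + s) / 4) = (1, s)" "square_boundary ((4 - s) / 4) = (s, 1)"
  using assms by (auto simp: square_boundary_def min_def max_def field_simps)

lemma square_boundary_cases:
  assumes "t \<in> {0..1}"
  obtains "t \<le> 1/4" "square_boundary t = (0, 1 - 4 * t)"
    | "1/4 \<le> t" "t \<le> 1/2" "square_boundary t = (4 * t - 1, 0)"
    | "1/2 \<le> t" "t \<le> 3/4" "square_boundary t = (1, 4 * t - 2)"
    | "3/4 \<le> t" "square_boundary t = (4 - 4 * t, 1)"
proof -
  have t: "0 \<le> t" "t \<le> 1" using assms by auto
  consider "t \<le> 1/4" | "1/4 \<le> t" "t \<le> 1/2" | "1/2 \<le> t" "t \<le> 3/4" | "3/4 \<le> t" by linarith
  then show thesis
  proof cases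
    case 1
    then show thesis using that(1) square_boundary_sides(1)[of "1 - 4 * t"] t by simp
  next
    case 2
    then show thesis using that(2) square_boundary_sides(2)[of "4 * t - 1"] t by simp
  next
    case 3
    then show thesis using that(3) square_boundary_sides(3)[of "4 * t - 2"] t by simp
  next
    case 4
    then show thesis using that(4) square_boundary_sides(4)[of "4 - 4 * t"] t by simp
  qed
qed

lemma square_boundary_inverse:
  assumes "t \<in> {0..1}" "square_boundary t = (x, y)"
  shows "x = 0 \<and> t = (1 - y) / 4 \<or> y = 0 \<and> t = (1 + x) / 4 \<or> x = 1 \<and> t = (2 + y) / 4 \<or> y = 1 \<and> t = (4 - x) / 4"
  by (rule square_boundary_cases[OF assms(1)]) (use assms(2) in simp_all)

lemma square_boundary_inj:
  assumes "s \<in> {0..1}" "t \<in> {0..1}" "square_boundary s = square_boundary t"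
  shows "s = t \<or> s = 0 \<and> t = 1 \<or> s = 1 \<and> t = 0"
proof -
  obtain x y where xy: "square_boundary t = (x, y)" by fastforce
  then have "square_boundary s = (x, y)" using assms(3) by simp
  from square_boundary_inverse[OF assms(1) this] square_boundary_inverse[OF assms(2) xy]
  show ?thesis by (elim disjE) simp_all
qed

lemma square_boundary_image:
  "(\<lambda>t. square_boundary t - (1/2, 1/2)) ` {0..1} = {w. square_gauge w = 1}" (is "?f ` _ = _")
proof (intro subset_antisym subsetI)
  fix w assume "w \<in> ?f ` {0..1}"
  then obtain t where t: "t \<in> {0..1}" "w = ?f t" by blast
  show "w \<in> {w. square_gauge w = 1}"
    by (rule square_boundary_cases[OF t(1)]) (use t in \<open>auto simp: square_gauge_def max_def abs_if\<close>)
next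
  fix w assume "w \<in> {w. square_gauge w = 1}"
  then obtain x y where w: "w = (x - 1/2, y - 1/2)" and m: "max \<bar>x - 1/2\<bar> \<bar>y - 1/2\<bar> = 1/2"
    by (cases w) (force simp: square_gauge_def intro: that[of "fst w + 1/2" "snd w + 1/2"])
  then have xy: "0 \<le> x" "x \<le> 1" "0 \<le> y" "y \<le> 1" and "x = 0 \<or> x = 1 \<or> y = 0 \<or> y = 1"
    by (auto simp: max_def abs_if split: if_splits)
  then have "\<exists>t\<in>{0..1}. square_boundary t = (x, y)"
  proof (elim disjE)
    assume "x = 0"
    then show ?thesis using square_boundary_sides(1)[OF xy(3,4)] xy by (intro bexI[of _ "(1 - y) / 4"]) auto
  next
    assume "x = 1"
    then show ?thesis using square_boundary_sides(3)[OF xy(3,4)] xy by (intro bexI[of _ "(2 + y) / 4"]) auto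
  next
    assume "y = 0"
    then show ?thesis using square_boundary_sides(2)[OF xy(1,2)] xy by (intro bexI[of _ "(1 + x) / 4"]) auto
  next
    assume "y = 1"
    then show ?thesis using square_boundary_sides(4)[OF xy(1,2)] xy by (intro bexI[of _ "(4 - x) / 4"]) auto
  qed
  then show "w \<in> ?f ` {0..1}" using w by force
qed

abbreviation unit_square :: "(real \<times> real) set" where
  "unit_square \<equiv> {0..1} \<times> {0..1}"

lemma unit_square_gauge: "w \<in> unit_square \<longleftrightarrow> square_gauge (w - (1/2, 1/2)) \<le> 1"
proof -
  obtain x y where w: "w = (x, y)" by (cases w)
  have "square_gauge (w - (1/2, 1/2)) \<le> 1 \<longleftrightarrow> max \<bar>x - 1/2\<bar> \<bar>y - 1/2\<bar> \<le> 1/2"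
    unfolding w square_gauge_def by (simp, linarith)
  then show ?thesis
    unfolding w max.bounded_iff by (simp add: abs_le_iff) argo
qed

text \<open>A parametrisation of the boundary of a disc by the boundary of the unit square is coned off
  from the centres.\<close>

lemma disc_square_coordinates:
  fixes c :: "real \<Rightarrow> 'a::euclidean_space"
  assumes c: "simple_path c" "pathfinish c = pathstart c"
    and hk: "homeomorphism (cball (0::complex) 1) Q h k" and sph: "h ` sphere 0 1 = path_image c"
  shows "\<exists>\<eta> ab. continuous_on unit_square \<eta> \<and> \<eta> ` unit_square \<subseteq> Q \<and>
    continuous_on Q ab \<and> ab ` Q \<subseteq> unit_square \<and> (\<forall>q\<in>Q. \<eta> (ab q) = q) \<and>
    (\<forall>t\<in>{0..1}. \<eta> (square_boundary t) = c t) \<and> (\<forall>t\<in>{0..1}. ab (c t) = square_boundary t)"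
proof -
  let ?o = "(1/2, 1/2) :: real \<times> real"
  let ?s = "\<lambda>t. square_boundary t - ?o" and ?T = "\<lambda>t. k (c t)"
  have hk': "continuous_on (cball 0 1) h" "continuous_on Q k" "h ` cball 0 1 = Q" "k ` Q = cball 0 1"
    "\<And>z. z \<in> cball 0 1 \<Longrightarrow> k (h z) = z" "\<And>q. q \<in> Q \<Longrightarrow> h (k q) = q"
    using hk by (auto simp: homeomorphism_def)
  have cQ: "c t \<in> Q" if "t \<in> {0..1}" for t
    using that sph hk'(3) sphere_cball[of "0::complex" 1] unfolding path_image_def by blast
  have "continuous_on {0..1} c" using c(1) by (simp add: simple_path_def path_def)
  then have cT: "continuous_on {0..1} ?T"
    by (rule continuous_on_compose2[OF hk'(2)]) (use cQ in auto)
  have cs: "continuous_on {0..1} ?s"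
    by (intro continuous_intros continuous_on_square_boundary)
  have c01: "c 0 = c 1" using c(2) by (simp add: pathfinish_def pathstart_def)
  have s01: "square_boundary 0 = square_boundary 1" by (simp add: square_boundary_def)
  have T_s: "?s s = ?s t" if "s \<in> {0..1}" "t \<in> {0..1}" "?T s = ?T t" for s t
  proof -
    have "c s = c t" using hk'(6)[OF cQ[OF that(1)]] hk'(6)[OF cQ[OF that(2)]] that(3) by metis
    then have "s = t \<or> s = 0 \<and> t = 1 \<or> s = 1 \<and> t = 0"
      using c(1) that(1,2) by (auto simp: simple_path_def loop_free_def)
    then show ?thesis using s01 by auto
  qed
  have s_T: "?T s = ?T t" if "s \<in> {0..1}" "t \<in> {0..1}" "?s s = ?s t" for s t
  proof -
    have "square_boundary s = square_boundary t" using that(3) by simp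
    then show ?thesis using square_boundary_inj[OF that(1,2)] c01 by auto
  qed
  \<comment> \<open>\<open>f\<close> and \<open>g\<close> reparametrise the unit circle as the
    boundary of the centred square and back; both exist because \<open>c\<close> and
    \<open>square_boundary\<close> identify just the parameters 0 and 1.\<close>
  obtain f where f: "continuous_on (?T ` {0..1}) f" "\<And>t. t \<in> {0..1} \<Longrightarrow> f (?T t) = ?s t"
    using continuous_factor_compact[OF compact_Icc cT cs T_s] by blast
  obtain g where g: "continuous_on (?s ` {0..1}) g" "\<And>t. t \<in> {0..1} \<Longrightarrow> g (?s t) = ?T t"
    using continuous_factor_compact[OF compact_Icc cs cT s_T] by blast
  have "(\<lambda>z. k (h z)) ` sphere 0 1 = (\<lambda>z. z) ` sphere 0 1"
    by (rule image_cong[OF refl]) (use hk'(5) in simp)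
  then have "k ` path_image c = sphere 0 1"
    unfolding sph[symmetric] by (simp add: image_image)
  then have T_im: "?T ` {0..1} = {z. norm z = 1}"
    unfolding path_image_def image_image by (simp add: sphere_def)
  note s_im = square_boundary_image
  have s1: "square_gauge (?s t) = 1" and T1: "norm (?T t) = 1" if "t \<in> {0..1}" for t
    using imageI[OF that, of ?s] imageI[OF that, of ?T] unfolding s_im T_im by simp_all
  have fg: "square_gauge (f z) = 1" "g (f z) = z" if z: "norm z = 1" for z
  proof -
    have "z \<in> ?T ` {0..1}" unfolding T_im using z by simp
    then obtain t where t: "z = ?T t" "t \<in> {0..1}" by (rule imageE)
    show "square_gauge (f z) = 1" "g (f z) = z"
      unfolding t(1) f(2)[OF t(2)] g(2)[OF t(2)] using s1[OF t(2)] by simp_all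
  qed
  have gf: "norm (g w) = 1" if w: "square_gauge w = 1" for w
  proof -
    have "w \<in> ?s ` {0..1}" unfolding s_im using w by simp
    then obtain t where t: "w = ?s t" "t \<in> {0..1}" by (rule imageE)
    show ?thesis unfolding t(1) g(2)[OF t(2)] by (rule T1[OF t(2)])
  qed
  define \<eta> where "\<eta> w = h (cone_map square_gauge g (w - ?o))" for w
  define ab where "ab q = ?o + cone_map norm f (k q)" for q
  have bdf: "bounded (f ` {z. norm z = 1})" and bdg: "bounded (g ` {w. square_gauge w = 1})"
    using compact_continuous_image[OF f(1) compact_continuous_image[OF cT compact_Icc]]
      compact_continuous_image[OF g(1) compact_continuous_image[OF cs compact_Icc]]
    unfolding T_im s_im by (simp_all add: compact_imp_bounded)
  have cf: "continuous_on UNIV (cone_map norm f)"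
    using f(1) unfolding T_im by (intro continuous_on_cone_map gauge_function_norm bdf)
  have cg: "continuous_on UNIV (cone_map square_gauge g)"
    using g(1) unfolding s_im by (intro continuous_on_cone_map gauge_function_square bdg)
  have ng: "norm (cone_map square_gauge g w) = square_gauge w" for w
    by (rule gauge_cone_map[OF gauge_function_square gauge_function_norm gf])
  have nf: "square_gauge (cone_map norm f z) = norm z" for z
    by (rule gauge_cone_map[OF gauge_function_norm gauge_function_square fg(1)])
  have "continuous_on unit_square (\<lambda>w. cone_map square_gauge g (w - ?o))"
    by (rule continuous_on_compose2[OF cg]) (auto intro!: continuous_intros)
  moreover have disc: "cone_map square_gauge g (w - ?o) \<in> cball 0 1" if "w \<in> unit_square" for w
    using that unfolding unit_square_gauge by (simp add: ng)
  ultimately have 1: "continuous_on unit_square \<eta>"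
    unfolding \<eta>_def by (intro continuous_on_compose2[OF hk'(1)] image_subsetI)
  have 2: "\<eta> ` unit_square \<subseteq> Q"
    unfolding \<eta>_def hk'(3)[symmetric] by (intro image_subsetI imageI disc)
  have "continuous_on Q (\<lambda>q. cone_map norm f (k q))"
    by (rule continuous_on_compose2[OF cf hk'(2)]) simp
  then have 3: "continuous_on Q ab"
    unfolding ab_def by (intro continuous_on_add continuous_on_const)
  have kQ: "norm (k q) \<le> 1" if "q \<in> Q" for q
    using imageI[OF that, of k] unfolding hk'(4) by simp
  have 4: "ab ` Q \<subseteq> unit_square"
    unfolding image_subset_iff unit_square_gauge ab_def by (simp add: nf kQ)
  have 5: "\<eta> (ab q) = q" if "q \<in> Q" for q
    using hk'(6)[OF that]
    by (simp add: \<eta>_def ab_def cone_map_inverse[OF gauge_function_norm gauge_function_square fg])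
  have 6: "\<eta> (square_boundary t) = c t" if "t \<in> {0..1}" for t
    using g(2)[OF that] hk'(6)[OF cQ[OF that]] s1[OF that] by (simp add: \<eta>_def cone_map_unit)
  have 7: "ab (c t) = square_boundary t" if "t \<in> {0..1}" for t
    using f(2)[OF that] T1[OF that] by (simp add: ab_def cone_map_unit)
  show ?thesis
    by (intro exI[of _ \<eta>] exI[of _ ab]) (use 1 2 3 4 5 6 7 in blast)
qed

subsection \<open>Lifting to the real moment-angle cover\<close>

text \<open>At 0 the sign is 0 by convention. A facet whose coordinate vanishes contains the point,
  and there both signs give the same class in the small cover.\<close>

definition sgn_bit :: "real \<Rightarrow> bit" where
  "sgn_bit x = (if x < 0 then 1 else 0)"

definition flip :: "bit \<Rightarrow> real \<Rightarrow> real" where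
  "flip b x = (if b = 0 then x else - x)"

lemma flip_zero [simp]: "flip b 0 = 0" and abs_flip [simp]: "\<bar>flip b x\<bar> = \<bar>x\<bar>"
  by (simp_all add: flip_def)

lemma sgn_bit_flip: "x \<noteq> 0 \<Longrightarrow> sgn_bit (flip b x) = sgn_bit x + b"
  by (cases b) (auto simp: sgn_bit_def flip_def)

lemma flip_inject: "x \<noteq> 0 \<Longrightarrow> flip b x = flip c x \<longleftrightarrow> b = c"
  by (cases b; cases c) (auto simp: flip_def)

lemma eq_flip_of_abs_eq: "\<bar>y\<bar> = \<bar>x\<bar> \<Longrightarrow> y = flip (sgn_bit x + sgn_bit y) x"
  by (auto simp: flip_def sgn_bit_def abs_if split: if_splits)

lemma continuous_on_flip: "continuous_on D f \<Longrightarrow> continuous_on D (\<lambda>z. flip b (f z))"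
  by (cases "b = 0") (simp_all add: flip_def continuous_on_minus)

lemma bit_add_self_eq: "(a::bit) + b = 0 \<longleftrightarrow> a = b"
  by (cases a; cases b) auto

lemma finite_UNIV_bit: "finite (UNIV :: bit set)"
proof -
  have "b \<in> {0, 1}" for b :: bit
    by (cases b) auto
  then have "(UNIV :: bit set) \<subseteq> {0, 1}" by blast
  then show ?thesis by (rule finite_subset) simp
qed

text \<open>The slices over single points of the discrete factor are open and cover the
  product.\<close>

lemma continuous_map_prod_discrete:
  fixes f :: "'b \<times> 'd \<Rightarrow> 'c"
  assumes "\<And>g. continuous_map X Y (\<lambda>p. f (p, g))"
  shows "continuous_map (prod_topology X (discrete_topology UNIV)) Y f"
proof (rule pasting_lemma[where I = UNIV and T = "\<lambda>g. topspace X \<times> {g}" and f = "\<lambda>g y. f (fst y, g)"])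
  fix g :: 'd
  show "openin (prod_topology X (discrete_topology UNIV)) (topspace X \<times> {g})"
    by (simp add: openin_prod_Times_iff)
  have "continuous_map (prod_topology X (discrete_topology UNIV)) Y ((\<lambda>p. f (p, g)) \<circ> fst)"
    by (rule continuous_map_compose[OF continuous_map_fst assms])
  then show "continuous_map (subtopology (prod_topology X (discrete_topology UNIV)) (topspace X \<times> {g})) Y
      (\<lambda>y. f (fst y, g))"
    unfolding o_def by (rule continuous_map_from_subtopology)
qed auto

locale coloured_polytope =
  fixes P :: "'a::euclidean_space set" and col :: "'a set \<Rightarrow> z2_cube"
  assumes simple: "simple_3_polytope P" and char: "characteristic_map P col"
begin

abbreviation "M \<equiv> small_cover P col"
abbreviation "cp \<equiv> cover_point P col"
abbreviation "fs \<equiv> facet_sum P col"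

lemma P: "polytope P"
  using simple by (simp add: simple_3_polytope_def)

lemma facet_props:
  assumes "A \<in> facets P"
  shows "closed A" "A \<noteq> {}" "A \<subseteq> P"
proof -
  have "A face_of P" "A \<noteq> {}"
    using assms by (auto simp: facets_def facet_of_def)
  then show "closed A" "A \<noteq> {}" "A \<subseteq> P"
    using polytope_imp_closed[OF face_of_polytope_polytope[OF P]] face_of_imp_subset by simp_all
qed

lemma infdist_facet_eq_0_iff: "A \<in> facets P \<Longrightarrow> infdist p A = 0 \<longleftrightarrow> p \<in> A"
  using in_closed_iff_infdist_zero[OF facet_props(1,2)] by simp

text \<open>The difference of \<open>c\<close> and \<open>d\<close> is supported on facets through
  \<open>p\<close>, so its colour sum lies in the face group at \<open>p\<close>.\<close>

lemma cp_cong: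
  assumes "p \<in> P" "\<And>A. A \<in> facets P \<Longrightarrow> p \<notin> A \<Longrightarrow> c A = d A"
  shows "cp p (fs c) = cp p (fs d)"
  unfolding cover_point_eq_iff[OF P assms(1)]
proof (intro conjI exI)
  show "\<forall>A\<in>facets P. p \<notin> A \<longrightarrow> c A + d A = 0"
    using assms(2) by simp
  show "fs d = fs c + fs (\<lambda>A. c A + d A)"
    by (simp only: facet_sum_add z2_cube_cancel)
qed simp

text \<open>With \<open>e\<close> the ambiguity of the group coordinate over \<open>p\<close>, the
  sum of \<open>c\<close>, \<open>d\<close> and \<open>e\<close> lies in the kernel of
  \<open>fs\<close>: it is the deck transformation that compares two points above the same point of
  \<open>M\<close>.\<close>

lemma cp_eqD:
  assumes "p \<in> P" "cp p (fs c) = cp p (fs d)"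
  shows "\<exists>k. (\<forall>A\<in>facets P. p \<notin> A \<longrightarrow> k A = c A + d A) \<and> fs k = 0"
proof -
  obtain e where e: "\<forall>A\<in>facets P. p \<notin> A \<longrightarrow> e A = 0" "fs d = fs c + fs e"
    using assms(2) unfolding cover_point_eq_iff[OF P assms(1)] by blast
  have "fs (\<lambda>A. c A + (d A + e A)) = 0"
    by (simp only: facet_sum_add e(2) add.assoc z2_cube_cancel double_z2_cube)
  then show ?thesis
    using e(1) by (intro exI[of _ "\<lambda>A. c A + (d A + e A)"]) simp
qed

lemma small_cover_point_cases:
  assumes "x \<in> topspace M"
  obtains g where "small_cover_proj x \<in> P" "x = cp (small_cover_proj x) g"
  using assms unfolding topspace_small_cover by (auto simp: small_cover_proj_cover_point[OF P])

text \<open>\<open>z \<mapsto> (small_cover_proj (H z), v z)\<close> is a lift of \<open>H\<close> to the covering of \<open>M\<close> by the pairs \<open>(p, v)\<close>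
  with \<open>\<bar>v A\<bar> = infdist p A\<close>; its deck transformations are the sign changes \<open>k\<close> with \<open>fs k = 0\<close>.\<close>

definition lifts :: "('b::metric_space \<Rightarrow> ('a \<times> z2_cube) set) \<Rightarrow> 'b set \<Rightarrow> ('a set \<Rightarrow> 'b \<Rightarrow> real) \<Rightarrow> bool" where
  "lifts H D v \<longleftrightarrow> (\<forall>A\<in>facets P. continuous_on D (v A)) \<and>
    (\<forall>z\<in>D. H z \<in> topspace M \<and> (\<forall>A\<in>facets P. \<bar>v A z\<bar> = infdist (small_cover_proj (H z)) A) \<and>
      H z = cp (small_cover_proj (H z)) (fs (\<lambda>A. sgn_bit (v A z))))"

lemma lifts_subset: "lifts H D v \<Longrightarrow> D' \<subseteq> D \<Longrightarrow> lifts H D' v"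
  unfolding lifts_def by (meson continuous_on_subset subsetD)

lemma lifts_proj: "lifts H D v \<Longrightarrow> z \<in> D \<Longrightarrow> small_cover_proj (H z) \<in> P"
  unfolding lifts_def using small_cover_point_cases by metis

lemma lifts_eq_0_iff:
  "lifts H D v \<Longrightarrow> z \<in> D \<Longrightarrow> A \<in> facets P \<Longrightarrow> v A z = 0 \<longleftrightarrow> small_cover_proj (H z) \<in> A"
  unfolding lifts_def using infdist_facet_eq_0_iff by (metis abs_eq_0)

lemma lifts_continuous: "lifts H D v \<Longrightarrow> A \<in> facets P \<Longrightarrow> continuous_on D (v A)"
  and lifts_topspace: "lifts H D v \<Longrightarrow> z \<in> D \<Longrightarrow> H z \<in> topspace M"
  and lifts_abs: "lifts H D v \<Longrightarrow> z \<in> D \<Longrightarrow> A \<in> facets P \<Longrightarrow>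
    \<bar>v A z\<bar> = infdist (small_cover_proj (H z)) A"
  and lifts_cp: "lifts H D v \<Longrightarrow> z \<in> D \<Longrightarrow>
    cp (small_cover_proj (H z)) (fs (\<lambda>A. sgn_bit (v A z))) = H z"
  unfolding lifts_def by (blast, blast, blast, metis)

lemma lifts_flip:
  assumes "lifts H D v" "fs k = 0"
  shows "lifts H D (\<lambda>A z. flip (k A) (v A z))"
  unfolding lifts_def
proof (intro conjI ballI)
  fix z assume z: "z \<in> D"
  let ?p = "small_cover_proj (H z)"
  have "cp ?p (fs (\<lambda>A. sgn_bit (flip (k A) (v A z)))) = cp ?p (fs (\<lambda>A. sgn_bit (v A z) + k A))"
    by (rule cp_cong[OF lifts_proj[OF assms(1) z]])
      (use lifts_eq_0_iff[OF assms(1) z] sgn_bit_flip in blast)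
  also have "fs (\<lambda>A. sgn_bit (v A z) + k A) = fs (\<lambda>A. sgn_bit (v A z))"
    by (simp only: facet_sum_add assms(2) add_0_right)
  finally show "H z = cp ?p (fs (\<lambda>A. sgn_bit (flip (k A) (v A z))))"
    using lifts_cp[OF assms(1) z] by (simp only:)
next
  fix A assume "A \<in> facets P"
  then show "continuous_on D (\<lambda>z. flip (k A) (v A z))"
    by (intro continuous_on_flip lifts_continuous[OF assms(1)])
next
  fix z A assume "z \<in> D" "A \<in> facets P"
  then show "\<bar>flip (k A) (v A z)\<bar> = infdist (small_cover_proj (H z)) A"
    unfolding abs_flip by (rule lifts_abs[OF assms(1)])
qed (rule lifts_topspace[OF assms(1)])

lemma facet_sum_unique:
  assumes "p \<in> P" "\<And>A. A \<in> facets P \<Longrightarrow> p \<notin> A \<Longrightarrow> c A = d A" "fs c = fs d" "A \<in> facets P"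
  shows "c A = d A"
proof -
  have "c A + d A = 0"
  proof (rule facet_sum_independent[OF simple char assms(1) _ _ assms(4)])
    show "fs (\<lambda>A. c A + d A) = 0"
      by (simp only: facet_sum_add assms(3) double_z2_cube)
  qed (use assms(2) in simp)
  then show ?thesis by (simp only: bit_add_self_eq)
qed

text \<open>The sets on which two lifts differ by a fixed deck transformation are closed, finitely many
  and, because the deck transformations act freely, disjoint.\<close>

lemma lifts_unique:
  assumes v: "lifts H D v" and v': "lifts H D v'" and "connected D" "D \<noteq> {}"
  shows "\<exists>k. fs k = 0 \<and> (\<forall>A\<in>facets P. \<forall>z\<in>D. v' A z = flip (k A) (v A z))"
proof -
  \<comment> \<open>Deck transformations are normalised to vanish outside the facets; this makes the
    set of them finite and lets equality be checked as functions.\<close>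
  define \<K> where "\<K> = {k. fs k = 0 \<and> (\<forall>A. A \<notin> facets P \<longrightarrow> k A = 0)}"
  define E where "E k = {z \<in> D. \<forall>A\<in>facets P. v' A z = flip (k A) (v A z)}" for k
  have "finite {k :: 'a set \<Rightarrow> bit. \<forall>A. (A \<in> facets P \<longrightarrow> k A \<in> UNIV) \<and> (A \<notin> facets P \<longrightarrow> k A = 0)}"
    by (rule finite_set_of_finite_funs) (simp_all add: finite_facets[OF P] finite_UNIV_bit)
  then have fin: "finite \<K>"
    by (rule finite_subset[rotated]) (auto simp: \<K>_def)
  have ex: "\<exists>k\<in>\<K>. z \<in> E k" if z: "z \<in> D" for z
  proof -
    let ?p = "small_cover_proj (H z)"
    have "cp ?p (fs (\<lambda>A. sgn_bit (v A z))) = cp ?p (fs (\<lambda>A. sgn_bit (v' A z)))"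
      using lifts_cp[OF v z] lifts_cp[OF v' z] by (simp only:)
    from cp_eqD[OF lifts_proj[OF v z] this] obtain k
      where k: "\<And>A. A \<in> facets P \<Longrightarrow> ?p \<notin> A \<Longrightarrow> k A = sgn_bit (v A z) + sgn_bit (v' A z)"
      and "fs k = 0"
      by blast
    define k' where "k' A = (if A \<in> facets P then k A else 0)" for A
    have "fs k' = fs k" by (rule facet_sum_cong) (simp add: k'_def)
    then have "k' \<in> \<K>" using \<open>fs k = 0\<close> by (simp add: \<K>_def k'_def)
    moreover have "v' A z = flip (k' A) (v A z)" if A: "A \<in> facets P" for A
    proof (cases "?p \<in> A")
      case True
      then show ?thesis using lifts_eq_0_iff[OF v z A] lifts_eq_0_iff[OF v' z A] by simp
    next
      case False
      have "\<bar>v' A z\<bar> = \<bar>v A z\<bar>" using lifts_abs[OF v z A] lifts_abs[OF v' z A] by simp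
      then show ?thesis using k[OF A False] A eq_flip_of_abs_eq by (metis k'_def)
    qed
    ultimately show ?thesis using z by (auto simp: E_def)
  qed
  have closed: "closedin (top_of_set D) (E k)" for k
  proof -
    have "E k = D \<inter> (\<Inter>A\<in>facets P. {z \<in> D. v' A z - flip (k A) (v A z) = 0})"
      by (auto simp: E_def)
    moreover have "closedin (top_of_set D) {z \<in> D. v' A z - flip (k A) (v A z) = 0}" if "A \<in> facets P" for A
      using lifts_continuous[OF v that] lifts_continuous[OF v' that]
      by (intro continuous_closedin_preimage_constant continuous_on_diff continuous_on_flip)
    ultimately show ?thesis
      by (cases "facets P = {}") (auto intro!: closedin_Int closedin_INT)
  qed
  have disj: "k = k'" if "k \<in> \<K>" "k' \<in> \<K>" "z \<in> E k" "z \<in> E k'" for k k' z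
  proof
    fix A
    have z: "z \<in> D" using that by (simp add: E_def)
    have off: "k A = k' A" if A: "A \<in> facets P" "small_cover_proj (H z) \<notin> A" for A
    proof -
      have "v A z \<noteq> 0" using lifts_eq_0_iff[OF v z A(1)] A(2) by simp
      then show ?thesis
        using \<open>z \<in> E k\<close> \<open>z \<in> E k'\<close> A(1) flip_inject unfolding E_def by (metis (mono_tags, lifting) mem_Collect_eq)
    qed
    show "k A = k' A"
    proof (cases "A \<in> facets P")
      case True
      show ?thesis
        by (rule facet_sum_unique[OF lifts_proj[OF v z] off _ True]) (use that in \<open>auto simp: \<K>_def\<close>)
    next
      case False
      then show ?thesis using that by (simp add: \<K>_def)
    qed
  qed
  obtain z0 where "z0 \<in> D" using \<open>D \<noteq> {}\<close> by blast
  then obtain k where k: "k \<in> \<K>" "z0 \<in> E k" using ex by blast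
  have "E k = D"
  proof (rule ccontr)
    assume "E k \<noteq> D"
    let ?R = "\<Union>(E ` (\<K> - {k}))"
    have "closedin (top_of_set D) ?R"
      using fin closed by (intro closedin_Union) auto
    moreover have "D \<subseteq> E k \<union> ?R" using ex by blast
    moreover have "E k \<inter> ?R = {}" using disj k(1) by blast
    moreover have "?R \<noteq> {}" "E k \<noteq> {}"
      using ex \<open>E k \<noteq> D\<close> k by (auto simp: E_def) blast
    ultimately show False
      using \<open>connected D\<close> closed[of k] unfolding connected_closedin by blast
  qed
  then show ?thesis
    using k(1) unfolding E_def \<K>_def by blast
qed

text \<open>On the connected overlap the lifts differ by one deck transformation; applied to the
  second lift it makes the two agree there.\<close>

lemma lifts_union:
  assumes v1: "lifts H D1 v1" and v2: "lifts H D2 v2" and "closed D1" "closed D2"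
    and "connected (D1 \<inter> D2)" "D1 \<inter> D2 \<noteq> {}"
  shows "\<exists>v. lifts H (D1 \<union> D2) v"
proof -
  obtain k where k: "fs k = 0" "\<And>A z. A \<in> facets P \<Longrightarrow> z \<in> D1 \<inter> D2 \<Longrightarrow> v1 A z = flip (k A) (v2 A z)"
    using lifts_unique[of H "D1 \<inter> D2" v2 v1] lifts_subset v1 v2 assms(5,6) by (metis Int_lower1 Int_lower2)
  note v2' = lifts_flip[OF v2 k(1)]
  let ?v = "\<lambda>A z. if z \<in> D1 then v1 A z else flip (k A) (v2 A z)"
  have "continuous_on (D1 \<union> D2) (?v A)" if "A \<in> facets P" for A
    by (rule continuous_on_cases) (use assms(3,4) lifts_continuous[OF v1 that] lifts_continuous[OF v2' that] that k(2) in auto)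
  moreover have "H z \<in> topspace M \<and> (\<forall>A\<in>facets P. \<bar>?v A z\<bar> = infdist (small_cover_proj (H z)) A) \<and>
      H z = cp (small_cover_proj (H z)) (fs (\<lambda>A. sgn_bit (?v A z)))" if "z \<in> D1 \<union> D2" for z
  proof (cases "z \<in> D1")
    case True
    then show ?thesis
      using lifts_topspace[OF v1 True] lifts_abs[OF v1 True] lifts_cp[OF v1 True] by simp
  next
    case False
    then have z: "z \<in> D2" using that by simp
    show ?thesis
      using lifts_topspace[OF v2' z] lifts_abs[OF v2' z] lifts_cp[OF v2' z] False by simp
  qed
  ultimately show ?thesis unfolding lifts_def by (intro exI[of _ ?v]) blast
qed


text \<open>Near the class of \<open>(p0, g0)\<close> only facets through \<open>p0\<close> are met,
  and by freeness the group coordinate determines their signs. The distances to the facets,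
  multiplied by these signs and by the signs \<open>e\<close> that represent \<open>g0\<close>,
  descend to an open subset \<open>W\<close> of \<open>M\<close>.\<close>

lemma lifts_local:
  assumes H: "continuous_map euclidean M H"
  shows "\<exists>U v. open U \<and> z0 \<in> U \<and> lifts H U v"
proof -
  let ?X = "prod_topology (top_of_set P) (discrete_topology UNIV) :: ('a \<times> z2_cube) topology"
  let ?q = "\<lambda>(p, g). cp p g"
  have "H z0 \<in> topspace M"
    using continuous_map_image_subset_topspace[OF H] by auto
  then obtain p0 g0 where p0: "p0 \<in> P" "H z0 = cp p0 g0"
    unfolding topspace_small_cover by blast
  obtain e where e: "fs e = g0" using facet_sum_surj[OF simple char] by blast
  define van where "van c \<longleftrightarrow> (\<forall>A\<in>facets P. p0 \<notin> A \<longrightarrow> c A = 0)" for c :: "'a set \<Rightarrow> bit"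
  \<comment> \<open>Saturated, because an identification at a point of \<open>V\<close> involves
    only facets through that point, and all of these contain \<open>p0\<close>.\<close>
  define V where "V = {p\<in>P. \<forall>A\<in>facets P. p0 \<notin> A \<longrightarrow> p \<notin> A} \<times> {g. \<exists>c. van c \<and> g = g0 + fs c}"
  define K where "K g = (SOME c. van c \<and> g = g0 + fs c)" for g
  have K: "van (K g)" "g = g0 + fs (K g)" if "(p, g) \<in> V" for p g
  proof -
    have "\<exists>c. van c \<and> g = g0 + fs c" using that by (auto simp: V_def)
    then have "van (K g) \<and> g = g0 + fs (K g)" unfolding K_def by (rule someI_ex)
    then show "van (K g)" "g = g0 + fs (K g)" by blast+
  qed
  define \<sigma> where "\<sigma> A y = flip (e A + K (snd y) A) (infdist (fst y) A)" for A y
  have open_V: "openin ?X V"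
  proof -
    have "{p\<in>P. \<forall>A\<in>facets P. p0 \<notin> A \<longrightarrow> p \<notin> A} = P \<inter> - \<Union>{A\<in>facets P. p0 \<notin> A}"
      by blast
    moreover have "closed (\<Union>{A\<in>facets P. p0 \<notin> A})"
      by (rule closed_Union) (auto simp: finite_facets[OF P] facet_props)
    ultimately have "openin (top_of_set P) {p\<in>P. \<forall>A\<in>facets P. p0 \<notin> A \<longrightarrow> p \<notin> A}"
      by (metis open_Compl openin_open_Int)
    then show ?thesis unfolding V_def by (simp add: openin_prod_Times_iff)
  qed
  have V_P: "p \<in> P" if "(p, g) \<in> V" for p g
    using that by (simp add: V_def)
  \<comment> \<open>\<open>d\<close> is supported on facets through \<open>p\<close>, hence through
    \<open>p0\<close>, where coefficients are determined by their colour sum. So the choice made in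
    \<open>K\<close> respects the identifications.\<close>
  have off: "K h A = K g A + d A"
    if as: "(p, g) \<in> V" "(p, h) \<in> V" "\<forall>A\<in>facets P. p \<notin> A \<longrightarrow> d A = 0" "h = g + fs d" "A \<in> facets P"
    for p g h d A
  proof (rule facet_sum_unique[OF p0(1) _ _ as(5)])
    have "p0 \<notin> A \<Longrightarrow> d A = 0" if "A \<in> facets P" for A
      using that as(1,3) by (auto simp: V_def)
    then show "K h A = K g A + d A" if "A \<in> facets P" "p0 \<notin> A" for A
      using K(1)[OF as(1)] K(1)[OF as(2)] that by (simp add: van_def)
    have "g0 + fs (K h) = g0 + (fs (K g) + fs d)"
      using K(2)[OF as(1)] K(2)[OF as(2)] as(4) by (metis add.assoc)
    then show "fs (K h) = fs (\<lambda>A. K g A + d A)"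
      by (simp only: facet_sum_add add_left_cancel)
  qed
  have saturated: "(p, h) \<in> V"
    if as: "(p, g) \<in> V" "cp p g = cp p' h" for p p' g h
  proof -
    obtain d where d: "\<forall>A\<in>facets P. p \<notin> A \<longrightarrow> d A = 0" "h = g + fs d"
      using as(2) unfolding cover_point_eq_iff[OF P V_P[OF as(1)]] by blast
    have "van (\<lambda>A. K g A + d A)"
      using K(1)[OF as(1)] d(1) as(1) by (auto simp: van_def V_def)
    moreover have "h = g0 + fs (\<lambda>A. K g A + d A)"
      using K(2)[OF as(1)] d(2) by (simp only: facet_sum_add add.assoc) (metis add.assoc)
    ultimately show ?thesis using as(1) by (auto simp: V_def)
  qed
  have \<sigma>_inv: "\<sigma> A (p, g) = \<sigma> A (p', h)"
    if as: "(p, g) \<in> V" "cp p g = cp p' h" "A \<in> facets P" for A p p' g h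
  proof -
    obtain d where d: "p' = p" "\<forall>A\<in>facets P. p \<notin> A \<longrightarrow> d A = 0" "h = g + fs d"
      using as(2) unfolding cover_point_eq_iff[OF P V_P[OF as(1)]] by blast
    have "K h A = K g A + d A"
      using off[OF as(1) saturated[OF as(1,2)] d(2,3) as(3)] .
    moreover have "d A = 0 \<or> infdist p A = 0"
      using d(2) as(3) infdist_facet_eq_0_iff by blast
    ultimately show ?thesis using d(1) by (auto simp: \<sigma>_def)
  qed
  define W where "W = ?q ` V"
  have pre: "{y \<in> topspace ?X. ?q y \<in> W} = V"
  proof
    show "{y \<in> topspace ?X. ?q y \<in> W} \<subseteq> V"
    proof clarify
      fix p' h assume "(p', h) \<in> topspace ?X" "cp p' h \<in> W"
      then obtain p g where pg: "(p, g) \<in> V" "cp p g = cp p' h" by (auto simp: W_def)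
      then have "p' = p" using cover_point_eq_iff[OF P V_P[OF pg(1)]] by blast
      then show "(p', h) \<in> V" using saturated[OF pg] by simp
    qed
    show "V \<subseteq> {y \<in> topspace ?X. ?q y \<in> W}"
      using openin_subset[OF open_V] by (auto simp: W_def)
  qed
  have W_sub: "W \<subseteq> topspace M"
    using V_P by (auto simp: W_def topspace_small_cover)
  have "openin ?X {y \<in> topspace ?X. ?q y \<in> W} = openin M W"
    using quotient_map_cover_point[of P col] W_sub unfolding quotient_map_def by blast
  then have open_W: "openin M W"
    using open_V unfolding pre by (simp only:)
  define \<tau> where "\<tau> A x = \<sigma> A (SOME y. y \<in> V \<and> ?q y = x)" for A x
  have \<tau>: "\<tau> A (cp p g) = \<sigma> A (p, g)" if "(p, g) \<in> V" "A \<in> facets P" for A p g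
  proof -
    let ?y = "SOME y. y \<in> V \<and> ?q y = cp p g"
    have "?y \<in> V \<and> ?q ?y = cp p g"
      by (rule someI[of _ "(p, g)"]) (use that in simp)
    then have "cp p g = cp (fst ?y) (snd ?y)" by (simp add: case_prod_unfold)
    then have "\<sigma> A (p, g) = \<sigma> A (fst ?y, snd ?y)"
      by (rule \<sigma>_inv[OF that(1) _ that(2)])
    then show ?thesis by (simp add: \<tau>_def)
  qed
  have cont_\<tau>: "continuous_map (subtopology M W) euclideanreal (\<tau> A)" if A: "A \<in> facets P" for A
  proof (rule continuous_compose_quotient_map)
    show "quotient_map (subtopology ?X V) (subtopology M W) ?q"
      by (rule quotient_map_restriction[OF quotient_map_cover_point pre]) (simp add: open_W)
    have "continuous_map ?X euclideanreal (\<sigma> A)"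
      by (rule continuous_map_prod_discrete)
        (auto simp: \<sigma>_def intro!: continuous_on_flip continuous_intros)
    then show "continuous_map (subtopology ?X V) euclideanreal (\<tau> A \<circ> ?q)"
      by (rule continuous_map_eq[OF continuous_map_from_subtopology]) (auto simp: \<tau> A)
  qed
  define U where "U = {z. H z \<in> W}"
  have "open U"
    using openin_continuous_map_preimage[OF H open_W] by (simp add: U_def)
  moreover have "z0 \<in> U"
  proof -
    have "van (\<lambda>_. 0)" "g0 = g0 + fs (\<lambda>_. 0)" by (simp_all add: van_def facet_sum_zero)
    then have "(p0, g0) \<in> V" using p0(1) unfolding V_def by blast
    then show ?thesis using p0(2) by (auto simp: U_def W_def)
  qed
  moreover have "lifts H U (\<lambda>A z. \<tau> A (H z))"
    unfolding lifts_def
  proof (intro conjI ballI)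
    fix A assume A: "A \<in> facets P"
    have "continuous_map (top_of_set U) (subtopology M W) H"
      using H by (auto simp: continuous_map_in_subtopology U_def intro: continuous_map_from_subtopology)
    from continuous_map_compose[OF this cont_\<tau>[OF A]]
    show "continuous_on U (\<lambda>z. \<tau> A (H z))" by (simp add: o_def)
  next
    fix z assume "z \<in> U"
    then obtain p g where pg: "(p, g) \<in> V" "H z = cp p g" by (auto simp: U_def W_def)
    have proj: "small_cover_proj (H z) = p"
      unfolding pg(2) by (rule small_cover_proj_cover_point[OF P V_P[OF pg(1)]])
    show "H z \<in> topspace M" using W_sub \<open>z \<in> U\<close> by (auto simp: U_def)
    show "\<bar>\<tau> A (H z)\<bar> = infdist (small_cover_proj (H z)) A" if "A \<in> facets P" for A
      unfolding proj unfolding pg(2) \<tau>[OF pg(1) that] by (simp add: \<sigma>_def infdist_nonneg)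
    have "g = fs (\<lambda>A. e A + K g A)"
      using K(2)[OF pg(1)] e by (simp only: facet_sum_add)
    then have "H z = cp p (fs (\<lambda>A. e A + K g A))" using pg(2) by simp
    also have "\<dots> = cp p (fs (\<lambda>A. sgn_bit (\<tau> A (H z))))"
    proof (rule cp_cong[OF V_P[OF pg(1)]])
      fix A assume A: "A \<in> facets P" "p \<notin> A"
      then have "infdist p A > 0"
        using infdist_facet_eq_0_iff[OF A(1), of p] infdist_nonneg[of p A] by linarith
      moreover have "\<tau> A (H z) = flip (e A + K g A) (infdist p A)"
        unfolding pg(2) \<tau>[OF pg(1) A(1)] by (simp add: \<sigma>_def)
      ultimately show "e A + K g A = sgn_bit (\<tau> A (H z))"
        by (simp add: sgn_bit_flip) (simp add: sgn_bit_def)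
    qed
    finally show "H z = cp (small_cover_proj (H z)) (fs (\<lambda>A. sgn_bit (\<tau> A (H z))))"
      unfolding proj .
  qed
  ultimately show ?thesis by blast
qed

text \<open>Bisection in the first coordinate. The thickness \<open>d\<close> is quantified inside
  the property, so each gluing may pass to the smaller of two thicknesses.\<close>

lemma lifts_strip:
  fixes H :: "real \<times> real \<Rightarrow> ('a \<times> z2_cube) set"
  assumes H: "continuous_map euclidean M H" and "a \<le> b"
  shows "\<exists>d>0. \<exists>v. lifts H ({a..b} \<times> {t - d..t + d}) v"
  using \<open>a \<le> b\<close>
proof (rule Bolzano)
  fix a b c :: real
  assume "\<exists>d>0. \<exists>v. lifts H ({a..b} \<times> {t - d..t + d}) v" "\<exists>d>0. \<exists>v. lifts H ({b..c} \<times> {t - d..t + d}) v"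
    and le: "a \<le> b" "b \<le> c"
  then obtain d1 v1 d2 v2 where d: "d1 > 0" "d2 > 0"
    and v: "lifts H ({a..b} \<times> {t - d1..t + d1}) v1" "lifts H ({b..c} \<times> {t - d2..t + d2}) v2"
    by blast
  let ?J = "{t - min d1 d2..t + min d1 d2}"
  have v': "lifts H ({a..b} \<times> ?J) v1" "lifts H ({b..c} \<times> ?J) v2"
    by (rule lifts_subset[OF v(1)], force, rule lifts_subset[OF v(2)], force)
  have int: "({a..b} \<times> ?J) \<inter> ({b..c} \<times> ?J) = {b} \<times> ?J" and un: "({a..b} \<times> ?J) \<union> ({b..c} \<times> ?J) = {a..c} \<times> ?J"
    using le by auto
  have "\<exists>v. lifts H (({a..b} \<times> ?J) \<union> ({b..c} \<times> ?J)) v"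
  proof (rule lifts_union[OF v'])
    show "connected (({a..b} \<times> ?J) \<inter> ({b..c} \<times> ?J))"
      unfolding int by (intro connected_Times connected_Icc connected_sing)
    show "({a..b} \<times> ?J) \<inter> ({b..c} \<times> ?J) \<noteq> {}"
      unfolding int using d by auto
  qed (intro closed_Times closed_atLeastAtMost)+
  then show "\<exists>d>0. \<exists>v. lifts H ({a..c} \<times> {t - d..t + d}) v"
    unfolding un using d by (intro exI[of _ "min d1 d2"]) auto
next
  fix x
  obtain U v where U: "open U" "(x, t) \<in> U" "lifts H U v"
    using lifts_local[OF H] by blast
  then obtain A B where AB: "open A" "open B" "(x, t) \<in> A \<times> B" "A \<times> B \<subseteq> U"
    using open_prod_elim[OF U(1,2)] by metis
  then have "x \<in> A" "t \<in> B" by auto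
  then obtain d1 d2 where d: "d1 > 0" "d2 > 0" "ball x d1 \<subseteq> A" "cball t d2 \<subseteq> B"
    using AB(1,2) open_contains_ball open_contains_cball by metis
  show "\<exists>d>0. \<forall>a b. a \<le> x \<and> x \<le> b \<and> b - a < d \<longrightarrow> (\<exists>d>0. \<exists>v. lifts H ({a..b} \<times> {t - d..t + d}) v)"
  proof (intro exI conjI allI impI)
    show "d1 > 0" by fact
    fix a b assume ab: "a \<le> x \<and> x \<le> b \<and> b - a < d1"
    show "d2 > 0" by fact
    have "{a..b} \<subseteq> A" using ab d(3) by (force simp: dist_real_def subset_iff)
    moreover have "{t - d2..t + d2} \<subseteq> B" using d(4) by (simp add: cball_eq_atLeastAtMost)
    ultimately show "lifts H ({a..b} \<times> {t - d2..t + d2}) v"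
      using AB(4) by (intro lifts_subset[OF U(3)]) blast
  qed
qed

text \<open>Bisection in the second coordinate; the strip around height \<open>t\<close> supplies
  lifts over all short intervals that contain \<open>t\<close>.\<close>

lemma lifts_box:
  fixes H :: "real \<times> real \<Rightarrow> ('a \<times> z2_cube) set"
  assumes H: "continuous_map euclidean M H" and "a \<le> b" "c \<le> d"
  shows "\<exists>v. lifts H ({a..b} \<times> {c..d}) v"
  using \<open>c \<le> d\<close>
proof (rule Bolzano)
  fix r s t :: real
  assume v: "\<exists>v. lifts H ({a..b} \<times> {r..s}) v" "\<exists>v. lifts H ({a..b} \<times> {s..t}) v" and le: "r \<le> s" "s \<le> t"
  then obtain v1 v2 where v: "lifts H ({a..b} \<times> {r..s}) v1" "lifts H ({a..b} \<times> {s..t}) v2" by blast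
  have int: "({a..b} \<times> {r..s}) \<inter> ({a..b} \<times> {s..t}) = {a..b} \<times> {s}"
    and un: "({a..b} \<times> {r..s}) \<union> ({a..b} \<times> {s..t}) = {a..b} \<times> {r..t}"
    using le by auto
  have "\<exists>v. lifts H (({a..b} \<times> {r..s}) \<union> ({a..b} \<times> {s..t})) v"
  proof (rule lifts_union[OF v])
    show "connected (({a..b} \<times> {r..s}) \<inter> ({a..b} \<times> {s..t}))"
      unfolding int by (intro connected_Times connected_Icc connected_sing)
    show "({a..b} \<times> {r..s}) \<inter> ({a..b} \<times> {s..t}) \<noteq> {}"
      unfolding int using \<open>a \<le> b\<close> by auto
  qed (intro closed_Times closed_atLeastAtMost)+
  then show "\<exists>v. lifts H ({a..b} \<times> {r..t}) v"
    unfolding un .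
next
  fix t
  obtain d v where d: "d > 0" "lifts H ({a..b} \<times> {t - d..t + d}) v"
    using lifts_strip[OF H \<open>a \<le> b\<close>] by blast
  have "lifts H ({a..b} \<times> {r..s}) v" if "r \<le> t \<and> t \<le> s \<and> s - r < d" for r s
    by (rule lifts_subset[OF d(2)]) (use that in auto)
  then show "\<exists>d>0. \<forall>r s. r \<le> t \<and> t \<le> s \<and> s - r < d \<longrightarrow> (\<exists>v. lifts H ({a..b} \<times> {r..s}) v)"
    using d(1) by blast
qed

end

subsection \<open>The section over the square\<close>

text \<open>Side \<open>i\<close> is the one traced by \<open>square_boundary\<close> on
  \<open>[(i-1)/4, i/4]\<close>, so that it matches the facet \<open>F i\<close> in
  \<open>belt_loop\<close>.\<close>

definition on_side :: "nat \<Rightarrow> real \<times> real \<Rightarrow> bool" where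
  "on_side i w \<longleftrightarrow> i = 1 \<and> fst w = 0 \<or> i = 2 \<and> snd w = 0 \<or> i = 3 \<and> fst w = 1 \<or> i = 4 \<and> snd w = 1"

text \<open>The constants 0 and 1 and the function \<open>g\<close> agree on the overlaps of the
  closed sets \<open>A\<close>, \<open>B\<close>, \<open>Q\<close>; the glued function is extended
  by Tietze's theorem with values kept in [0,1].\<close>

lemma extend_coordinate:
  fixes g :: "'a::euclidean_space \<Rightarrow> real"
  assumes cl: "closed A" "closed B" "closed Q" and sub: "A \<subseteq> P" "B \<subseteq> P" "Q \<subseteq> P"
    and "A \<inter> B = {}" and g: "continuous_on Q g" "g ` Q \<subseteq> {0..1}"
    and gA: "\<And>q. q \<in> Q \<Longrightarrow> q \<in> A \<Longrightarrow> g q = 0" and gB: "\<And>q. q \<in> Q \<Longrightarrow> q \<in> B \<Longrightarrow> g q = 1"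
  shows "\<exists>f. continuous_on P f \<and> f ` P \<subseteq> {0..1} \<and> (\<forall>p\<in>A. f p = 0) \<and> (\<forall>p\<in>B. f p = 1) \<and>
    (\<forall>q\<in>Q. f q = g q)"
proof -
  define f where "f p = (if p \<in> A then 0 else if p \<in> B then 1 else g p)" for p
  have BQ: "continuous_on (B \<union> Q) (\<lambda>p. if p \<in> B then 1 else g p)"
    by (rule continuous_on_cases) (use cl g gB in auto)
  have c1: "continuous_on (A \<union> (B \<union> Q)) f"
    unfolding f_def by (rule continuous_on_cases) (use BQ cl gA \<open>A \<inter> B = {}\<close> in auto)
  have c2: "closedin (top_of_set P) (A \<union> (B \<union> Q))"
    using cl sub by (intro closed_subset closed_Un) auto
  have c3: "f x \<in> cbox 0 1" if "x \<in> A \<union> (B \<union> Q)" for x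
    using that g(2) by (auto simp: f_def)
  obtain f' where f': "continuous_on P f'" "\<And>x. x \<in> A \<union> (B \<union> Q) \<Longrightarrow> f' x = f x"
    "\<And>x. x \<in> P \<Longrightarrow> f' x \<in> cbox 0 1"
    using Tietze_closed_interval_1[OF c1 c2 zero_le_one c3] by blast
  have "f' p = 0" if "p \<in> A" for p using f'(2) that by (simp add: f_def)
  moreover have "f' p = 1" if "p \<in> B" for p using f'(2)[of p] that \<open>A \<inter> B = {}\<close> by (auto simp: f_def)
  moreover have "f' q = g q" if "q \<in> Q" for q using f'(2)[of q] that gA gB by (auto simp: f_def)
  moreover have "f' ` P \<subseteq> {0..1}" using f'(3) by auto
  ultimately show ?thesis using f'(1) by blast
qed

text \<open>Angles with equal sine and cosine differ by a multiple of \<open>2 * pi\<close>, so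
  \<theta> takes discrete values on a connected set.\<close>

lemma constant_angle:
  fixes \<theta> :: "'a::topological_space \<Rightarrow> real"
  assumes "connected S" "continuous_on S \<theta>" "x \<in> S" "y \<in> S"
    and "\<And>z. z \<in> S \<Longrightarrow> sin (\<theta> z) = s \<and> cos (\<theta> z) = c"
  shows "\<theta> x = \<theta> y"
proof -
  have "\<exists>e>0. \<forall>z'. z' \<in> S \<and> \<theta> z' \<noteq> \<theta> z \<longrightarrow> e \<le> norm (\<theta> z' - \<theta> z)" if z: "z \<in> S" for z
  proof (intro exI conjI allI impI)
    show "2 * pi > 0" by simp
    fix z' assume z': "z' \<in> S \<and> \<theta> z' \<noteq> \<theta> z"
    then have "sin (\<theta> z') = sin (\<theta> z) \<and> cos (\<theta> z') = cos (\<theta> z)"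
      using assms(5) z by metis
    then obtain n :: int where n: "\<theta> z' = \<theta> z + 2 * pi * n"
      using sin_cos_eq_iff[of "\<theta> z'" "\<theta> z"] by blast
    then have "n \<noteq> 0" using z' by auto
    then have "\<bar>real_of_int n\<bar> \<ge> 1" by linarith
    then have "2 * pi * 1 \<le> 2 * pi * \<bar>real_of_int n\<bar>" by (intro mult_left_mono) auto
    then show "2 * pi \<le> norm (\<theta> z' - \<theta> z)" using n by (simp add: abs_mult)
  qed
  then have "\<theta> constant_on S"
    using continuous_discrete_range_constant[OF assms(1,2)] by blast
  then show ?thesis using assms(3,4) unfolding constant_on_def by metis
qed

lemma constant_sign:
  fixes f :: "'a::topological_space \<Rightarrow> real"
  assumes "connected S" "continuous_on S f" "\<And>z. z \<in> S \<Longrightarrow> f z \<noteq> 0" "x \<in> S" "y \<in> S"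
  shows "f x < 0 \<longleftrightarrow> f y < 0"
proof (rule ccontr)
  assume "(f x < 0) \<noteq> (f y < 0)"
  then have "\<exists>a\<in>f ` S. \<exists>b\<in>f ` S. a < 0 \<and> \<not> b < 0" using assms(4,5) by blast
  then obtain a b where ab: "a \<in> f ` S" "b \<in> f ` S" "a < 0" "\<not> b < 0" by blast
  have "connected (f ` S)" by (rule connected_continuous_image[OF assms(2,1)])
  then have "0 \<in> f ` S"
    using ab connectedD_interval[of "f ` S" a b 0] by auto
  then show False using assms(3) by auto
qed

context coloured_polytope begin

text \<open>For each of the finitely many sign patterns, the set where no coordinate contradicts it
  is closed, and there the group coordinate is constant. The pieces agree on overlaps: a coordinate
  compatible with both signs is 0, so \<open>p x\<close> lies on that facet.\<close>

lemma continuous_map_cp_signs: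
  fixes b :: "'a set \<Rightarrow> 'b::topological_space \<Rightarrow> real"
  assumes p: "continuous_on UNIV p" "range p \<subseteq> P"
    and b: "\<And>A. A \<in> facets P \<Longrightarrow> continuous_on UNIV (b A)"
    and zero: "\<And>A x. A \<in> facets P \<Longrightarrow> b A x = 0 \<Longrightarrow> p x \<in> A"
  shows "continuous_map euclidean M (\<lambda>x. cp (p x) (fs (\<lambda>A. sgn_bit (b A x))))"
proof -
  define I where "I = {\<sigma> :: 'a set \<Rightarrow> bit. \<forall>A. (A \<in> facets P \<longrightarrow> \<sigma> A \<in> UNIV) \<and> (A \<notin> facets P \<longrightarrow> \<sigma> A = 0)}"
  define T where "T \<sigma> = {x. \<forall>A\<in>facets P. flip (\<sigma> A) (b A x) \<ge> 0}" for \<sigma>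
  let ?g = "\<lambda>x. cp (p x) (fs (\<lambda>A. sgn_bit (b A x)))"
  have eq: "cp (p x) (fs \<sigma>) = ?g x" if x: "x \<in> T \<sigma>" for x \<sigma>
  proof (rule cp_cong)
    show "p x \<in> P" using p(2) by blast
    fix A assume A: "A \<in> facets P" "p x \<notin> A"
    then have "b A x \<noteq> 0" using zero by blast
    moreover have "flip (\<sigma> A) (b A x) \<ge> 0" using x A by (simp add: T_def)
    ultimately show "\<sigma> A = sgn_bit (b A x)"
      by (cases "\<sigma> A") (auto simp: flip_def sgn_bit_def)
  qed
  show ?thesis
  proof (rule pasting_lemma_closed[where I = I and T = T and f = "\<lambda>\<sigma> x. cp (p x) (fs \<sigma>)"])
    show "finite I"
      unfolding I_def by (rule finite_set_of_finite_funs) (simp_all add: finite_facets[OF P] finite_UNIV_bit)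
    fix \<sigma>
    have "T \<sigma> = (\<Inter>A\<in>facets P. {x. 0 \<le> flip (\<sigma> A) (b A x)})" by (auto simp: T_def)
    moreover have "closed {x. 0 \<le> flip (\<sigma> A) (b A x)}" if "A \<in> facets P" for A
      by (rule closed_Collect_le) (use continuous_on_flip[OF b[OF that]] in simp_all)
    ultimately have "closed (T \<sigma>)"
      using closed_INT[of "facets P" "\<lambda>A. {x. 0 \<le> flip (\<sigma> A) (b A x)}"] by simp
    then show "closedin euclidean (T \<sigma>)" by simp
    have "continuous_map euclidean (top_of_set P) p"
      using p by (simp add: continuous_map_in_subtopology image_subset_iff)
    from continuous_map_compose[OF this continuous_map_cover_point]
    show "continuous_map (subtopology euclidean (T \<sigma>)) M (\<lambda>x. cp (p x) (fs \<sigma>))"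
      by (intro continuous_map_from_subtopology) (simp add: o_def)
  next
    fix \<sigma> \<tau> x assume "x \<in> topspace euclidean \<inter> T \<sigma> \<inter> T \<tau>"
    then show "cp (p x) (fs \<sigma>) = cp (p x) (fs \<tau>)"
      using eq[of x \<sigma>] eq[of x \<tau>] by (metis IntE)
  next
    fix x
    define \<sigma> where "\<sigma> A = (if A \<in> facets P then sgn_bit (b A x) else 0)" for A
    have "\<sigma> \<in> I" by (simp add: I_def \<sigma>_def)
    moreover have "x \<in> T \<sigma>" by (auto simp: T_def \<sigma>_def flip_def sgn_bit_def)
    ultimately show "\<exists>\<sigma>. \<sigma> \<in> I \<and> x \<in> T \<sigma> \<and> ?g x = cp (p x) (fs \<sigma>)"
      using eq by metis
  qed
qed

lemma continuous_on_proj: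
  assumes "continuous_map euclidean M H"
  shows "continuous_on D (\<lambda>z. small_cover_proj (H z))"
proof -
  have "continuous_map euclidean (top_of_set P) (small_cover_proj \<circ> H)"
    using continuous_map_compose[OF assms continuous_map_small_cover_proj[OF P]] .
  then have "continuous_on UNIV (small_cover_proj \<circ> H)"
    by (simp add: continuous_map_in_subtopology)
  then show ?thesis
    unfolding o_def by (rule continuous_on_subset) simp
qed

text \<open>The sign of \<open>v A\<close> jumps only where the projection lies in \<open>A\<close>.\<close>

lemma continuous_on_sgn_lift:
  assumes H: "continuous_map euclidean M H" and v: "lifts H D v" and A: "A \<in> facets P"
    and f: "continuous_on P f" "\<And>p. p \<in> A \<Longrightarrow> f p = (0::real)"
  shows "continuous_on D (\<lambda>z. sgn (v A z) * f (small_cover_proj (H z)))"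
  unfolding continuous_on_def
proof
  fix z assume z: "z \<in> D"
  have fp: "continuous_on D (\<lambda>z. f (small_cover_proj (H z)))"
    by (rule continuous_on_compose2[OF f(1) continuous_on_proj[OF H]]) (use lifts_proj[OF v] in auto)
  then have lim: "((\<lambda>z. f (small_cover_proj (H z))) \<longlongrightarrow> f (small_cover_proj (H z))) (at z within D)"
    using z by (simp add: continuous_on_def)
  have vlim: "(v A \<longlongrightarrow> v A z) (at z within D)"
    using lifts_continuous[OF v A] z by (simp add: continuous_on_def)
  show "((\<lambda>z. sgn (v A z) * f (small_cover_proj (H z))) \<longlongrightarrow> sgn (v A z) * f (small_cover_proj (H z))) (at z within D)"
  proof (cases "v A z = 0")
    case False
    then show ?thesis by (intro tendsto_mult tendsto_sgn vlim lim)
  next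
    case True
    then have "f (small_cover_proj (H z)) = 0" using lifts_eq_0_iff[OF v z A] f(2) by blast
    then have "((\<lambda>z. norm (f (small_cover_proj (H z)))) \<longlongrightarrow> 0) (at z within D)"
      using tendsto_norm[OF lim] by simp
    then have "((\<lambda>z. sgn (v A z) * f (small_cover_proj (H z))) \<longlongrightarrow> 0) (at z within D)"
      by (rule Lim_null_comparison[rotated]) (simp add: norm_mult sgn_if)
    then show ?thesis using True by simp
  qed
qed

text \<open>The factor \<open>pi / 2\<close> bends [0,1] into a quarter circle and the signs reflect
  it. A sign becomes 0 only on its facet, where its trigonometric factor is 0 and the other one is
  1; so the point stays on the unit circle, and a continuous logarithm on the convex
  \<open>D\<close> provides the angle.\<close>

lemma angle_lift:
  fixes H :: "'b::real_normed_vector \<Rightarrow> ('a \<times> z2_cube) set"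
  assumes H: "continuous_map euclidean M H" and v: "lifts H D v" and "convex D"
    and A: "A \<in> facets P" and B: "B \<in> facets P" and "A \<inter> B = {}"
    and a: "continuous_on P a" "\<And>p. p \<in> A \<Longrightarrow> a p = 0" "\<And>p. p \<in> B \<Longrightarrow> a p = 1"
  shows "\<exists>\<theta>. continuous_on D \<theta> \<and> (\<forall>z\<in>D.
    sin (\<theta> z) = sgn (v A z) * sin (pi / 2 * a (small_cover_proj (H z))) \<and>
    cos (\<theta> z) = sgn (v B z) * cos (pi / 2 * a (small_cover_proj (H z))))"
proof -
  let ?p = "\<lambda>z. small_cover_proj (H z)"
  define w where "w z = Complex (sgn (v B z) * cos (pi / 2 * a (?p z))) (sgn (v A z) * sin (pi / 2 * a (?p z)))" for z
  have "continuous_on D (\<lambda>z. sgn (v A z) * sin (pi / 2 * a (?p z)))"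
    by (rule continuous_on_sgn_lift[OF H v A]) (auto intro!: continuous_intros a(1) simp: a(2))
  moreover have "continuous_on D (\<lambda>z. sgn (v B z) * cos (pi / 2 * a (?p z)))"
    by (rule continuous_on_sgn_lift[OF H v B]) (auto intro!: continuous_intros a(1) simp: a(3))
  ultimately have "continuous_on D w"
    unfolding w_def by (intro continuous_on_Complex)
  have norm1: "norm (w z) = 1" if z: "z \<in> D" for z
  proof -
    have "(sgn (v B z) * cos (pi / 2 * a (?p z)))\<^sup>2 + (sgn (v A z) * sin (pi / 2 * a (?p z)))\<^sup>2 = 1"
    proof -
      consider "v A z = 0" "v B z \<noteq> 0" | "v A z \<noteq> 0" "v B z = 0" | "v A z \<noteq> 0" "v B z \<noteq> 0"
        using lifts_eq_0_iff[OF v z A] lifts_eq_0_iff[OF v z B] \<open>A \<inter> B = {}\<close> by blast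
      then show ?thesis
      proof cases
        case 1
        then have "a (?p z) = 0" using lifts_eq_0_iff[OF v z A] a(2) by blast
        then show ?thesis using 1 by (simp add: sgn_if)
      next
        case 2
        then have "a (?p z) = 1" using lifts_eq_0_iff[OF v z B] a(3) by blast
        then show ?thesis using 2 by (simp add: sgn_if)
      next
        case 3
        then show ?thesis by (simp add: power_mult_distrib sgn_if)
      qed
    qed
    then show ?thesis by (simp add: w_def cmod_def)
  qed
  have "contractible D" using \<open>convex D\<close> by (rule convex_imp_contractible)
  moreover have "w z \<noteq> 0" if "z \<in> D" for z using norm1[OF that] by auto
  ultimately obtain l where l: "continuous_on D l" "\<And>z. z \<in> D \<Longrightarrow> w z = exp (l z)"
    using continuous_logarithm_on_contractible[OF \<open>continuous_on D w\<close>] by metis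
  have "sin (Im (l z)) = Im (w z) \<and> cos (Im (l z)) = Re (w z)" if z: "z \<in> D" for z
  proof -
    have "exp (Re (l z)) = 1" using norm1[OF z] l(2)[OF z] by (simp add: norm_exp_eq_Re)
    then show ?thesis using l(2)[OF z] by (simp add: Re_exp Im_exp)
  qed
  then show ?thesis
    using l(1) by (intro exI[of _ "\<lambda>z. Im (l z)"]) (simp add: w_def continuous_on_Im)
qed

end

section \<open>Sides of the square and facets of the belt\<close>

lemma belt_index_cases: "i \<in> {1..4::nat} \<longleftrightarrow> i = 1 \<or> i = 2 \<or> i = 3 \<or> i = 4"
  by auto

context coloured_polytope begin

lemma edge_facets:
  assumes "A \<in> facets P" "B \<in> facets P" "C \<in> facets P" "A \<noteq> B" "y \<in> rel_interior (A \<inter> B)" "y \<in> C"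
  shows "C = A \<or> C = B"
  using rel_interior_edge_disjoint[OF simple assms(1-3,4) _ _ assms(5,6)] by blast

text \<open>Simplicity enters at the four corners: a point in the relative interior of the edge of
  two facets lies on no third one. Between corners the loop is in the relative interior of a single
  facet.\<close>

lemma belt_loop_facet:
  assumes belt: "four_belt P F" and c: "belt_loop F c" and A: "A \<in> facets P" and t: "t \<in> {0..1}" and "c t \<in> A"
  shows "\<exists>i\<in>{1..4}. A = F i \<and> on_side i (square_boundary t)"
proof -
  have F: "F 1 \<in> facets P" "F 2 \<in> facets P" "F 3 \<in> facets P" "F 4 \<in> facets P"
    and neq: "F 1 \<noteq> F 2" "F 2 \<noteq> F 3" "F 3 \<noteq> F 4" "F 4 \<noteq> F 1"
    using belt by (auto simp: four_belt_def inj_on_def)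
  have c01: "c 0 = c 1" using c by (simp add: belt_loop_def pathfinish_def pathstart_def)
  have int: "c t \<in> rel_interior (F i)" if "i \<in> {1..4}" "(real i - 1) / 4 < t" "t < real i / 4" for i
    using c that unfolding belt_loop_def by blast
  have corner: "c (1/4) \<in> rel_interior (F 1 \<inter> F 2)" "c (2/4) \<in> rel_interior (F 2 \<inter> F 3)"
    "c (3/4) \<in> rel_interior (F 3 \<inter> F 4)" "c 1 \<in> rel_interior (F 4 \<inter> F 1)"
    using c by (auto simp: belt_loop_def)
  consider "t = 1/4" | "t = 2/4" | "t = 3/4" | "t = 1 \<or> t = 0" | "0 < t" "t < 1/4" | "1/4 < t" "t < 2/4"
    | "2/4 < t" "t < 3/4" | "3/4 < t" "t < 1"
    using t by force
  then show ?thesis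
  proof cases
    case 1
    have "square_boundary t = (0, 0)" unfolding 1 using square_boundary_sides(1)[of 0] by simp
    moreover have "A = F 1 \<or> A = F 2"
      by (rule edge_facets[OF F(1,2) A neq(1) corner(1) \<open>c t \<in> A\<close>[unfolded 1]])
    ultimately show ?thesis
      by (elim disjE) (rule bexI[of _ 1] bexI[of _ 2], simp_all add: on_side_def)+
  next
    case 2
    have "square_boundary t = (1, 0)" unfolding 2 using square_boundary_sides(2)[of 1] by simp
    moreover have "A = F 2 \<or> A = F 3"
      by (rule edge_facets[OF F(2,3) A neq(2) corner(2) \<open>c t \<in> A\<close>[unfolded 2]])
    ultimately show ?thesis
      by (elim disjE) (rule bexI[of _ 2] bexI[of _ 3], simp_all add: on_side_def)+
  next
    case 3
    have "square_boundary t = (1, 1)" unfolding 3 using square_boundary_sides(3)[of 1] by simp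
    moreover have "A = F 3 \<or> A = F 4"
      by (rule edge_facets[OF F(3,4) A neq(3) corner(3) \<open>c t \<in> A\<close>[unfolded 3]])
    ultimately show ?thesis
      by (elim disjE) (rule bexI[of _ 3] bexI[of _ 4], simp_all add: on_side_def)+
  next
    case 4
    have "square_boundary t = (0, 1)"
      using square_boundary_sides(4)[of 0] square_boundary_sides(1)[of 1] 4 by auto
    moreover have "A = F 4 \<or> A = F 1"
      by (rule edge_facets[OF F(4,1) A neq(4) corner(4)]) (use \<open>c t \<in> A\<close> c01 4 in auto)
    ultimately show ?thesis
      by (elim disjE) (rule bexI[of _ 4] bexI[of _ 1], simp_all add: on_side_def)+
  next
    case 5
    have "square_boundary t = (0, 1 - 4 * t)" using square_boundary_sides(1)[of "1 - 4 * t"] 5 by simp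
    moreover have "A = F 1"
      using rel_interior_facet_disjoint[OF P F(1) A int[of 1] \<open>c t \<in> A\<close>] 5 by simp
    ultimately show ?thesis by (intro bexI[of _ 1]) (simp_all add: on_side_def)
  next
    case 6
    have "square_boundary t = (4 * t - 1, 0)" using square_boundary_sides(2)[of "4 * t - 1"] 6 by simp
    moreover have "A = F 2"
      using rel_interior_facet_disjoint[OF P F(2) A int[of 2] \<open>c t \<in> A\<close>] 6 by simp
    ultimately show ?thesis by (intro bexI[of _ 2]) (simp_all add: on_side_def)
  next
    case 7
    have "square_boundary t = (1, 4 * t - 2)" using square_boundary_sides(3)[of "4 * t - 2"] 7 by simp
    moreover have "A = F 3"
      using rel_interior_facet_disjoint[OF P F(3) A int[of 3] \<open>c t \<in> A\<close>] 7 by simp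
    ultimately show ?thesis by (intro bexI[of _ 3]) (simp_all add: on_side_def)
  next
    case 8
    have "square_boundary t = (4 - 4 * t, 1)" using square_boundary_sides(4)[of "4 - 4 * t"] 8 by simp
    moreover have "A = F 4"
      using rel_interior_facet_disjoint[OF P F(4) A int[of 4] \<open>c t \<in> A\<close>] 8 by simp
    ultimately show ?thesis by (intro bexI[of _ 4]) (simp_all add: on_side_def)
  qed
qed

lemma belt_loop_side:
  assumes belt: "four_belt P F" and c: "belt_loop F c" and i: "i \<in> {1..4}"
    and t: "(real i - 1) / 4 \<le> t" "t \<le> real i / 4"
  shows "c t \<in> F i"
proof -
  have c01: "c 0 = c 1" using c by (simp add: belt_loop_def pathfinish_def pathstart_def)
  have "c (1/4) \<in> F 1 \<inter> F 2" "c (2/4) \<in> F 2 \<inter> F 3" "c (3/4) \<in> F 3 \<inter> F 4" "c 1 \<in> F 4 \<inter> F 1"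
    using c rel_interior_subset unfolding belt_loop_def by blast+
  \<comment> \<open>For \<open>i = 1\<close> the left end is \<open>c 0\<close>, which equals
    \<open>c 1\<close> and so lies in \<open>F 4 \<inter> F 1\<close>.\<close>
  then have corners: "c ((real i - 1) / 4) \<in> F i" "c (real i / 4) \<in> F i"
    using i c01 unfolding belt_index_cases by auto
  consider "t = (real i - 1) / 4" | "t = real i / 4" | "(real i - 1) / 4 < t" "t < real i / 4"
    using t by linarith
  then show ?thesis
  proof cases
    case 1
    show ?thesis unfolding 1 by (rule corners(1))
  next
    case 2
    show ?thesis unfolding 2 by (rule corners(2))
  next
    case 3
    then have "c t \<in> rel_interior (F i)" using c i unfolding belt_loop_def by blast
    then show ?thesis using rel_interior_subset by blast
  qed
qed

lemma cross_section_coordinates: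
  assumes belt: "four_belt P F" and Q: "cross_section P F Q"
  shows "Q \<subseteq> P" "compact Q"
    "\<exists>\<eta> ab. continuous_on unit_square \<eta> \<and> \<eta> ` unit_square \<subseteq> Q \<and>
      continuous_on Q ab \<and> ab ` Q \<subseteq> unit_square \<and> (\<forall>q\<in>Q. \<eta> (ab q) = q) \<and>
      (\<forall>i\<in>{1..4}. \<forall>w\<in>unit_square. on_side i w \<longrightarrow> \<eta> w \<in> F i) \<and>
      (\<forall>A\<in>facets P. \<forall>q\<in>Q \<inter> A. \<exists>i\<in>{1..4}. A = F i \<and> on_side i (ab q))"
proof -
  obtain c h k where c: "belt_loop F c" and QP: "Q \<subseteq> P" and fr: "Q \<inter> rel_frontier P = path_image c"
    and hk: "homeomorphism (cball (0::complex) 1) Q h k" "h ` sphere 0 1 = path_image c"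
    using Q unfolding cross_section_def by blast
  show "Q \<subseteq> P" by fact
  show "compact Q"
    using hk(1) compact_continuous_image[of "cball 0 1" h] by (auto simp: homeomorphism_def)
  have "simple_path c" "pathfinish c = pathstart c" using c by (auto simp: belt_loop_def)
  from disc_square_coordinates[OF this hk]
  obtain \<eta> ab where \<eta>: "continuous_on unit_square \<eta>" "\<eta> ` unit_square \<subseteq> Q"
    and ab: "continuous_on Q ab" "ab ` Q \<subseteq> unit_square" "\<forall>q\<in>Q. \<eta> (ab q) = q"
    and bd: "\<And>t. t \<in> {0..1} \<Longrightarrow> \<eta> (square_boundary t) = c t"
      "\<And>t. t \<in> {0..1} \<Longrightarrow> ab (c t) = square_boundary t"
    by blast
  have side: "\<eta> w \<in> F i" if i: "i \<in> {1..4}" and w: "w \<in> unit_square" and s: "on_side i w" for i w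
  proof -
    obtain x y where xy: "w = (x, y)" "0 \<le> x" "x \<le> 1" "0 \<le> y" "y \<le> 1"
      using w by (cases w) auto
    have ex: "\<exists>t. w = square_boundary t \<and> (real i - 1) / 4 \<le> t \<and> t \<le> real i / 4"
    proof -
      consider "i = 1" "x = 0" | "i = 2" "y = 0" | "i = 3" "x = 1" | "i = 4" "y = 1"
        using s xy(1) unfolding on_side_def by auto
      then show ?thesis
      proof cases
        case 1
        then show ?thesis using square_boundary_sides(1)[OF xy(4,5)] xy by (intro exI[of _ "(1 - y) / 4"]) simp
      next
        case 2
        then show ?thesis using square_boundary_sides(2)[OF xy(2,3)] xy by (intro exI[of _ "(1 + x) / 4"]) simp
      next
        case 3
        then show ?thesis using square_boundary_sides(3)[OF xy(4,5)] xy by (intro exI[of _ "(2 + y) / 4"]) simp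
      next
        case 4
        then show ?thesis using square_boundary_sides(4)[OF xy(2,3)] xy by (intro exI[of _ "(4 - x) / 4"]) simp
      qed
    qed
    then obtain t where t: "w = square_boundary t" "(real i - 1) / 4 \<le> t" "t \<le> real i / 4" by blast
    have "t \<in> {0..1}" using t(2,3) i unfolding belt_index_cases by auto
    then show ?thesis
      using bd(1) t(1) belt_loop_side[OF belt c i t(2,3)] by simp
  qed
  have facet: "\<exists>i\<in>{1..4}. A = F i \<and> on_side i (ab q)" if A: "A \<in> facets P" and q: "q \<in> Q \<inter> A" for A q
  proof -
    \<comment> \<open>Facets lie in the relative frontier, which \<open>Q\<close> meets only along
      the loop; so a point of \<open>Q\<close> on a facet is some \<open>c t\<close>.\<close>
    have "A \<subseteq> rel_frontier P"
      using A rel_frontier_of_polyhedron[OF polytope_imp_polyhedron[OF P]] by (auto simp: facets_def)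
    then have "q \<in> path_image c" using q fr by blast
    then obtain t where t: "t \<in> {0..1}" "q = c t" by (auto simp: path_image_def)
    then show ?thesis
      using belt_loop_facet[OF belt c A t(1)] q bd(2)[OF t(1)] by simp
  qed
  show "\<exists>\<eta> ab. continuous_on unit_square \<eta> \<and> \<eta> ` unit_square \<subseteq> Q \<and>
      continuous_on Q ab \<and> ab ` Q \<subseteq> unit_square \<and> (\<forall>q\<in>Q. \<eta> (ab q) = q) \<and>
      (\<forall>i\<in>{1..4}. \<forall>w\<in>unit_square. on_side i w \<longrightarrow> \<eta> w \<in> F i) \<and>
      (\<forall>A\<in>facets P. \<forall>q\<in>Q \<inter> A. \<exists>i\<in>{1..4}. A = F i \<and> on_side i (ab q))"
    using \<eta> ab side facet by (intro exI[of _ \<eta>] exI[of _ ab]) blast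
qed

end

text \<open>The tent function of period \<pi>: the distance of \<theta> from the nearest multiple of
  \<pi> in units of \<pi>/2. It folds the line onto [0,1].\<close>

definition fold_angle :: "real \<Rightarrow> real" where
  "fold_angle \<theta> = 2 / pi * arcsin \<bar>sin \<theta>\<bar>"

lemma continuous_on_fold_angle: "continuous_on S fold_angle"
  unfolding fold_angle_def by (intro continuous_intros) auto

lemma fold_angle_bounds: "0 \<le> fold_angle \<theta>" "fold_angle \<theta> \<le> 1"
proof -
  have "0 \<le> arcsin \<bar>sin \<theta>\<bar>" "arcsin \<bar>sin \<theta>\<bar> \<le> pi / 2"
    using arcsin_le_arcsin[of 0 "\<bar>sin \<theta>\<bar>"] arcsin_bounded[of "\<bar>sin \<theta>\<bar>"] by auto
  then show "0 \<le> fold_angle \<theta>" "fold_angle \<theta> \<le> 1"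
    using pi_gt_zero by (simp_all add: fold_angle_def divide_le_eq)
qed

lemma fold_angle_eq_0: "sin \<theta> = 0 \<Longrightarrow> fold_angle \<theta> = 0"
  by (simp add: fold_angle_def)

lemma fold_angle_eq_1: "cos \<theta> = 0 \<Longrightarrow> fold_angle \<theta> = 1"
  using sin_cos_squared_add[of \<theta>] by (simp add: fold_angle_def abs_square_eq_1)

lemma fold_angle_eqI:
  assumes "0 \<le> a" "a \<le> 1" "\<bar>sin \<theta>\<bar> = sin (pi / 2 * a)"
  shows "fold_angle \<theta> = a"
proof -
  have "0 \<le> pi / 2 * a" "pi / 2 * a \<le> pi / 2 * 1"
    using assms(1,2) pi_gt_zero by (simp, intro mult_left_mono, simp_all)
  then have "arcsin (sin (pi / 2 * a)) = pi / 2 * a"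
    using pi_gt_zero by (intro arcsin_sin) linarith+
  then show ?thesis using pi_gt_zero unfolding fold_angle_def assms(3) by (simp add: field_simps)
qed

section \<open>Developing the section into the plane\<close>

locale square_section = coloured_polytope P col
  for P :: "'a::euclidean_space set" and col :: "'a set \<Rightarrow> z2_cube" +
  fixes F :: "nat \<Rightarrow> 'a set" and Q :: "'a set" and \<eta> :: "real \<times> real \<Rightarrow> 'a" and ab :: "'a \<Rightarrow> real \<times> real"
  assumes belt: "four_belt P F"
    and Q: "Q \<subseteq> P" "compact Q"
    and \<eta>: "continuous_on unit_square \<eta>" "\<eta> ` unit_square \<subseteq> Q"
    and ab: "continuous_on Q ab" "ab ` Q \<subseteq> unit_square" "q \<in> Q \<Longrightarrow> \<eta> (ab q) = q"
    and side: "i \<in> {1..4} \<Longrightarrow> w \<in> unit_square \<Longrightarrow> on_side i w \<Longrightarrow> \<eta> w \<in> F i"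
    and facet: "A \<in> facets P \<Longrightarrow> q \<in> Q \<Longrightarrow> q \<in> A \<Longrightarrow> \<exists>i\<in>{1..4}. A = F i \<and> on_side i (ab q)"
begin

lemma F: "F 1 \<in> facets P" "F 2 \<in> facets P" "F 3 \<in> facets P" "F 4 \<in> facets P"
  and F_neq: "F 1 \<noteq> F 2" "F 1 \<noteq> F 3" "F 1 \<noteq> F 4" "F 2 \<noteq> F 3" "F 2 \<noteq> F 4" "F 3 \<noteq> F 4"
  and F_disjoint: "F 1 \<inter> F 3 = {}" "F 2 \<inter> F 4 = {}"
  using belt by (auto simp: four_belt_def inj_on_def)

lemma on_side_iff:
  assumes "i \<in> {1..4}" "q \<in> Q"
  shows "on_side i (ab q) \<longleftrightarrow> q \<in> F i"
proof
  assume "on_side i (ab q)"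
  moreover have "ab q \<in> unit_square" using ab(2) assms(2) by blast
  ultimately show "q \<in> F i" using side[OF assms(1)] ab(3)[OF assms(2)] by metis
next
  assume "q \<in> F i"
  moreover have "F i \<in> facets P" using assms(1) F unfolding belt_index_cases by auto
  ultimately obtain j where j: "j \<in> {1..4}" "F i = F j" "on_side j (ab q)"
    using facet[OF _ assms(2)] by blast
  moreover have "i = j"
    using j(1,2) assms(1) F_neq unfolding belt_index_cases by metis
  ultimately show "on_side i (ab q)" by simp
qed

text \<open>The values are prescribed on whole facets and not just on their traces in
  \<open>Q\<close>, since a homotopy in \<open>M\<close> may cross the belt facets away from the
  square.\<close>

lemma extended_coordinates:
  "\<exists>a. continuous_on P a \<and> a ` P \<subseteq> {0..1} \<and> (\<forall>p\<in>F 1. a p = 0) \<and> (\<forall>p\<in>F 3. a p = 1) \<and> (\<forall>q\<in>Q. a q = fst (ab q))"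
  "\<exists>b. continuous_on P b \<and> b ` P \<subseteq> {0..1} \<and> (\<forall>p\<in>F 2. b p = 0) \<and> (\<forall>p\<in>F 4. b p = 1) \<and> (\<forall>q\<in>Q. b q = snd (ab q))"
proof -
  have im: "fst ` ab ` Q \<subseteq> {0..1}" "snd ` ab ` Q \<subseteq> {0..1}" using ab(2) by auto
  have s: "\<And>q. q \<in> Q \<Longrightarrow> q \<in> F 1 \<Longrightarrow> fst (ab q) = 0" "\<And>q. q \<in> Q \<Longrightarrow> q \<in> F 3 \<Longrightarrow> fst (ab q) = 1"
    "\<And>q. q \<in> Q \<Longrightarrow> q \<in> F 2 \<Longrightarrow> snd (ab q) = 0" "\<And>q. q \<in> Q \<Longrightarrow> q \<in> F 4 \<Longrightarrow> snd (ab q) = 1"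
    using on_side_iff[of 1] on_side_iff[of 2] on_side_iff[of 3] on_side_iff[of 4]
    by (simp_all add: on_side_def)
  have cl: "closed Q" using Q(2) by (rule compact_imp_closed)
  show "\<exists>a. continuous_on P a \<and> a ` P \<subseteq> {0..1} \<and> (\<forall>p\<in>F 1. a p = 0) \<and> (\<forall>p\<in>F 3. a p = 1) \<and> (\<forall>q\<in>Q. a q = fst (ab q))"
    by (rule extend_coordinate) (use cl Q(1) F facet_props F_disjoint ab(1) im s in \<open>auto simp: image_image intro: continuous_on_fst\<close>)
  show "\<exists>b. continuous_on P b \<and> b ` P \<subseteq> {0..1} \<and> (\<forall>p\<in>F 2. b p = 0) \<and> (\<forall>p\<in>F 4. b p = 1) \<and> (\<forall>q\<in>Q. b q = snd (ab q))"
    by (rule extend_coordinate) (use cl Q(1) F facet_props F_disjoint ab(1) im s in \<open>auto simp: image_image intro: continuous_on_snd\<close>)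
qed

text \<open>Signs and zeros are what is read off: sine and cosine of \<open>fst w\<close> vanish
  over the sides a = 0 and a = 1, those of \<open>snd w\<close> over b = 0 and b = 1, and a facet
  off the belt keeps the constant sign \<open>e A\<close>.\<close>

definition sign_at :: "('a set \<Rightarrow> bit) \<Rightarrow> 'a set \<Rightarrow> real \<times> real \<Rightarrow> real" where
  "sign_at e A w = (if A = F 1 then sin (fst w) else if A = F 3 then cos (fst w)
    else if A = F 2 then sin (snd w) else if A = F 4 then cos (snd w) else flip (e A) 1)"

definition fold_point :: "real \<times> real \<Rightarrow> 'a" where
  "fold_point w = \<eta> (fold_angle (fst w), fold_angle (snd w))"

text \<open>The universal covering of a component of the section: the plane is tiled by reflected copies
  of the square, and the signs of sine and cosine tell in which copy a point lies. The parameter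
  \<open>e\<close> fixes the colours off the belt.\<close>

definition develop :: "('a set \<Rightarrow> bit) \<Rightarrow> real \<times> real \<Rightarrow> ('a \<times> z2_cube) set" where
  "develop e w = cp (fold_point w) (fs (\<lambda>A. sgn_bit (sign_at e A w)))"

lemma fold_point_in_Q: "fold_point w \<in> Q"
  using \<eta>(2) fold_angle_bounds by (auto simp: fold_point_def image_subset_iff)

lemma sign_at_eq_0: "A \<in> facets P \<Longrightarrow> sign_at e A w = 0 \<Longrightarrow> fold_point w \<in> A"
proof -
  assume "sign_at e A w = 0"
  then consider "A = F 1" "sin (fst w) = 0" | "A = F 3" "cos (fst w) = 0"
    | "A = F 2" "sin (snd w) = 0" | "A = F 4" "cos (snd w) = 0"
    by (auto simp: sign_at_def flip_def split: if_splits)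
  then show "fold_point w \<in> A"
    unfolding fold_point_def
    by cases (auto intro!: side simp: on_side_def fold_angle_eq_0 fold_angle_eq_1 fold_angle_bounds)
qed

lemma continuous_map_develop: "continuous_map euclidean M (develop e)"
  unfolding develop_def[abs_def]
proof (rule continuous_map_cp_signs)
  show "continuous_on UNIV fold_point"
    unfolding fold_point_def[abs_def]
    by (rule continuous_on_compose2[OF \<eta>(1)])
      (auto intro!: continuous_on_Pair continuous_on_compose2[OF continuous_on_fold_angle[of UNIV]] continuous_intros
        simp: fold_angle_bounds)
  show "range fold_point \<subseteq> P" using fold_point_in_Q Q(1) by blast
  show "continuous_on UNIV (sign_at e A)" for A
    unfolding sign_at_def[abs_def]
    by (cases "A = F 1"; cases "A = F 3"; cases "A = F 2"; cases "A = F 4"; simp; intro continuous_intros)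
qed (rule sign_at_eq_0)

lemma proj_develop: "small_cover_proj (develop e w) = fold_point w"
  unfolding develop_def using fold_point_in_Q Q(1) by (intro small_cover_proj_cover_point[OF P]) blast

text \<open>\<Theta> consists of the two angles and exists on all of \<open>D\<close>, while
  \<open>H\<close> is recovered from it only over \<open>Q\<close>: there folding the angles returns
  the coordinates of the projection, and their sines and cosines return the signs of
  \<open>v\<close>. The last property keeps end points fixed.\<close>

lemma development:
  fixes H :: "'b::real_normed_vector \<Rightarrow> ('a \<times> z2_cube) set"
  assumes H: "continuous_map euclidean M H" and v: "lifts H D v" and "convex D"
  obtains \<Theta> where "continuous_on D \<Theta>"
    "\<forall>z\<in>D. \<forall>e. small_cover_proj (H z) \<in> Q \<longrightarrow> (\<forall>A\<in>facets P - F ` {1..4}. e A = sgn_bit (v A z)) \<longrightarrow>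
      H z = develop e (\<Theta> z)"
    "\<forall>S\<subseteq>D. connected S \<longrightarrow> (\<forall>z\<in>S. \<forall>z'\<in>S. H z = H z') \<longrightarrow> (\<forall>z\<in>S. \<forall>z'\<in>S. \<Theta> z = \<Theta> z')"
proof -
  let ?p = "\<lambda>z. small_cover_proj (H z)"
  obtain a where a: "continuous_on P a" "a ` P \<subseteq> {0..1}" "\<And>p. p \<in> F 1 \<Longrightarrow> a p = 0"
    "\<And>p. p \<in> F 3 \<Longrightarrow> a p = 1" "\<And>q. q \<in> Q \<Longrightarrow> a q = fst (ab q)"
    using extended_coordinates(1) by blast
  obtain b where b: "continuous_on P b" "b ` P \<subseteq> {0..1}" "\<And>p. p \<in> F 2 \<Longrightarrow> b p = 0"
    "\<And>p. p \<in> F 4 \<Longrightarrow> b p = 1" "\<And>q. q \<in> Q \<Longrightarrow> b q = snd (ab q)"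
    using extended_coordinates(2) by blast
  obtain \<theta> where \<theta>: "continuous_on D \<theta>" "\<And>z. z \<in> D \<Longrightarrow> sin (\<theta> z) = sgn (v (F 1) z) * sin (pi / 2 * a (?p z))"
    "\<And>z. z \<in> D \<Longrightarrow> cos (\<theta> z) = sgn (v (F 3) z) * cos (pi / 2 * a (?p z))"
    using angle_lift[OF H v \<open>convex D\<close> F(1,3) F_disjoint(1) a(1,3,4)] by blast
  obtain \<phi> where \<phi>: "continuous_on D \<phi>" "\<And>z. z \<in> D \<Longrightarrow> sin (\<phi> z) = sgn (v (F 2) z) * sin (pi / 2 * b (?p z))"
    "\<And>z. z \<in> D \<Longrightarrow> cos (\<phi> z) = sgn (v (F 4) z) * cos (pi / 2 * b (?p z))"
    using angle_lift[OF H v \<open>convex D\<close> F(2,4) F_disjoint(2) b(1,3,4)] by blast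
  have fold: "fold_angle \<theta> = s" if "0 \<le> s" "s \<le> 1" "sin \<theta> = sgn r * sin (pi / 2 * s)" "r = 0 \<Longrightarrow> s = 0"
    for \<theta> s r :: real
  proof (rule fold_angle_eqI[OF that(1,2)])
    have "sin (pi / 2 * s) \<ge> 0" using that(1,2) by (intro sin_ge_zero) auto
    then show "\<bar>sin \<theta>\<bar> = sin (pi / 2 * s)"
      using that(3,4) by (cases "r = 0") (auto simp: abs_mult sgn_if)
  qed
  have sign: "sgn_bit (sgn r * s) = sgn_bit r" if "s > 0" for r s :: real
    using that by (simp add: sgn_bit_def sgn_if)
  have dev: "H z = develop e (\<theta> z, \<phi> z)"
    if z: "z \<in> D" and pQ: "?p z \<in> Q" and e: "\<forall>A\<in>facets P - F ` {1..4}. e A = sgn_bit (v A z)" for z e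
  proof -
    have pP: "?p z \<in> P" using pQ Q(1) by blast
    then have a01: "0 \<le> a (?p z)" "a (?p z) \<le> 1" and b01: "0 \<le> b (?p z)" "b (?p z) \<le> 1"
      using a(2) b(2) by (auto simp: image_subset_iff)
    have "fold_angle (\<theta> z) = a (?p z)"
      by (rule fold[OF a01 \<theta>(2)[OF z]]) (use lifts_eq_0_iff[OF v z F(1)] a(3) in blast)
    moreover have "fold_angle (\<phi> z) = b (?p z)"
      by (rule fold[OF b01 \<phi>(2)[OF z]]) (use lifts_eq_0_iff[OF v z F(2)] b(3) in blast)
    ultimately have fp: "fold_point (\<theta> z, \<phi> z) = ?p z"
      using ab(3)[OF pQ] a(5)[OF pQ] b(5)[OF pQ] by (simp add: fold_point_def)
    \<comment> \<open>For a belt facet that misses the point, the sine or cosine of the coordinate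
      is strictly positive, so the sign is that of \<open>v A z\<close>. Facets through the point
      are left to \<open>cp_cong\<close>.\<close>
    have "sgn_bit (sign_at e A (\<theta> z, \<phi> z)) = sgn_bit (v A z)" if A: "A \<in> facets P" "?p z \<notin> A" for A
    proof -
      have off: "\<not> on_side i (ab (?p z))" if "A = F i" "i \<in> {1..4}" for i
        using on_side_iff[OF that(2) pQ] A(2) that(1) by simp
      have cos_pos: "cos (pi / 2 * s) > 0" if "0 \<le> s" "s < 1" for s
      proof -
        have "0 \<le> pi / 2 * s" "pi / 2 * s < pi / 2 * 1"
          using that pi_gt_zero by (simp, intro mult_strict_left_mono, simp_all)
        then show ?thesis using pi_gt_zero by (intro cos_gt_zero_pi) linarith+
      qed
      consider "A = F 1" | "A = F 2" | "A = F 3" | "A = F 4" | "A \<notin> F ` {1..4}"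
        unfolding image_iff bex_simps using belt_index_cases by metis
      then show ?thesis
      proof cases
        case 1
        then have "a (?p z) > 0" using off[of 1] a(5)[OF pQ] a01 by (simp add: on_side_def)
        then have "sin (pi / 2 * a (?p z)) > 0" using a01 pi_gt_zero by (intro sin_gt_zero) auto
        then show ?thesis using 1 \<theta>(2)[OF z] sign by (simp add: sign_at_def)
      next
        case 2
        then have "b (?p z) > 0" using off[of 2] b(5)[OF pQ] b01 by (simp add: on_side_def)
        then have "sin (pi / 2 * b (?p z)) > 0" using b01 pi_gt_zero by (intro sin_gt_zero) auto
        then show ?thesis using 2 F_neq \<phi>(2)[OF z] sign by (simp add: sign_at_def)
      next
        case 3
        then have "a (?p z) < 1" using off[of 3] a(5)[OF pQ] a01 by (simp add: on_side_def)
        then have "cos (pi / 2 * a (?p z)) > 0" using a01(1) by (rule cos_pos[rotated])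
        then show ?thesis using 3 F_neq \<theta>(3)[OF z] sign by (simp add: sign_at_def)
      next
        case 4
        then have "b (?p z) < 1" using off[of 4] b(5)[OF pQ] b01 by (simp add: on_side_def)
        then have "cos (pi / 2 * b (?p z)) > 0" using b01(1) by (rule cos_pos[rotated])
        then show ?thesis using 4 F_neq \<phi>(3)[OF z] sign by (simp add: sign_at_def)
      next
        case 5
        then have "A \<noteq> F 1" "A \<noteq> F 2" "A \<noteq> F 3" "A \<noteq> F 4" by auto
        moreover have "e A = sgn_bit (v A z)" using e A(1) 5 by blast
        ultimately show ?thesis by (simp add: sign_at_def flip_def sgn_bit_def)
      qed
    qed
    then have "develop e (\<theta> z, \<phi> z) = cp (?p z) (fs (\<lambda>A. sgn_bit (v A z)))"
      unfolding develop_def fp by (rule cp_cong[OF pP])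
    then show ?thesis using lifts_cp[OF v z] by (simp only:)
  qed
  have const: "(\<theta> z, \<phi> z) = (\<theta> z', \<phi> z')"
    if S: "S \<subseteq> D" "connected S" and eq: "\<forall>z\<in>S. \<forall>z'\<in>S. H z = H z'" and zz': "z \<in> S" "z' \<in> S" for S z z'
  proof -
    \<comment> \<open>The absolute value of \<open>v A\<close> depends on \<open>H\<close> only,
      hence is constant on \<open>S\<close>; where it is not 0, connectedness fixes the
      sign.\<close>
    have sg: "sgn (v A y) = sgn (v A z)" if A: "A \<in> facets P" and y: "y \<in> S" for A y
    proof (cases "v A z = 0")
      case True
      have "\<bar>v A y\<bar> = \<bar>v A z\<bar>"
        using lifts_abs[OF v _ A, of y] lifts_abs[OF v _ A, of z] eq S(1) y zz'(1) by (metis subsetD)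
      then show ?thesis using True by simp
    next
      case False
      have "\<bar>v A y\<bar> = \<bar>v A z\<bar>" if "y \<in> S" for y
        using lifts_abs[OF v _ A, of y] lifts_abs[OF v _ A, of z] eq S(1) that zz'(1) by (metis subsetD)
      then have nz: "v A y \<noteq> 0" if "y \<in> S" for y
        using False that by fastforce
      have "v A y < 0 \<longleftrightarrow> v A z < 0"
        by (rule constant_sign[OF S(2) continuous_on_subset[OF lifts_continuous[OF v A] S(1)] nz y zz'(1)])
      then show ?thesis using nz[OF y] False by (cases "v A z < 0") (auto simp: sgn_if)
    qed
    have pS: "?p y = ?p z" if "y \<in> S" for y using eq that zz'(1) by metis
    have "\<theta> z = \<theta> z'"
    proof (rule constant_angle[OF S(2) continuous_on_subset[OF \<theta>(1) S(1)] zz'])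
      fix y assume y: "y \<in> S"
      show "sin (\<theta> y) = sin (\<theta> z) \<and> cos (\<theta> y) = cos (\<theta> z)"
        using \<theta>(2,3)[of y] \<theta>(2,3)[of z] S(1) y zz'(1) sg[OF F(1) y] sg[OF F(3) y] pS[OF y] by (metis subsetD)
    qed
    moreover have "\<phi> z = \<phi> z'"
    proof (rule constant_angle[OF S(2) continuous_on_subset[OF \<phi>(1) S(1)] zz'])
      fix y assume y: "y \<in> S"
      show "sin (\<phi> y) = sin (\<phi> z) \<and> cos (\<phi> y) = cos (\<phi> z)"
        using \<phi>(2,3)[of y] \<phi>(2,3)[of z] S(1) y zz'(1) sg[OF F(2) y] sg[OF F(4) y] pS[OF y] by (metis subsetD)
    qed
    ultimately show ?thesis by simp
  qed
  show thesis
  proof (rule that[of "\<lambda>z. (\<theta> z, \<phi> z)"])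
    show "continuous_on D (\<lambda>z. (\<theta> z, \<phi> z))" by (intro continuous_on_Pair \<theta>(1) \<phi>(1))
  qed (use dev const in blast)+
qed

lemma sectional_submanifold_proj:
  assumes "sectional_submanifold P col F Q N" "y \<in> N"
  shows "small_cover_proj y \<in> Q"
proof -
  have "y \<in> section_preimage P col Q"
  proof (cases "generate Z2_cube (col ` F ` {1..4}) = UNIV")
    case True
    then show ?thesis using assms by (simp add: sectional_submanifold_def)
  next
    case False
    then have "N \<in> connected_components_of (subtopology M (section_preimage P col Q))"
      using assms(1) by (simp add: sectional_submanifold_def)
    then show ?thesis
      using connected_components_of_subset assms(2) by fastforce
  qed
  then show ?thesis
    by (simp add: section_preimage_def)
qed

text \<open>When \<open>N\<close> is a component this is the maximality of components. It keeps a
  homotopy over \<open>Q\<close> inside \<open>N\<close> in both cases of the definition.\<close>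

lemma sectional_submanifold_absorbs:
  assumes N: "sectional_submanifold P col F Q N" and C: "connectedin M C"
    and CQ: "\<And>y. y \<in> C \<Longrightarrow> small_cover_proj y \<in> Q" and "x \<in> C" "x \<in> N"
  shows "C \<subseteq> N"
proof -
  have sub: "C \<subseteq> section_preimage P col Q"
    using CQ connectedin_subset_topspace[OF C] by (auto simp: section_preimage_def)
  show ?thesis
  proof (cases "generate Z2_cube (col ` F ` {1..4}) = UNIV")
    case True
    then show ?thesis using N sub by (simp add: sectional_submanifold_def)
  next
    case False
    then have "N \<in> connected_components_of (subtopology M (section_preimage P col Q))"
      using N by (simp add: sectional_submanifold_def)
    moreover have "connectedin (subtopology M (section_preimage P col Q)) C"
      using C sub by (simp add: connectedin_subtopology)
    moreover have "\<not> disjnt N C"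
      using assms(4,5) by (auto simp: disjnt_iff)
    ultimately show ?thesis by (rule connected_components_of_maximal)
  qed
qed

lemma homotopic_loops_in_section:
  assumes N: "sectional_submanifold P col F Q N"
    and p: "loop_at (subtopology M N) x p" and q: "loop_at (subtopology M N) x q"
    and hom: "homotopic_loops_at M x p q"
  shows "homotopic_loops_at (subtopology M N) x p q"
proof -
  let ?I = "top_of_set {0..1::real}"
  obtain h where h: "continuous_map (prod_topology ?I ?I) M h" "\<And>t. h (0, t) = p t" "\<And>t. h (1, t) = q t"
    "\<And>s. s \<in> {0..1} \<Longrightarrow> h (s, 0) = x \<and> h (s, 1) = x"
    using hom unfolding homotopic_with_def by blast
  have pN: "p t \<in> N" and qN: "q t \<in> N" if "t \<in> {0..1}" for t
    using p q that by (auto simp: loop_at_def pathin_subtopology)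
  have xN: "x \<in> N" using pN[of 0] p by (simp add: loop_at_def)
  \<comment> \<open>The lifting lemmas are stated for maps on a whole space, so the homotopy is
    extended to the plane by clamping both parameters.\<close>
  define clamp where "clamp t = max 0 (min 1 t)" for t :: real
  define H where "H z = h (clamp (fst z), clamp (snd z))" for z
  have clamp: "clamp t \<in> {0..1}" "t \<in> {0..1} \<Longrightarrow> clamp t = t" for t
    by (auto simp: clamp_def)
  have "continuous_on UNIV (\<lambda>z. (clamp (fst z), clamp (snd z)))"
    unfolding clamp_def by (intro continuous_intros)
  then have "continuous_map euclidean (prod_topology ?I ?I) (\<lambda>z. (clamp (fst z), clamp (snd z)))"
    using clamp(1) by (simp add: continuous_map_in_subtopology)
  from continuous_map_compose[OF this h(1)] have H: "continuous_map euclidean M H"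
    by (simp add: o_def H_def[abs_def])
  have H_sides: "H (0, t) = p t" "H (1, t) = q t" if "t \<in> {0..1}" for t
    using that clamp(2) h(2,3) by (simp_all add: H_def)
  have H_ends: "H (s, 0) = x" "H (s, 1) = x" if "s \<in> {0..1}" for s
    using that clamp(2) h(4) by (simp_all add: H_def)
  obtain v where v: "lifts H unit_square v"
    using lifts_box[OF H, of 0 1 0 1] by auto
  have "convex unit_square" by (intro convex_Times) simp_all
  obtain \<Theta> where \<Theta>: "continuous_on unit_square \<Theta>"
    and dev: "\<forall>z\<in>unit_square. \<forall>e. small_cover_proj (H z) \<in> Q \<longrightarrow> (\<forall>A\<in>facets P - F ` {1..4}. e A = sgn_bit (v A z)) \<longrightarrow>
      H z = develop e (\<Theta> z)"
    and const: "\<forall>S\<subseteq>unit_square. connected S \<longrightarrow> (\<forall>z\<in>S. \<forall>z'\<in>S. H z = H z') \<longrightarrow> (\<forall>z\<in>S. \<forall>z'\<in>S. \<Theta> z = \<Theta> z')"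
    by (rule development[OF H v \<open>convex unit_square\<close>])
  \<comment> \<open>The signs off the belt, read at one corner. They persist along
    \<open>snd z = 0\<close>, where \<open>H\<close> is constantly \<open>x\<close>, and along the
    sides \<open>fst z = 0\<close> and \<open>fst z = 1\<close>: these coordinates have no zeros
    over \<open>N\<close>.\<close>
  define e where "e A = sgn_bit (v A (0, 0))" for A
  have nz: "v A z \<noteq> 0" if z: "z \<in> unit_square" "H z \<in> N" and A: "A \<in> facets P - F ` {1..4}" for z A
  proof
    assume "v A z = 0"
    moreover have "A \<in> facets P" using A by blast
    ultimately have "small_cover_proj (H z) \<in> A" using lifts_eq_0_iff[OF v z(1)] by blast
    from facet[OF \<open>A \<in> facets P\<close> sectional_submanifold_proj[OF N z(2)] this]
    show False using A by blast
  qed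
  have same: "sgn_bit (v A z) = sgn_bit (v A z')"
    if "S \<subseteq> unit_square" "connected S" "H ` S \<subseteq> N" "A \<in> facets P - F ` {1..4}" "z \<in> S" "z' \<in> S" for S A z z'
  proof -
    have "A \<in> facets P" using that(4) by blast
    have "v A z < 0 \<longleftrightarrow> v A z' < 0"
      by (rule constant_sign[OF that(2) continuous_on_subset[OF lifts_continuous[OF v \<open>A \<in> facets P\<close>] that(1)] _ that(5,6)])
        (use nz that in blast)
    then show ?thesis by (simp add: sgn_bit_def)
  qed
  have bottom: "connected ({0..1::real} \<times> {0::real})" and vert: "connected ({s::real} \<times> {0..1::real})" for s
    by (intro connected_Times connected_Icc connected_sing)+
  have e_side: "H (s, t) = develop e (\<Theta> (s, t))" if s: "s = 0 \<or> s = 1" and t: "t \<in> {0..1}" for s t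
  proof (rule dev[rule_format])
    have HN: "H (s, t) \<in> N" if "t \<in> {0..1}" for t
      using s H_sides[OF that] pN[OF that] qN[OF that] by auto
    show "(s, t) \<in> unit_square" using s t by auto
    show "small_cover_proj (H (s, t)) \<in> Q"
      by (rule sectional_submanifold_proj[OF N HN[OF t]])
    show "e A = sgn_bit (v A (s, t))" if A: "A \<in> facets P - F ` {1..4}" for A
    proof -
      have "sgn_bit (v A (0, 0)) = sgn_bit (v A (s, 0))"
        by (rule same[OF _ bottom _ A]) (use s H_ends(1) xN in auto)
      also have "\<dots> = sgn_bit (v A (s, t))"
        by (rule same[OF _ vert _ A]) (use s t HN in auto)
      finally show "e A = sgn_bit (v A (s, t))" by (simp add: e_def)
    qed
  qed
  \<comment> \<open>\<open>H\<close> is constantly \<open>x\<close> on each of these two sides, so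
    the developed loops share both end points.\<close>
  have ends: "\<Theta> (0, 0) = \<Theta> (1, 0)" "\<Theta> (0, 1) = \<Theta> (1, 1)"
  proof -
    show "\<Theta> (0, 0) = \<Theta> (1, 0)"
      by (rule const[rule_format, of "{0..1} \<times> {0}"]) (use H_ends(1) bottom in auto)
    show "\<Theta> (0, 1) = \<Theta> (1, 1)"
      by (rule const[rule_format, of "{0..1} \<times> {1}"]) (use H_ends(2) in \<open>auto intro: connected_Times\<close>)
  qed
  \<comment> \<open>The straight-line homotopy of the developed paths, followed by
    \<open>develop\<close>. As \<open>develop\<close> maps the whole plane to points over
    \<open>Q\<close>, \<open>G\<close> stays in the section even where \<open>H\<close> leaves
    it.\<close>
  define G where "G z = develop e ((1 - fst z) *\<^sub>R \<Theta> (0, snd z) + fst z *\<^sub>R \<Theta> (1, snd z))" for z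
  have "continuous_on unit_square (\<lambda>z. \<Theta> (s, snd z))" if "s \<in> {0..1}" for s
    by (rule continuous_on_compose2[OF \<Theta>]) (use that in \<open>auto intro!: continuous_intros\<close>)
  then have "continuous_on unit_square (\<lambda>z. (1 - fst z) *\<^sub>R \<Theta> (0, snd z) + fst z *\<^sub>R \<Theta> (1, snd z))"
    by (intro continuous_intros) auto
  then have "continuous_map (top_of_set unit_square) euclidean
      (\<lambda>z. (1 - fst z) *\<^sub>R \<Theta> (0, snd z) + fst z *\<^sub>R \<Theta> (1, snd z))"
    by simp
  from continuous_map_compose[OF this continuous_map_develop]
  have G: "continuous_map (top_of_set unit_square) M G"
    by (simp add: o_def G_def[abs_def])
  have G_sides: "G (0, t) = p t" "G (1, t) = q t" if "t \<in> {0..1}" for t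
    using e_side[of 0 t] e_side[of 1 t] H_sides[OF that] that by (simp_all add: G_def)
  have "(1 - s) *\<^sub>R u + s *\<^sub>R u = u" for s and u :: "real \<times> real"
    by (simp add: scaleR_left_diff_distrib)
  then have G_ends: "G (s, 0) = x" "G (s, 1) = x" for s
    using G_sides[of 0] G_sides[of 1] p ends by (simp_all add: G_def loop_at_def)
  \<comment> \<open>Lying over \<open>Q\<close> does not suffice when \<open>N\<close> is a single
    component; connectedness and the point \<open>x\<close> bring the image of \<open>G\<close> into
    \<open>N\<close>.\<close>
  have "connectedin (top_of_set unit_square) unit_square"
    by (simp add: connectedin_subtopology connected_Times)
  then have "connectedin M (G ` unit_square)"
    by (rule connectedin_continuous_map_image[OF G])
  moreover have "small_cover_proj (G z) \<in> Q" for z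
    unfolding G_def proj_develop by (rule fold_point_in_Q)
  then have "small_cover_proj y \<in> Q" if "y \<in> G ` unit_square" for y
    using that by blast
  moreover have "x \<in> G ` unit_square"
    using G_ends(1)[of 0] by (intro image_eqI[of _ _ "(0, 0)"]) auto
  ultimately have "G ` unit_square \<subseteq> N"
    using xN by (intro sectional_submanifold_absorbs[OF N, of _ x])
  then have GN: "continuous_map (prod_topology ?I ?I) (subtopology M N) G"
    using G by (auto simp: continuous_map_in_subtopology)
  show ?thesis
  \<comment> \<open>\<open>G\<close> matches \<open>p\<close> and \<open>q\<close> only on
    \<open>{0..1}\<close>, while the definition of \<open>homotopic_with\<close> asks for equality
    everywhere; this characterisation restricts it to the interval.\<close>
  proof (rule iffD2[OF homotopic_with])
    show "(h 0 = x \<and> h 1 = x) = (k 0 = x \<and> k 1 = x)"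
      if "\<And>t. t \<in> topspace ?I \<Longrightarrow> h t = k t" for h k :: "real \<Rightarrow> ('a \<times> z2_cube) set"
      using that[of 0] that[of 1] by simp
    show "\<exists>h. continuous_map (prod_topology ?I ?I) (subtopology M N) h \<and>
        (\<forall>t\<in>topspace ?I. h (0, t) = p t) \<and> (\<forall>t\<in>topspace ?I. h (1, t) = q t) \<and>
        (\<forall>s\<in>{0..1}. h (s, 0) = x \<and> h (s, 1) = x)"
      by (intro exI[of _ G] conjI ballI GN) (simp_all add: G_sides G_ends)
  qed
qed

end

theorem lemma3:
  fixes P :: "'a::euclidean_space set"
    and col :: "'a set \<Rightarrow> z2_cube"
    and F :: "nat \<Rightarrow> 'a set"
    and Q :: "'a set"
    and N :: "('a \<times> z2_cube) set set"
    and x :: "('a \<times> z2_cube) set"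
  assumes "simple_3_polytope P"
    and "characteristic_map P col"
    and "four_belt P F"
    and "cross_section P F Q"
    and "sectional_submanifold P col F Q N"
    and "x \<in> N"
  shows "fundamental_group_map (small_cover P col) x id
           \<in> mon (fundamental_group (subtopology (small_cover P col) N) x)
                 (fundamental_group (small_cover P col) x) \<and>
         (\<exists>j \<in> hom W_square (W_polytope P).
            \<forall>i\<in>{1..4}. j (edge_reflection i) = facet_reflection P (F i)) \<and>
         (\<forall>j \<in> hom W_square (W_polytope P).
            (\<forall>i\<in>{1..4}. j (edge_reflection i) = facet_reflection P (F i)) \<longrightarrow>
            inj_on j (carrier W_square))"
proof -
  interpret coloured_polytope P col
    using assms(1,2) by unfold_locales
  from cross_section_coordinates(3)[OF assms(3,4)] obtain \<eta> ab where coords: "continuous_on unit_square \<eta>" "\<eta> ` unit_square \<subseteq> Q"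
    "continuous_on Q ab" "ab ` Q \<subseteq> unit_square" "\<forall>q\<in>Q. \<eta> (ab q) = q"
    "\<forall>i\<in>{1..4}. \<forall>w\<in>unit_square. on_side i w \<longrightarrow> \<eta> w \<in> F i"
    "\<forall>A\<in>facets P. \<forall>q\<in>Q \<inter> A. \<exists>i\<in>{1..4}. A = F i \<and> on_side i (ab q)"
    by (elim exE conjE) (rule that)
  interpret square_section P col F Q \<eta> ab
  proof
    show "Q \<subseteq> P" "compact Q" using cross_section_coordinates(1,2)[OF assms(3,4)] .
    show "\<eta> (ab q) = q" if "q \<in> Q" for q using coords(5) that by blast
    show "\<eta> w \<in> F i" if "i \<in> {1..4}" "w \<in> unit_square" "on_side i w" for i w
      using coords(6) that by blast
    show "\<exists>i\<in>{1..4}. A = F i \<and> on_side i (ab q)" if "A \<in> facets P" "q \<in> Q" "q \<in> A" for A q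
      using coords(7) that by blast
  qed (fact assms(3) coords(1-4))+
  have "fundamental_group_map M x id \<in> mon (fundamental_group (subtopology M N) x) (fundamental_group M x)"
  proof (rule fundamental_group_map_mon)
    show "continuous_map (subtopology M N) M id"
      by (simp add: continuous_map_from_subtopology)
  qed (use homotopic_loops_in_section[OF assms(5)] in simp_all)
  then show ?thesis
    using belt_coxeter[OF assms(3)] by blast
qed

end
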